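(* Let $1<p<N$ and $0\le\mu<\left(\frac{N-p}{p}\right)^p$. Let $\Omega\subset\mathbb{R}^N$ be a bounded domain containing the origin and let $f\in L^{\frac Np}(\Omega)$ be a nonnegative function. If $u\in\mathcal{D}^{1,p}(\Omega)$ is a nonnegative weak supersolution of $$-\Delta_p u-\frac{\mu}{|x|^p}|u|^{p-2}u=f|u|^{p-2}u\quad\text{in }\Omega,$$ then $$u(x)\ge Cm|x|^{-\gamma_1}\quad\text{for } x\in\Omega,$$ where $m=\inf_{\Omega}u$ and $C=\inf_{x\in\partial\Omega}|x|^{\gamma_1}$.
   Context: $\Delta_p u=\operatorname{div}(|\nabla u|^{p-2}\nabla u)$, $p^*=\frac{Np}{N-p}$. $\mathcal{D}^{1,p}(\Omega)=\{v\in L^{p^*}(\Omega): v\text{ weakly differentiable and }\nabla v\in L^p(\Omega)\}$. A function $u\in\mathcal{D}^{1,p}(\Omega)$ is a weak subsolution of the equation in $\Omega$ if for every nonnegative $\varphi\in C_0^\infty(\Omega)$, $$\int_{\Omega}\Big(|\nabla u|^{p-2}\nabla u\cdot\nabla\varphi-\frac{\mu}{|x|^p}|u|^{p-2}u\varphi\Big)\le\int_{\Omega}f|u|^{p-2}u\varphi ,$$ and a weak supersolution if $-u$ is a weak subsolution. Pointwise inequalities hold almost everywhere, and $\inf_\Omega u$ is the essential infimum. $\gamma_1<\gamma_2$ are the two roots in $[0,\infty)$ of $\gamma^{p-2}[(p-1)\gamma^2-(N-p)\gamma]+\mu=0$ (the left side being read as $(p-1)\gamma^p-(N-p)\gamma^{p-1}+\mu$).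 They satisfy $0\le\gamma_1<\frac{N-p}{p}<\gamma_2\le\frac{N-p}{p-1}$. *)

theory Defs
  imports "HOL-Analysis.Analysis" "HOL-Probability.Essential_Supremum"
begin

text \<open>
  The space R^N is a type \<open>'a\<close> of class \<^class>\<open>euclidean_space\<close> with \<open>N = DIM('a)\<close>. A function on
  \<open>\<Omega>\<close> is represented by a total function on \<open>'a\<close> whose values outside \<open>\<Omega>\<close> are never used; only test
  functions are genuinely defined everywhere, being extended by zero.
\<close>

definition partial_deriv :: "'a::euclidean_space \<Rightarrow> ('a \<Rightarrow> real) \<Rightarrow> 'a \<Rightarrow> real"
  where "partial_deriv i f x = frechet_derivative f (at x) i"

definition grad :: "('a::euclidean_space \<Rightarrow> real) \<Rightarrow> 'a \<Rightarrow> 'a"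
  where "grad f x = (\<Sum>i\<in>Basis. partial_deriv i f x *\<^sub>R i)"

primrec C_k :: "nat \<Rightarrow> ('a::euclidean_space \<Rightarrow> real) \<Rightarrow> bool" where
  "C_k 0 f \<longleftrightarrow> continuous_on UNIV f"
| "C_k (Suc k) f \<longleftrightarrow> (\<forall>x. f differentiable at x) \<and> (\<forall>i\<in>Basis. C_k k (partial_deriv i f))"

definition C0_infinity :: "'a::euclidean_space set \<Rightarrow> ('a \<Rightarrow> real) set"
  where "C0_infinity \<Omega> =
    {\<phi>. (\<forall>k. C_k k \<phi>) \<and> compact (closure {x. \<phi> x \<noteq> 0}) \<and> closure {x. \<phi> x \<noteq> 0} \<subseteq> \<Omega>}"

definition in_Lp ::
    "real \<Rightarrow> 'a::euclidean_space set \<Rightarrow> ('a \<Rightarrow> 'b::{second_countable_topology, banach}) \<Rightarrow> bool"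
  where "in_Lp q \<Omega> g \<longleftrightarrow>
    g \<in> borel_measurable (lebesgue_on \<Omega>) \<and> integrable (lebesgue_on \<Omega>) (\<lambda>x. norm (g x) powr q)"

definition locally_integrable ::
    "'a::euclidean_space set \<Rightarrow> ('a \<Rightarrow> 'b::{second_countable_topology, banach}) \<Rightarrow> bool"
  where "locally_integrable \<Omega> g \<longleftrightarrow> (\<forall>K. compact K \<and> K \<subseteq> \<Omega> \<longrightarrow> set_integrable lebesgue K g)"

definition has_weak_gradient ::
    "'a::euclidean_space set \<Rightarrow> ('a \<Rightarrow> real) \<Rightarrow> ('a \<Rightarrow> 'a) \<Rightarrow> bool"
  where "has_weak_gradient \<Omega> u G \<longleftrightarrow>
    locally_integrable \<Omega> u \<and> locally_integrable \<Omega> G \<and>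
    (\<forall>\<phi>\<in>C0_infinity \<Omega>. \<forall>i\<in>Basis.
      (\<integral>x. u x * partial_deriv i \<phi> x \<partial>lebesgue_on \<Omega>) = - (\<integral>x. (G x \<bullet> i) * \<phi> x \<partial>lebesgue_on \<Omega>))"

definition weakly_differentiable :: "'a::euclidean_space set \<Rightarrow> ('a \<Rightarrow> real) \<Rightarrow> bool"
  where "weakly_differentiable \<Omega> u \<longleftrightarrow> (\<exists>G. has_weak_gradient \<Omega> u G)"

text \<open>
  A weak gradient is unique up to a null set of \<open>\<Omega>\<close>, and it is used below only under integrals and
  in \<open>in_Lp\<close>, so the choice of representative is immaterial.
\<close>

definition weak_grad :: "'a::euclidean_space set \<Rightarrow> ('a \<Rightarrow> real) \<Rightarrow> 'a \<Rightarrow> 'a"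
  where "weak_grad \<Omega> u = (SOME G. has_weak_gradient \<Omega> u G)"

definition D1p :: "real \<Rightarrow> 'a::euclidean_space set \<Rightarrow> ('a \<Rightarrow> real) set"
  where "D1p p \<Omega> = {v. in_Lp (real DIM('a) * p / (real DIM('a) - p)) \<Omega> v \<and>
    weakly_differentiable \<Omega> v \<and> in_Lp p \<Omega> (weak_grad \<Omega> v)}"

text \<open>
  The conventions \<open>0 powr a = 0\<close> and \<open>x / 0 = 0\<close> do no harm here: they give the vector
  \<open>|\<nabla>u|^(p-2) \<nabla>u\<close> and the number \<open>|u|^(p-2) u\<close> the value 0 where \<open>\<nabla>u\<close>, respectively \<open>u\<close>,
  vanishes (also for \<open>p < 2\<close>), and otherwise concern only the null set \<open>{0}\<close>.
  If \<open>1 < p < N\<close>, \<open>u\<close> is in \<open>D1p p \<Omega>\<close> and \<open>f\<close> is in \<open>L^(N/p)\<close>, both integrands are integrable by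
  Hoelder's inequality.
\<close>

definition weak_subsolution ::
    "real \<Rightarrow> real \<Rightarrow> ('a \<Rightarrow> real) \<Rightarrow> 'a::euclidean_space set \<Rightarrow> ('a \<Rightarrow> real) \<Rightarrow> bool"
  where "weak_subsolution p \<mu> f \<Omega> u \<longleftrightarrow> u \<in> D1p p \<Omega> \<and>
    (\<forall>\<phi>\<in>C0_infinity \<Omega>. (\<forall>x. 0 \<le> \<phi> x) \<longrightarrow>
      (\<integral>x. (norm (weak_grad \<Omega> u x) powr (p - 2) *\<^sub>R weak_grad \<Omega> u x) \<bullet> grad \<phi> x
            - \<mu> / norm x powr p * \<bar>u x\<bar> powr (p - 2) * u x * \<phi> x \<partial>lebesgue_on \<Omega>)
      \<le> (\<integral>x. f x * \<bar>u x\<bar> powr (p - 2) * u x * \<phi> x \<partial>lebesgue_on \<Omega>))"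

definition weak_supersolution ::
    "real \<Rightarrow> real \<Rightarrow> ('a \<Rightarrow> real) \<Rightarrow> 'a::euclidean_space set \<Rightarrow> ('a \<Rightarrow> real) \<Rightarrow> bool"
  where "weak_supersolution p \<mu> f \<Omega> u \<longleftrightarrow> weak_subsolution p \<mu> f \<Omega> (\<lambda>x. - u x)"

text \<open>
  The essential infimum lives in \<^typ>\<open>ereal\<close>, because \<^const>\<open>esssup\<close> needs a complete order. It is
  finite if \<open>u\<close> is measurable and almost everywhere nonnegative and \<open>\<Omega>\<close> has positive measure.
\<close>

definition ess_inf :: "'a::euclidean_space set \<Rightarrow> ('a \<Rightarrow> real) \<Rightarrow> ereal"
  where "ess_inf \<Omega> u = - esssup (lebesgue_on \<Omega>) (\<lambda>x. - ereal (u x))"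

end

theory Submission
  imports Defs
begin

text \<open>
  Let \<open>d\<close> be the distance of \<open>0\<close> to the boundary. Where \<open>|x| \<ge> d\<close> the bound is below \<open>m\<close>, so only
  the ball \<open>B\<close> of radius \<open>d\<close> matters. There the supersolution is compared with explicit radial
  functions \<open>v = exp V\<close>, by a Picone type argument: writing \<open>U = ln u\<close>, one tests the inequality for \<open>u\<close>
  with \<open>exp (p V - (p - 1) U) P(V - U)\<close> and the one for \<open>V\<close> with \<open>exp (p V) P(V - U)\<close>, where
  \<open>P(t) = (max 0 t)\<^sup>2\<close>. By Young's inequality all terms of the difference have one sign, so if \<open>V\<close> is a
  subsolution with a constant smaller than \<open>\<mu>\<close>, then \<open>P(V - U) = 0\<close> almost everywhere.

  In \<open>t = ln (|x| / d)\<close> take \<open>- |\<nabla>V|^(p-2) \<nabla>V = (K + \<delta> t) |x|^(-p) x\<close> with \<open>K = \<gamma>^(p-1)\<close>,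
  \<open>0 < \<gamma> < \<gamma>\<^sub>1\<close> and small \<open>\<delta> > 0\<close>. The term \<open>\<delta> t\<close> makes \<open>V\<close> tend to \<open>- \<infinity>\<close> at the origin, so that the
  test functions vanish near \<open>0\<close> and neither a cut-off nor Hardy's inequality is needed. For
  \<open>\<delta> \<rightarrow> 0\<close> and \<open>\<gamma> \<rightarrow> \<gamma>\<^sub>1\<close> the functions \<open>v\<close> converge to \<open>m (|x| / d)^(-\<gamma>\<^sub>1)\<close>.

  The test functions are not smooth: they are approximated by mollifying first \<open>u\<close> inside
  them and then the resulting continuously differentiable functions.
\<close>

subsection \<open>Continuity of translations in the mean\<close>

text \<open>With t = ln (|x| / d) and flux coefficient y(t), the subsolution condition for exp V
  with Hardy constant \<mu>' becomes y' + (N - p) y - (p - 1) |y|^(p/(p-1)) \<le> \<mu>'. A constant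
  y = \<gamma>^(p-1) belongs to the power |x|^(-\<gamma>), which blows up at the origin, where u is
  only known to be at least m. The slope \<delta> adds just \<delta> to the left side, while for t <
  0 it lowers y. That is harmless because (N - p) y - (p - 1) |y|^(p/(p-1)) increases up to y = ((N
  - p) / p)^(p-1), and \<open>\<gamma>\<^sub>1\<close>, as the smaller root, lies below (N - p) / p.
  Where y is negative, V decreases towards the origin. With v = exp V the test function for u is v^p
  u^(1-p) P(ln (v / u)), the function of Picone's inequality weighted by P; the derivative of P
  contributes a term whose sign is the monotonicity of the flux. The flux is nonlinear and does not
  commute with convolution. So u is mollified in the test functions alone, and the flux and
  potential in the inequality keep the true u; the favourable sign of the integrand appears only in
  the limit.\<close>

lemma lborel_distr_minus: "distr lborel borel (\<lambda>y. x - y) = (lborel :: 'a::euclidean_space measure)"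
proof -
  have "lborel = density (distr lborel borel (\<lambda>y. x + (-1) *\<^sub>R y)) (\<lambda>_. ennreal (\<bar>-1\<bar> ^ DIM('a)))"
    by (rule lborel_affine) simp
  then show ?thesis by (simp add: density_1)
qed

lemma integral_lborel_minus:
  fixes f :: "'a::euclidean_space \<Rightarrow> 'b::{banach, second_countable_topology}"
  assumes "f \<in> borel_measurable borel"
  shows "(LBINT y. f (x - y)) = (LBINT y. f y)"
proof -
  have "(LBINT y. f y) = (\<integral>y. f y \<partial>distr lborel borel (\<lambda>y. x - y))"
    by (simp add: lborel_distr_minus)
  also have "\<dots> = (LBINT y. f (x - y))"
    by (rule integral_distr) (use assms in auto)
  finally show ?thesis by simp
qed

lemma integrable_lborel_minus:
  fixes f :: "'a::euclidean_space \<Rightarrow> 'b::{banach, second_countable_topology}"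
  assumes "integrable lborel f"
  shows "integrable lborel (\<lambda>y. f (x - y))"
proof -
  have "integrable (distr lborel borel (\<lambda>y. x - y)) f"
    using assms by (simp add: lborel_distr_minus)
  then show ?thesis by (subst (asm) integrable_distr_eq) (use assms in auto)
qed

lemma integral_lborel_diff:
  fixes f :: "'a::euclidean_space \<Rightarrow> 'b::{banach, second_countable_topology}"
  assumes [measurable]: "f \<in> borel_measurable borel"
  shows "(LBINT y. f (y - x)) = (LBINT y. f y)"
proof -
  have "(\<lambda>y. f (0 - y)) \<in> borel_measurable borel" by measurable
  from integral_lborel_minus[OF this, of x] show ?thesis
    using integral_lborel_minus[OF assms, of 0] by simp
qed

lemma integrable_lborel_diff:
  fixes f :: "'a::euclidean_space \<Rightarrow> 'b::{banach, second_countable_topology}"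
  assumes "integrable lborel f"
  shows "integrable lborel (\<lambda>y. f (y - x))"
  using integrable_lborel_minus[OF integrable_lborel_minus[OF assms, of 0], of x] by simp

lemma integrable_lborel_translation_diff:
  fixes f :: "'a::euclidean_space \<Rightarrow> 'b::{banach, second_countable_topology}"
  assumes "integrable lborel f"
  shows "integrable lborel (\<lambda>x. norm (f (x - y) - f x))"
  using assms integrable_lborel_diff[OF assms] by auto


definition L1_translation_continuous ::
    "('a::euclidean_space \<Rightarrow> 'b::{banach, second_countable_topology}) \<Rightarrow> bool"
  where "L1_translation_continuous f \<longleftrightarrow> (\<forall>e>0. \<exists>\<delta>>0. \<forall>y. norm y < \<delta> \<longrightarrow>
    (LBINT x. norm (f (x - y) - f x)) \<le> e)"

text \<open>A three-term splitting works because translations preserve the L1 distance between f and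
  its approximant g. Through this lemma each class of functions below is reduced to a nicer
  one.\<close>

lemma L1_translation_continuous_closed:
  fixes f :: "'a::euclidean_space \<Rightarrow> 'b::{banach, second_countable_topology}"
  assumes f: "integrable lborel f"
    and approx: "\<And>e. 0 < e \<Longrightarrow>
      \<exists>g. integrable lborel g \<and> L1_translation_continuous g \<and> (LBINT x. norm (f x - g x)) \<le> e"
  shows "L1_translation_continuous f"
  unfolding L1_translation_continuous_def
proof (intro allI impI)
  fix e :: real assume "0 < e"
  then have e: "0 < e/3" by simp
  obtain g where g: "integrable lborel g" "L1_translation_continuous g"
    "(LBINT x. norm (f x - g x)) \<le> e/3"
    using approx[OF e] by auto
  obtain \<delta> where \<delta>: "\<delta> > 0"
    "\<And>y. norm y < \<delta> \<Longrightarrow> (LBINT x. norm (g (x - y) - g x)) \<le> e/3"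
    using g(2) e unfolding L1_translation_continuous_def by blast
  have fg: "integrable lborel (\<lambda>x. norm (f x - g x))" using f g by auto
  have "(LBINT x. norm (f (x - y) - f x)) \<le> e" if y: "norm y < \<delta>" for y
  proof -
    have "(LBINT x. norm (f (x - y) - f x)) \<le>
      (LBINT x. norm (f (x - y) - g (x - y)) + norm (g (x - y) - g x) + norm (f x - g x))"
    proof (rule integral_mono)
      show "integrable lborel (\<lambda>x. norm (f (x - y) - f x))"
        by (rule integrable_lborel_translation_diff[OF f])
      show "integrable lborel
        (\<lambda>x. norm (f (x - y) - g (x - y)) + norm (g (x - y) - g x) + norm (f x - g x))"
        using integrable_lborel_diff[OF fg, of y] integrable_lborel_translation_diff[OF g(1), of y] fg
        by auto
      show "norm (f (x - y) - f x) \<le>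
        norm (f (x - y) - g (x - y)) + norm (g (x - y) - g x) + norm (f x - g x)" for x
        proof -
        have "f (x - y) - f x = (f (x - y) - g (x - y)) + (g (x - y) - g x) + (g x - f x)" by simp
        then show ?thesis
          using norm_triangle_ineq[of "(f (x - y) - g (x - y)) + (g (x - y) - g x)" "g x - f x"]
            norm_triangle_ineq[of "f (x - y) - g (x - y)" "g (x - y) - g x"]
          by (metis (no_types, lifting) add_mono_thms_linordered_semiring(3) norm_minus_commute order_trans)
      qed
    qed
    also have "\<dots> = (LBINT x. norm (f (x - y) - g (x - y)))
        + (LBINT x. norm (g (x - y) - g x)) + (LBINT x. norm (f x - g x))"
      using integrable_lborel_diff[OF fg, of y] integrable_lborel_translation_diff[OF g(1), of y] fg
      by simp
    also have "(LBINT x. norm (f (x - y) - g (x - y))) = (LBINT x. norm (f x - g x))"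
      using integral_lborel_diff[of "\<lambda>x. norm (f x - g x)" y] fg by auto
    finally show ?thesis using g(3) \<delta>(2)[OF y] by linarith
  qed
  then show "\<exists>\<delta>>0. \<forall>y. norm y < \<delta> \<longrightarrow> (LBINT x. norm (f (x - y) - f x)) \<le> e"
    using \<delta>(1) by blast
qed

lemma L1_translation_continuous_Lipschitz:
  fixes g :: "'a::euclidean_space \<Rightarrow> real"
  assumes lip: "\<And>x y. \<bar>g x - g y\<bar> \<le> L * norm (x - y)" and L: "0 \<le> L"
    and U: "U \<in> sets lborel" "emeasure lborel U < \<infinity>"
    and supp: "\<And>x. x \<notin> U \<Longrightarrow> g x = 0"
    and g: "integrable lborel g"
  shows "L1_translation_continuous g"
  unfolding L1_translation_continuous_def
proof (intro allI impI)
  fix e :: real assume e: "0 < e"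
  define M where "M = (\<integral>x. indicator U x \<partial>lborel :: real)"
  have iU: "integrable lborel (indicator U :: 'a \<Rightarrow> real)" using U by simp
  have M: "0 \<le> M" unfolding M_def by simp
  \<comment> \<open>The translated difference lives on U and a translate of U, of total measure at
    most 2 M, and is at most L |y| there. The added 1 keeps the quotient meaningful when L or M is
    0.\<close>
  define \<delta> where "\<delta> = e / (2 * L * M + 1)"
  have \<delta>: "0 < \<delta>" unfolding \<delta>_def using e L M by (intro divide_pos_pos) (auto intro: add_nonneg_pos)
  have "(LBINT x. norm (g (x - y) - g x)) \<le> e" if y: "norm y < \<delta>" for y
  proof -
    have iU': "integrable lborel (\<lambda>x. indicator U (x - y) :: real)"
      by (rule integrable_lborel_diff[OF iU])
    have "(LBINT x. norm (g (x - y) - g x)) \<le>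
      (LBINT x. L * norm y * (indicator U (x - y) + indicator U x))"
    proof (rule integral_mono)
      show "norm (g (x - y) - g x) \<le> L * norm y * (indicator U (x - y) + indicator U x)" for x
      proof (cases "x - y \<in> U \<or> x \<in> U")
        case True
        then have "(1::real) \<le> indicator U (x - y) + indicator U x" by (auto simp: indicator_def)
        then have "L * norm y * 1 \<le> L * norm y * (indicator U (x - y) + indicator U x)"
          using L by (intro mult_left_mono) auto
        then show ?thesis using lip[of "x - y" x] by simp
      qed (auto simp: supp)
    qed (use iU iU' integrable_lborel_translation_diff[OF g, of y] in auto)
    also have "\<dots> = L * norm y * (2 * M)"
      using iU iU' integral_lborel_diff[of "indicator U :: 'a \<Rightarrow> real" y] U by (simp add: M_def)
    also have "\<dots> \<le> L * \<delta> * (2 * M)"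
      using y L M by (intro mult_right_mono mult_left_mono) auto
    also have "\<dots> \<le> e"
      
    proof -
      have "0 < 2 * L * M + 1" using L M by (simp add: add_nonneg_pos)
      then show ?thesis unfolding \<delta>_def using e by (simp add: field_simps)
    qed
    finally show ?thesis .
  qed
  then show "\<exists>\<delta>>0. \<forall>y. norm y < \<delta> \<longrightarrow> (LBINT x. norm (g (x - y) - g x)) \<le> e"
    using \<delta> by blast
qed

text \<open>The cut-offs min 1 (n dist(x, - U)) are Lipschitz and increase to the indicator of U, so
  dominated convergence reduces the claim to the Lipschitz case.\<close>

lemma L1_translation_continuous_indicator_open:
  fixes U :: "'a::euclidean_space set"
  assumes U: "open U" "emeasure lborel U < \<infinity>"
  shows "L1_translation_continuous (indicator U :: 'a \<Rightarrow> real)"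
proof (rule L1_translation_continuous_closed)
  have sU: "U \<in> sets lborel" using U by simp
  show iU: "integrable lborel (indicator U :: 'a \<Rightarrow> real)" using U sU by simp
  \<comment> \<open>\<open>infdist\<close> to the empty set is 0 by convention, so the cut-offs
    would all vanish if U were the whole space; finite measure excludes this.\<close>
  have ne: "- U \<noteq> {}" using U(2) 
  proof -
    have "U \<noteq> UNIV" using U(2) by auto
    then show ?thesis by blast
  qed
  have cl: "closed (- U)" using U(1) by (rule closed_Compl)
  define g where "g n x = min 1 (real n * infdist x (- U))" for n x
  have gb: "0 \<le> g n x" "g n x \<le> indicator U x" for n x
  proof -
    show "0 \<le> g n x" by (simp add: g_def infdist_nonneg)
    show "g n x \<le> indicator U x"
      by (cases "x \<in> U") (auto simp: g_def infdist_zero)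
  qed
  have gm: "g n \<in> borel_measurable lborel" for n
  proof -
    have "continuous_on UNIV (g n)"
      unfolding g_def by (intro continuous_intros continuous_on_infdist)
    then show ?thesis by (simp add: borel_measurable_continuous_onI)
  qed
  have gi: "integrable lborel (g n)" for n
    by (rule Bochner_Integration.integrable_bound[OF iU gm]) (use gb in auto)
  have lim: "(\<lambda>n. \<integral>x. norm (indicator U x - g n x) \<partial>lborel) \<longlonglongrightarrow> (\<integral>x. 0 \<partial>(lborel :: 'a measure))"
  proof (rule integral_dominated_convergence[where w = "indicator U :: 'a \<Rightarrow> real"])
    show "AE x in lborel. (\<lambda>n. norm (indicator U x - g n x)) \<longlonglongrightarrow> 0"
    proof (intro AE_I2)
      fix x
      show "(\<lambda>n. norm (indicator U x - g n x)) \<longlonglongrightarrow> 0"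
      proof (cases "x \<in> U")
        case True
        then have pos: "0 < infdist x (- U)"
          using cl ne by (meson ComplD infdist_pos_not_in_closed)
        obtain N where N: "1 < real N * infdist x (- U)"
          using pos reals_Archimedean3 by blast
        have "norm (indicator U x - g n x) = 0" if "N \<le> n" for n
        proof -
          have "real N * infdist x (- U) \<le> real n * infdist x (- U)"
            using that pos by (intro mult_right_mono) auto
          then show ?thesis using N True by (simp add: g_def)
        qed
        then show ?thesis
          by (intro tendsto_eventually) (auto simp: eventually_sequentially)
      next
        case False
        then have "g n x = 0" for n using gb[of n x] by (simp add: indicator_def)
        with False show ?thesis by simp
      qed
    qed
    show "AE x in lborel. norm (norm (indicator U x - g n x)) \<le> indicator U x" for n
    proof (intro AE_I2)
      fix x show "norm (norm (indicator U x - g n x)) \<le> indicator U x"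
        using gb[of n x] by auto
    qed
  qed (use iU gm sU in auto)
  fix e :: real assume "0 < e"
  then have "\<forall>\<^sub>F n in sequentially. (LBINT x. norm (indicator U x - g n x)) < e"
    using order_tendstoD(2)[OF lim, of e] by simp
  then obtain n where n: "(LBINT x. norm (indicator U x - g n x)) < e"
    by (auto simp: eventually_sequentially)
  have "L1_translation_continuous (g n)"
  proof (rule L1_translation_continuous_Lipschitz[OF _ _ sU U(2) _ gi])
    show "\<bar>g n x - g n y\<bar> \<le> real n * norm (x - y)" for x y
    proof -
      have "\<bar>g n x - g n y\<bar> \<le> \<bar>real n * infdist x (- U) - real n * infdist y (- U)\<bar>"
        unfolding g_def by linarith
      also have "\<dots> = real n * \<bar>infdist x (- U) - infdist y (- U)\<bar>"
        by (simp add: abs_mult flip: right_diff_distrib)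
      also have "\<bar>infdist x (- U) - infdist y (- U)\<bar> \<le> norm (x - y)"
        using infdist_triangle_abs[of x "- U" y] by (simp add: dist_norm)
      finally show ?thesis by (simp add: mult_left_mono)
    qed
    show "g n x = 0" if "x \<notin> U" for x using gb[of n x] that by simp
  qed auto
  then show "\<exists>g. integrable lborel g \<and> L1_translation_continuous g \<and>
      (LBINT x. norm (indicator U x - g x :: real)) \<le> e"
    using n gi by (intro exI[of _ "g n"]) auto
qed

text \<open>Outer regularity replaces A by an open set, up to a difference of measure below
  e.\<close>

lemma L1_translation_continuous_indicator:
  fixes A :: "'a::euclidean_space set"
  assumes A: "A \<in> sets lborel" "emeasure lborel A < \<infinity>"
  shows "L1_translation_continuous (indicator A :: 'a \<Rightarrow> real)"
proof (rule L1_translation_continuous_closed)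
  show iA: "integrable lborel (indicator A :: 'a \<Rightarrow> real)" using A by simp
  fix e :: real assume e: "0 < e"
  obtain U where U: "open U" "A \<subseteq> U" "U - A \<in> lmeasurable" "emeasure lebesgue (U - A) < ennreal e"
    using sets_lebesgue_outer_open[of A e] A e by auto
  have s: "U \<in> sets lborel" "U - A \<in> sets lborel" using U A by auto
  have m: "emeasure lborel (U - A) < ennreal e" using U(4) s by simp
  have "emeasure lborel U = emeasure lborel (A \<union> (U - A))" using U(2) by (simp add: Un_absorb1)
  also have "\<dots> \<le> emeasure lborel A + emeasure lborel (U - A)"
    using A s by (intro emeasure_subadditive) auto
  also have "\<dots> < \<infinity>" using A(2) less_trans[OF m ennreal_less_top] by simp
  finally have fU: "emeasure lborel U < \<infinity>" .
  have "(LBINT x. norm (indicator A x - indicator U x :: real)) = (LBINT x. indicator (U - A) x)"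
    using U(2) by (intro Bochner_Integration.integral_cong) (auto simp: indicator_def)
  also have "\<dots> = measure lborel (U - A)" using s by simp
  also have "\<dots> \<le> e"
    using m e by (simp add: measure_def enn2real_leI)
  finally show "\<exists>g. integrable lborel g \<and> L1_translation_continuous g \<and>
      (LBINT x. norm (indicator A x - g x :: real)) \<le> e"
    using L1_translation_continuous_indicator_open[OF U(1) fU] fU s
    by (intro exI[of _ "indicator U"]) auto
qed

lemma integrable_L1_translation_continuous:
  fixes f :: "'a::euclidean_space \<Rightarrow> 'b::{banach, second_countable_topology}"
  assumes "integrable lborel f"
  shows "L1_translation_continuous f"
  using assms
proof (induction rule: integrable_induct)
  case (base A c)
  show ?case
    unfolding L1_translation_continuous_def
  proof (intro allI impI)
    fix e :: real assume e: "0 < e"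
    have "0 < e / (norm c + 1)" using e by (simp add: add_nonneg_pos)
    then obtain \<delta> where \<delta>: "\<delta> > 0"
      "\<And>y. norm y < \<delta> \<Longrightarrow> (LBINT x. norm (indicator A (x - y) - indicator A x :: real)) \<le> e / (norm c + 1)"
      using L1_translation_continuous_indicator[OF base] unfolding L1_translation_continuous_def
      by blast
    have "(LBINT x. norm (indicator A (x - y) *\<^sub>R c - indicator A x *\<^sub>R c)) \<le> e" if "norm y < \<delta>" for y
    proof -
      have "(LBINT x. norm (indicator A (x - y) *\<^sub>R c - indicator A x *\<^sub>R c)) =
        (LBINT x. norm (indicator A (x - y) - indicator A x :: real) * norm c)"
        by (simp flip: scaleR_diff_left)
      also have "\<dots> = (LBINT x. norm (indicator A (x - y) - indicator A x :: real)) * norm c"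
        by simp
      also have "\<dots> \<le> e / (norm c + 1) * norm c"
        using \<delta>(2)[OF that] by (intro mult_right_mono) auto
      also have "\<dots> \<le> e"
      proof -
        have "0 < norm c + 1" by (simp add: add_nonneg_pos)
        then show ?thesis using e by (simp add: field_simps)
      qed
      finally show ?thesis .
    qed
    then show "\<exists>\<delta>>0. \<forall>y. norm y < \<delta> \<longrightarrow>
        (LBINT x. norm (indicator A (x - y) *\<^sub>R c - indicator A x *\<^sub>R c)) \<le> e"
      using \<delta>(1) by blast
  qed
next
  case (add f g)
  show ?case
    unfolding L1_translation_continuous_def
  proof (intro allI impI)
    fix e :: real assume "0 < e"
    then have e: "0 < e/2" by simp
    obtain a where a: "a > 0" "\<And>y. norm y < a \<Longrightarrow> (LBINT x. norm (f (x - y) - f x)) \<le> e/2"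
      using add(3) e unfolding L1_translation_continuous_def by blast
    obtain b where b: "b > 0" "\<And>y. norm y < b \<Longrightarrow> (LBINT x. norm (g (x - y) - g x)) \<le> e/2"
      using add(4) e unfolding L1_translation_continuous_def by blast
    have "(LBINT x. norm (f (x - y) + g (x - y) - (f x + g x))) \<le> e" if "norm y < min a b" for y
    proof -
      note i = integrable_lborel_translation_diff[OF add(1), of y]
        integrable_lborel_translation_diff[OF add(2), of y]
      have "integrable lborel (\<lambda>x. f x + g x)" using add(1,2) by simp
      from integrable_lborel_translation_diff[OF this, of y]
      have "(LBINT x. norm (f (x - y) + g (x - y) - (f x + g x))) \<le>
        (LBINT x. norm (f (x - y) - f x) + norm (g (x - y) - g x))"
        using i by (intro integral_mono) (auto simp: norm_diff_triangle_ineq)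
      also have "\<dots> = (LBINT x. norm (f (x - y) - f x)) + (LBINT x. norm (g (x - y) - g x))"
        using i by simp
      finally show ?thesis using a(2)[of y] b(2)[of y] that by simp
    qed
    then show "\<exists>\<delta>>0. \<forall>y. norm y < \<delta> \<longrightarrow>
        (LBINT x. norm (f (x - y) + g (x - y) - (f x + g x))) \<le> e"
      using a(1) b(1) by (intro exI[of _ "min a b"]) auto
  qed
next
  case (lim f s)
  show ?case
  proof (rule L1_translation_continuous_closed[OF lim(4)])
    fix e :: real assume e: "0 < e"
    have "(\<lambda>n. \<integral>x. norm (f x - s n x) \<partial>lborel) \<longlonglongrightarrow> (\<integral>x. 0 \<partial>(lborel :: 'a measure))"
    proof (rule integral_dominated_convergence[where w = "\<lambda>x. 3 * norm (f x)"])
      show "AE x in lborel. (\<lambda>n. norm (f x - s n x)) \<longlonglongrightarrow> 0"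
      proof (intro AE_I2)
        fix x
        have "(\<lambda>n. norm (f x - s n x)) \<longlonglongrightarrow> norm (f x - f x)"
          using lim(2)[of x] by (intro tendsto_intros) auto
        then show "(\<lambda>n. norm (f x - s n x)) \<longlonglongrightarrow> 0" by simp
      qed
      show "AE x in lborel. norm (norm (f x - s n x)) \<le> 3 * norm (f x)" for n
      proof (intro AE_I2)
        fix x
        show "norm (norm (f x - s n x)) \<le> 3 * norm (f x)"
          using lim(3)[of x n] norm_triangle_ineq4[of "f x" "s n x"] by simp
      qed
    qed (use lim(1,4) in auto)
    then have "\<forall>\<^sub>F n in sequentially. (LBINT x. norm (f x - s n x)) < e"
      using order_tendstoD(2) e by fastforce
    then obtain n where "(LBINT x. norm (f x - s n x)) < e"
      by (auto simp: eventually_sequentially)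
    then show "\<exists>g. integrable lborel g \<and> L1_translation_continuous g \<and>
        (LBINT x. norm (f x - g x)) \<le> e"
      using lim(1,5) by (intro exI[of _ "s n"]) auto
  qed
qed

subsection \<open>Smooth functions\<close>

lemma partial_deriv_eq: "(f has_derivative f') (at x) \<Longrightarrow> partial_deriv i f x = f' i"
  unfolding partial_deriv_def using frechet_derivative_at by metis

lemma C_k_Suc_imp_C_k: "C_k (Suc k) f \<Longrightarrow> C_k k f"
proof (induction k arbitrary: f)
  case 0
  then show ?case
    by (auto intro: differentiable_imp_continuous_on simp: differentiable_on_def
        differentiable_at_withinI)
qed auto

lemma C_k_const: "C_k k (\<lambda>x. c)"
proof (induction k arbitrary: c)
  case (Suc k)
  have "partial_deriv i (\<lambda>x. c) = (\<lambda>x. 0)" for i :: 'a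
    by (rule ext, rule partial_deriv_eq[where f' = "\<lambda>_. 0"]) auto
  then show ?case using Suc by auto
qed auto

lemma C_k_inner_left: "C_k k (\<lambda>x. x \<bullet> i)"
proof (cases k)
  case (Suc l)
  have "partial_deriv j (\<lambda>x. x \<bullet> i) = (\<lambda>x. j \<bullet> i)" for j :: 'a
    by (rule ext, rule partial_deriv_eq[where f' = "\<lambda>h. h \<bullet> i"]) (auto intro!: derivative_eq_intros)
  moreover have "(\<lambda>x. x \<bullet> i) differentiable at x" for x :: 'a
    unfolding differentiable_def
    by (rule exI[of _ "\<lambda>h. h \<bullet> i"]) (auto intro!: derivative_eq_intros)
  ultimately show ?thesis using Suc by (auto simp: C_k_const)
qed (auto intro!: continuous_intros)

lemma C_k_add: "C_k k f \<Longrightarrow> C_k k g \<Longrightarrow> C_k k (\<lambda>x. f x + g x)"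
proof (induction k arbitrary: f g)
  case (Suc k)
  have d: "f differentiable at x" "g differentiable at x" for x using Suc by auto
  have "partial_deriv i (\<lambda>x. f x + g x) = (\<lambda>x. partial_deriv i f x + partial_deriv i g x)" for i
  proof (rule ext)
    fix x
    have "((\<lambda>x. f x + g x) has_derivative
      (\<lambda>h. frechet_derivative f (at x) h + frechet_derivative g (at x) h)) (at x)"
      using d[of x] by (intro has_derivative_add) (auto simp: frechet_derivative_works)
    from partial_deriv_eq[OF this]
    show "partial_deriv i (\<lambda>x. f x + g x) x = partial_deriv i f x + partial_deriv i g x"
      by (simp add: partial_deriv_def)
  qed
  then show ?case using Suc d by (auto intro!: differentiable_add)
qed (auto intro!: continuous_intros)

lemma C_k_mult: "C_k k f \<Longrightarrow> C_k k g \<Longrightarrow> C_k k (\<lambda>x. f x * g x)"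
proof (induction k arbitrary: f g)
  case (Suc k)
  have d: "f differentiable at x" "g differentiable at x" for x using Suc by auto
  have "partial_deriv i (\<lambda>x. f x * g x) = (\<lambda>x. f x * partial_deriv i g x + partial_deriv i f x * g x)" for i
  proof (rule ext)
    fix x
    have "((\<lambda>x. f x * g x) has_derivative
      (\<lambda>h. f x * frechet_derivative g (at x) h + frechet_derivative f (at x) h * g x)) (at x)"
      using d[of x] by (intro has_derivative_mult) (auto simp: frechet_derivative_works)
    from partial_deriv_eq[OF this]
    show "partial_deriv i (\<lambda>x. f x * g x) x = f x * partial_deriv i g x + partial_deriv i f x * g x"
      by (simp add: partial_deriv_def)
  qed
  then show ?case using Suc d C_k_Suc_imp_C_k[OF Suc.prems(1)] C_k_Suc_imp_C_k[OF Suc.prems(2)]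
    by (auto intro!: differentiable_mult C_k_add Suc.IH)
qed (auto intro!: continuous_intros)

text \<open>The index n makes the family closed under differentiation up to linear combinations, so
  that smoothness of the standard bump function follows by one induction.\<close>

definition flat_exp :: "nat \<Rightarrow> real \<Rightarrow> real"
  where "flat_exp n s = (if 0 < s then exp (- (1 / s)) / s ^ n else 0)"

lemma flat_exp_nonneg: "0 \<le> flat_exp n s"
  by (simp add: flat_exp_def)

text \<open>The term of index n + 2 in the series of exp (1 / s) already beats the denominator s^n
  by two powers of s. The quadratic decay makes the difference quotient at 0 tend to 0.\<close>

lemma flat_exp_le: "\<bar>flat_exp n s\<bar> \<le> fact (n + 2) * s\<^sup>2"
proof (cases "0 < s")
  case True
  have "sum (\<lambda>k. (1 / s) ^ k /\<^sub>R fact k) {n + 2} \<le> (\<Sum>k. (1 / s) ^ k /\<^sub>R fact k)"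
    using True sums_summable[OF exp_converges[of "1 / s"]] by (intro sum_le_suminf) auto
  then have "(1 / s) ^ (n + 2) / fact (n + 2) \<le> exp (1 / s)"
    using sums_unique[OF exp_converges[of "1 / s"]] by (simp add: divide_inverse mult.commute)
  then have "exp (- (1 / s)) \<le> inverse ((1 / s) ^ (n + 2) / fact (n + 2))"
    unfolding exp_minus using True by (intro le_imp_inverse_le) auto
  also have "\<dots> = fact (n + 2) * s\<^sup>2 * s ^ n"
    using True by (simp add: power_divide power_add power2_eq_square field_simps)
  finally show ?thesis using True by (simp add: flat_exp_def divide_le_eq)
qed (simp add: flat_exp_def)

lemma DERIV_flat_exp:
  "(flat_exp n has_real_derivative flat_exp (n + 2) s - real n * flat_exp (n + 1) s) (at s)"
proof -
  consider "s < 0" | "s = 0" | "0 < s" by linarith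
  then show ?thesis
  proof cases
    case 1
    have "((\<lambda>_. 0) has_real_derivative 0) (at s)" by simp
    then have "(flat_exp n has_real_derivative 0) (at s)"
      by (rule has_field_derivative_transform_within_open[where S = "{..<0}"])
        (use 1 in \<open>auto simp: flat_exp_def\<close>)
    then show ?thesis using 1 by (simp add: flat_exp_def)
  next
    case 2
    have "((\<lambda>h. (flat_exp n (0 + h) - flat_exp n 0) / h) \<longlongrightarrow> 0) (at 0)"
    proof (rule Lim_null_comparison)
      show "\<forall>\<^sub>F h in at 0. norm ((flat_exp n (0 + h) - flat_exp n 0) / h) \<le> fact (n + 2) * \<bar>h\<bar>"
      proof (rule eventually_at_filter[THEN iffD2], rule always_eventually, intro allI impI)
        fix h :: real assume "h \<noteq> 0"
        then show "norm ((flat_exp n (0 + h) - flat_exp n 0) / h) \<le> fact (n + 2) * \<bar>h\<bar>"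
          using flat_exp_le[of n h]
          by (simp add: flat_exp_def[of n 0] divide_le_eq power2_eq_square abs_mult_self_eq flip: abs_mult)
      qed
      show "((\<lambda>h. fact (n + 2) * \<bar>h\<bar>) \<longlongrightarrow> 0) (at (0::real))"
        by (auto intro!: tendsto_eq_intros)
    qed
    then show ?thesis using 2 by (simp add: DERIV_def flat_exp_def)
  next
    case 3
    have "((\<lambda>s. exp (- (1 / s)) / s ^ n) has_real_derivative
      flat_exp (n + 2) s - real n * flat_exp (n + 1) s) (at s)"
      using 3
      by (auto intro!: derivative_eq_intros simp: flat_exp_def field_simps power2_eq_square)
        (cases n; simp add: field_simps)
    then show ?thesis
      by (rule has_field_derivative_transform_within_open[where S = "{0<..}"])
        (use 3 in \<open>auto simp: flat_exp_def\<close>)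
  qed
qed

text \<open>The induction on k covers all n at once, because a partial derivative raises the index
  by one or two.\<close>

lemma C_k_flat_exp: "C_k k (\<lambda>x. flat_exp n (c - x \<bullet> x))"
proof (induction k arbitrary: n)
  case 0
  have "isCont (flat_exp n) s" for s using DERIV_flat_exp DERIV_isCont by blast
  then have "continuous_on UNIV (flat_exp n)" by (simp add: continuous_at_imp_continuous_on)
  then show ?case
    by (auto intro!: continuous_on_compose2[of UNIV "flat_exp n"] continuous_intros)
next
  case (Suc k)
  have D: "((\<lambda>x. flat_exp n (c - x \<bullet> x)) has_derivative
    (\<lambda>h. - 2 * (x \<bullet> h) * (flat_exp (n + 2) (c - x \<bullet> x) - real n * flat_exp (n + 1) (c - x \<bullet> x)))) (at x)"
    for x :: 'a
  proof -
    have "((\<lambda>x. c - x \<bullet> x) has_derivative (\<lambda>h. - 2 * (x \<bullet> h))) (at x)"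
      by (auto intro!: derivative_eq_intros simp: inner_commute)
    from has_derivative_compose[OF this DERIV_flat_exp[of n "c - x \<bullet> x", unfolded has_field_derivative_def]]
    show ?thesis by (simp add: mult_ac)
  qed
  have "partial_deriv i (\<lambda>x. flat_exp n (c - x \<bullet> x)) = (\<lambda>x. - 2 * (x \<bullet> i) *
     (flat_exp (n + 2) (c - x \<bullet> x) + - real n * flat_exp (n + 1) (c - x \<bullet> x)))" for i :: 'a
    by (rule ext, subst partial_deriv_eq[OF D]) simp
  moreover have "(\<lambda>x. flat_exp n (c - x \<bullet> x)) differentiable at x" for x :: 'a
    using D[of x] by (auto simp: differentiable_def)
  moreover have "C_k k (\<lambda>x. - 2 * (x \<bullet> i) *
     (flat_exp (n + 2) (c - x \<bullet> x) + - real n * flat_exp (n + 1) (c - x \<bullet> x)))" for i :: 'a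
    by (intro C_k_mult C_k_add C_k_const C_k_inner_left Suc)
  ultimately show ?case by simp
qed

definition mollifier :: "real \<Rightarrow> ('a::euclidean_space \<Rightarrow> real) \<Rightarrow> bool"
  where "mollifier r \<rho> \<longleftrightarrow> \<rho> \<in> C0_infinity UNIV \<and> (\<forall>x. 0 \<le> \<rho> x) \<and>
    (\<forall>x. r \<le> norm x \<longrightarrow> \<rho> x = 0) \<and> integral\<^sup>L lborel \<rho> = 1"

lemma C0_infinityI:
  assumes "\<And>k. C_k k \<phi>" "compact K" "K \<subseteq> \<Omega>" "\<And>x. x \<notin> K \<Longrightarrow> \<phi> x = 0"
  shows "\<phi> \<in> C0_infinity \<Omega>"
proof -
  have "{x. \<phi> x \<noteq> 0} \<subseteq> K" using assms(4) by auto
  then have c: "closure {x. \<phi> x \<noteq> 0} \<subseteq> K"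
    using assms(2) by (simp add: closure_minimal compact_imp_closed)
  then have "compact (closure {x. \<phi> x \<noteq> 0})"
    using assms(2) by (metis closed_closure compact_Int_closed inf.absorb_iff2)
  then show ?thesis using c assms by (auto simp: C0_infinity_def)
qed

lemma C0_infinity_support:
  assumes "\<phi> \<in> C0_infinity \<Omega>"
  shows "\<exists>K. compact K \<and> K \<subseteq> \<Omega> \<and> (\<forall>x. x \<notin> K \<longrightarrow> \<phi> x = 0)"
  using assms closure_subset[of "{x. \<phi> x \<noteq> 0}"] unfolding C0_infinity_def by blast

lemma continuous_compact_support_integrable:
  fixes f :: "'a::euclidean_space \<Rightarrow> 'b::{banach, second_countable_topology}"
  assumes f: "continuous_on UNIV f" and K: "compact K" "\<And>x. x \<notin> K \<Longrightarrow> f x = 0"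
  shows "integrable lborel f"
proof -
  have "integrable lborel (\<lambda>x. indicator K x *\<^sub>R f x)"
    using K f by (intro borel_integrable_compact) (auto intro: continuous_on_subset)
  moreover have "(\<lambda>x. indicator K x *\<^sub>R f x) = f" using K by (auto simp: indicator_def)
  ultimately show ?thesis by simp
qed

lemma C0_infinity_continuous: "\<phi> \<in> C0_infinity \<Omega> \<Longrightarrow> continuous_on UNIV \<phi>"
  unfolding C0_infinity_def using C_k.simps(1) by blast

lemma C0_infinity_integrable: "\<phi> \<in> C0_infinity \<Omega> \<Longrightarrow> integrable lborel \<phi>"
  by (meson C0_infinity_continuous C0_infinity_support continuous_compact_support_integrable)

lemma mollifier_exists:
  assumes r: "0 < r"
  shows "\<exists>\<rho> :: 'a::euclidean_space \<Rightarrow> real. mollifier r \<rho>"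
proof -
  define \<psi> where "\<psi> x = flat_exp 0 (r\<^sup>2 - x \<bullet> x)" for x :: 'a
  have z: "\<psi> x = 0" if "r \<le> norm x" for x
  proof -
    have "r\<^sup>2 \<le> (norm x)\<^sup>2" using that r by (intro power_mono) auto
    then show ?thesis by (simp add: \<psi>_def flat_exp_def dot_square_norm)
  qed
  have C: "C_k k (\<lambda>x. c * \<psi> x)" for k c
    unfolding \<psi>_def by (intro C_k_mult C_k_const C_k_flat_exp)
  have m: "(\<lambda>x. c * \<psi> x) \<in> C0_infinity UNIV" for c
    by (rule C0_infinityI[of _ "cball 0 r"]) (use z C in auto)
  have i: "integrable lborel \<psi>"
    using C0_infinity_integrable[OF m[of 1]] by simp
  \<comment> \<open>\<beta> is the value of \<psi> on the sphere |x| = r/2, hence a lower bound of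
    \<psi> inside it; this makes the integral of \<psi> positive.\<close>
  define \<beta> where "\<beta> = flat_exp 0 (3 * r\<^sup>2 / 4)"
  have \<beta>: "0 < \<beta>" using r by (simp add: \<beta>_def flat_exp_def)
  have "0 < \<beta> * measure lborel (ball 0 (r/2) :: 'a set)"
    using \<beta> r content_ball_pos[of "r/2" "0::'a"] by simp
  also have "\<dots> = (LBINT x. \<beta> * indicator (ball 0 (r/2) :: 'a set) x)" by simp
  also have "\<dots> \<le> (LBINT x. \<psi> x)"
  proof (rule integral_mono)
    fix x :: 'a
    show "\<beta> * indicator (ball 0 (r/2)) x \<le> \<psi> x"
    proof (cases "norm x < r/2")
      case True
      then have "norm x ^ 2 \<le> (r/2)^2" by (intro power_mono) auto
      then have le: "3 * r\<^sup>2 / 4 \<le> r\<^sup>2 - x \<bullet> x" by (simp add: dot_square_norm power_divide)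
      have p: "0 < 3 * r\<^sup>2 / 4" using r by simp
      have "1 / (r\<^sup>2 - x \<bullet> x) \<le> 1 / (3 * r\<^sup>2 / 4)"
        using le p by (intro divide_left_mono mult_pos_pos) linarith+
      moreover have "0 < r\<^sup>2 - x \<bullet> x" using le p by linarith
      ultimately have "\<beta> \<le> \<psi> x" using p by (simp add: \<beta>_def \<psi>_def flat_exp_def)
      then show ?thesis by (simp add: indicator_def flat_exp_nonneg \<psi>_def)
    qed (simp add: flat_exp_nonneg \<psi>_def)
  qed (use i emeasure_bounded_finite[OF bounded_ball, of "0::'a" "r/2"] in auto)
  finally have pos: "0 < integral\<^sup>L lborel \<psi>" .
  have "mollifier r (\<lambda>x. (1 / integral\<^sup>L lborel \<psi>) * \<psi> x)"
    unfolding mollifier_def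
  proof (intro conjI allI impI m)
    show "0 \<le> (1 / integral\<^sup>L lborel \<psi>) * \<psi> x" for x
      using pos by (simp add: \<psi>_def flat_exp_nonneg)
  qed (use z pos in auto)
  then show ?thesis by blast
qed

subsection \<open>Continuously differentiable functions and convolution\<close>

text \<open>The gradient is carried along as an explicit field, so that formulas for it can be
  computed and estimated. The test functions of the comparison belong to this class, not to
  \<open>C0_infinity\<close>.\<close>

definition C1_grad :: "('a::euclidean_space \<Rightarrow> real) \<Rightarrow> ('a \<Rightarrow> 'a) \<Rightarrow> bool"
  where "C1_grad \<phi> \<Phi> \<longleftrightarrow>
    continuous_on UNIV \<Phi> \<and> (\<forall>x. (\<phi> has_derivative (\<lambda>h. \<Phi> x \<bullet> h)) (at x))"

lemma C1_grad_continuous: "C1_grad \<phi> \<Phi> \<Longrightarrow> continuous_on UNIV \<phi>"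
  unfolding C1_grad_def
  by (meson continuous_at_imp_continuous_on has_derivative_continuous)

lemma C1_grad_partial_deriv: "C1_grad \<phi> \<Phi> \<Longrightarrow> partial_deriv i \<phi> x = \<Phi> x \<bullet> i"
  unfolding C1_grad_def by (intro partial_deriv_eq) auto

lemma C1_grad_grad: "C1_grad \<phi> \<Phi> \<Longrightarrow> grad \<phi> = \<Phi>"
  by (rule ext) (simp add: grad_def C1_grad_partial_deriv euclidean_representation)

lemma C0_infinity_C1_grad:
  fixes \<phi> :: "'a::euclidean_space \<Rightarrow> real"
  assumes "\<phi> \<in> C0_infinity \<Omega>"
  shows "C1_grad \<phi> (grad \<phi>)"
proof -
  have "C_k (Suc 0) \<phi>" using assms by (auto simp: C0_infinity_def simp del: C_k.simps)
  then have d: "\<phi> differentiable at x" and c: "i \<in> Basis \<Longrightarrow> continuous_on UNIV (partial_deriv i \<phi>)" for x i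
    by auto
  show ?thesis
    unfolding C1_grad_def
  proof (intro conjI allI)
    show "continuous_on UNIV (grad \<phi>)"
      unfolding grad_def using c by (intro continuous_intros) auto
    fix x
    have D: "(\<phi> has_derivative frechet_derivative \<phi> (at x)) (at x)"
      using d[of x] by (simp add: frechet_derivative_works)
    then have lin: "linear (frechet_derivative \<phi> (at x))"
      using has_derivative_linear by blast
    have "frechet_derivative \<phi> (at x) h = grad \<phi> x \<bullet> h" for h
    proof -
      have "frechet_derivative \<phi> (at x) h = frechet_derivative \<phi> (at x) (\<Sum>i\<in>Basis. (h \<bullet> i) *\<^sub>R i)"
        by (simp add: euclidean_representation)
      also have "\<dots> = (\<Sum>i\<in>Basis. (h \<bullet> i) * frechet_derivative \<phi> (at x) i)"
        using lin by (simp add: linear_sum linear_cmul)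
      also have "\<dots> = grad \<phi> x \<bullet> h"
        by (simp add: grad_def partial_deriv_def inner_sum_left inner_commute[of h] mult.commute)
      finally show ?thesis .
    qed
    then have "frechet_derivative \<phi> (at x) = (\<lambda>h. grad \<phi> x \<bullet> h)" by (rule ext)
    with D show "(\<phi> has_derivative (\<lambda>h. grad \<phi> x \<bullet> h)) (at x)" by simp
  qed
qed

lemma C1_grad_eq_0_off_closed:
  assumes "C1_grad \<phi> \<Phi>" and K: "closed K" "\<And>x. x \<notin> K \<Longrightarrow> \<phi> x = 0" and x: "x \<notin> K"
  shows "\<Phi> x = 0"
proof -
  have "(\<phi> has_derivative (\<lambda>h. \<Phi> x \<bullet> h)) (at x)" using assms by (auto simp: C1_grad_def)
  moreover have "(\<phi> has_derivative (\<lambda>h. 0)) (at x)"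
    by (rule has_derivative_transform_within_open[of "\<lambda>_. 0" _ x UNIV "- K"])
      (use K x in \<open>auto simp: open_Compl\<close>)
  ultimately have "(\<lambda>h. \<Phi> x \<bullet> h) = (\<lambda>h. 0)" by (rule has_derivative_unique)
  then have "\<Phi> x \<bullet> \<Phi> x = 0" by metis
  then show ?thesis by simp
qed

lemma uniformly_continuous_compact_support:
  fixes f :: "'a::euclidean_space \<Rightarrow> 'b::real_normed_vector"
  assumes f: "continuous_on UNIV f" and K: "compact K" "\<And>x. x \<notin> K \<Longrightarrow> f x = 0" and e: "0 < e"
  shows "\<exists>\<delta>>0. \<forall>x y. norm (x - y) < \<delta> \<longrightarrow> norm (f x - f y) \<le> e"
proof -
  obtain R where R: "K \<subseteq> cball 0 R"
    using compact_imp_bounded[OF K(1)] bounded_subset_ballD[of K 0] ball_subset_cball by blast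
  \<comment> \<open>The margin 1 in the radius, together with the bound 1 on |x - y|, takes care of
    pairs with only one point in K.\<close>
  have "uniformly_continuous_on (cball 0 (R + 1)) f"
    using f by (intro compact_uniformly_continuous) (auto intro: continuous_on_subset)
  then obtain \<delta> where \<delta>: "\<delta> > 0"
    "\<And>x y. x \<in> cball 0 (R + 1) \<Longrightarrow> y \<in> cball 0 (R + 1) \<Longrightarrow> dist y x < \<delta> \<Longrightarrow> dist (f y) (f x) < e"
    using e unfolding uniformly_continuous_on_def by meson
  have "norm (f x - f y) \<le> e" if "norm (x - y) < min \<delta> 1" for x y
  proof (cases "x \<in> K \<or> y \<in> K")
    case True
    then have "norm x \<le> R \<or> norm y \<le> R" using R by auto
    then have "norm x \<le> R + 1" "norm y \<le> R + 1"
      using that norm_triangle_sub[of x y] norm_triangle_sub[of y x] by (auto simp: norm_minus_commute)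
    then show ?thesis using \<delta>(2)[of y x] that by (auto simp: dist_norm)
  next
    case False
    then show ?thesis using K e by auto
  qed
  then show ?thesis using \<delta>(1) by (intro exI[of _ "min \<delta> 1"]) auto
qed

lemma continuous_compact_support_bounded:
  fixes f :: "'a::euclidean_space \<Rightarrow> 'b::real_normed_vector"
  assumes f: "continuous_on UNIV f" and K: "compact K" "\<And>x. x \<notin> K \<Longrightarrow> f x = 0"
  shows "\<exists>B\<ge>0. \<forall>x. norm (f x) \<le> B"
proof -
  have "compact (f ` K)" using f K by (intro compact_continuous_image) (auto intro: continuous_on_subset)
  then obtain B where "\<forall>y\<in>f ` K. norm y \<le> B" using compact_imp_bounded bounded_iff by metis
  then have "norm (f x) \<le> max B 0" for x using K(2)[of x] by (cases "x \<in> K") (auto simp: max.coboundedI1)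
  then show ?thesis by (intro exI[of _ "max B 0"]) auto
qed

lemma kernel_integrable:
  fixes K :: "'a::euclidean_space \<Rightarrow> 'b::euclidean_space"
  assumes f: "integrable lborel f" and K: "continuous_on UNIV K" "compact S" "\<And>x. x \<notin> S \<Longrightarrow> K x = 0"
  shows "integrable lborel (\<lambda>y. f y *\<^sub>R K (x - y))"
proof -
  obtain B where B: "\<And>x. norm (K x) \<le> B"
    using continuous_compact_support_bounded[OF K] by auto
  have m: "K \<in> borel_measurable borel" using K(1) by (simp add: borel_measurable_continuous_onI)
  show ?thesis
  proof (rule Bochner_Integration.integrable_bound)
    show "integrable lborel (\<lambda>y. B * f y)" using f by simp
    show "(\<lambda>y. f y *\<^sub>R K (x - y)) \<in> borel_measurable lborel" using f m by measurable
    show "AE y in lborel. norm (f y *\<^sub>R K (x - y)) \<le> norm (B * f y)"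
    proof (intro AE_I2)
      fix y
      have "\<bar>f y\<bar> * norm (K (x - y)) \<le> \<bar>f y\<bar> * \<bar>B\<bar>"
        using B[of "x - y"] by (intro mult_left_mono) auto
      then show "norm (f y *\<^sub>R K (x - y)) \<le> norm (B * f y)" by (simp add: abs_mult mult.commute)
    qed
  qed
qed

lemma kernel_continuous:
  fixes K :: "'a::euclidean_space \<Rightarrow> 'b::euclidean_space"
  assumes f: "integrable lborel f" and K: "continuous_on UNIV K" "compact S" "\<And>x. x \<notin> S \<Longrightarrow> K x = 0"
  shows "continuous_on UNIV (\<lambda>x. \<integral>y. f y *\<^sub>R K (x - y) \<partial>lborel)"
  unfolding continuous_on_iff
proof (intro ballI allI impI)
  fix x :: 'a and e :: real assume e: "0 < e"
  define M where "M = (LBINT y. \<bar>f y\<bar>)"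
  have M: "0 \<le> M" by (simp add: M_def)
  define e' where "e' = e / (M + 1)"
  have e': "0 < e'" using e M by (simp add: e'_def)
  obtain \<delta> where \<delta>: "\<delta> > 0" "\<And>x y. norm (x - y) < \<delta> \<Longrightarrow> norm (K x - K y) \<le> e'"
    using uniformly_continuous_compact_support[OF K e'] by auto
  have "norm ((LBINT y. f y *\<^sub>R K (x' - y)) - (LBINT y. f y *\<^sub>R K (x - y))) < e"
    if "norm (x' - x) < \<delta>" for x'
  proof -
    note i = kernel_integrable[OF f K]
    have "(LBINT y. f y *\<^sub>R K (x' - y)) - (LBINT y. f y *\<^sub>R K (x - y))
      = (LBINT y. f y *\<^sub>R (K (x' - y) - K (x - y)))"
      using i by (simp add: scaleR_diff_right)
    also have "norm \<dots> \<le> (LBINT y. e' * \<bar>f y\<bar>)"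
    proof (rule Bochner_Integration.integral_norm_bound_integral)
      show "integrable lborel (\<lambda>y. f y *\<^sub>R (K (x' - y) - K (x - y)))"
        using i by (simp add: scaleR_diff_right)
      show "norm (f y *\<^sub>R (K (x' - y) - K (x - y))) \<le> e' * \<bar>f y\<bar>" for y
        using mult_left_mono[OF \<delta>(2)[of "x' - y" "x - y"], of "\<bar>f y\<bar>"] that by (simp add: mult.commute)
    qed (use f in auto)
    also have "\<dots> = e' * M" by (simp add: M_def)
    also have "\<dots> < e" using e M by (simp add: e'_def field_simps)
    finally show ?thesis .
  qed
  then show "\<exists>d>0. \<forall>x'\<in>UNIV. dist x' x < d \<longrightarrow>
    dist (LBINT y. f y *\<^sub>R K (x' - y)) (LBINT y. f y *\<^sub>R K (x - y)) < e"
    using \<delta>(1) unfolding dist_norm by blast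
qed

definition convol :: "('a::euclidean_space \<Rightarrow> real) \<Rightarrow> ('a \<Rightarrow> 'b::{banach, second_countable_topology}) \<Rightarrow> 'a \<Rightarrow> 'b"
  where "convol \<rho> f x = (LBINT y. \<rho> (x - y) *\<^sub>R f y)"

text \<open>The derivative falls on the kernel. Its gradient is uniformly continuous, so the
  linearisation error of \<psi> at x - y is small uniformly in y and can be integrated against
  |f|.\<close>

lemma convol_C1_grad:
  fixes f :: "'a::euclidean_space \<Rightarrow> real"
  assumes f: "integrable lborel f" and \<psi>: "C1_grad \<psi> \<Psi>"
    and S: "compact S" "\<And>x. x \<notin> S \<Longrightarrow> \<psi> x = 0"
  shows "C1_grad (convol \<psi> f) (\<lambda>x. \<integral>y. f y *\<^sub>R \<Psi> (x - y) \<partial>lborel)"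
proof -
  have c: "continuous_on UNIV \<Psi>" "continuous_on UNIV \<psi>"
    using \<psi> C1_grad_continuous by (auto simp: C1_grad_def)
  have z: "\<Psi> x = 0" if "x \<notin> S" for x
    using C1_grad_eq_0_off_closed[OF \<psi> compact_imp_closed[OF S(1)] S(2) that] by simp
  have D: "(\<psi> has_derivative (\<lambda>h. \<Psi> x \<bullet> h)) (at x)" for x using \<psi> by (simp add: C1_grad_def)
  note i = kernel_integrable[OF f c(2) S] and I = kernel_integrable[OF f c(1) S(1) z]
  show ?thesis
    unfolding C1_grad_def
  proof (intro conjI allI)
    show "continuous_on UNIV (\<lambda>x. \<integral>y. f y *\<^sub>R \<Psi> (x - y) \<partial>lborel)"
      by (rule kernel_continuous[OF f c(1) S(1) z])
    fix x
    define M where "M = (LBINT y. \<bar>f y\<bar>)"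
    have M: "0 \<le> M" by (simp add: M_def)
    show "(convol \<psi> f has_derivative (\<lambda>h. (LBINT y. f y *\<^sub>R \<Psi> (x - y)) \<bullet> h)) (at x)"
      unfolding has_derivative_at_alt
    proof (intro conjI allI impI bounded_linear_inner_right)
      fix e :: real assume e: "0 < e"
      define e' where "e' = e / (M + 1)"
      have e': "0 < e'" using e M by (simp add: e'_def)
      obtain \<delta> where \<delta>: "\<delta> > 0" "\<And>x y. norm (x - y) < \<delta> \<Longrightarrow> norm (\<Psi> x - \<Psi> y) \<le> e'"
        using uniformly_continuous_compact_support[OF c(1) S(1) z e'] by auto
      have lin: "\<bar>\<psi> b - \<psi> a - \<Psi> a \<bullet> (b - a)\<bar> \<le> norm (b - a) * e'" if "norm (b - a) < \<delta>" for a b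
      proof -
        have "norm (\<psi> b - \<psi> a - \<Psi> a \<bullet> (b - a)) \<le> norm (b - a) * e'"
        proof (rule differentiable_bound_linearization[where S = "cball a (norm (b - a))" and f' = "\<lambda>x h. \<Psi> x \<bullet> h"])
          show "a + t *\<^sub>R (b - a) \<in> cball a (norm (b - a))" if "t \<in> {0..1}" for t
            using that by (auto simp: dist_norm intro: mult_left_le_one_le)
          show "(\<psi> has_derivative (\<lambda>h. \<Psi> x \<bullet> h)) (at x within cball a (norm (b - a)))" for x
            using D by (rule has_derivative_at_withinI)
          show "onorm ((\<lambda>h. \<Psi> x \<bullet> h) - (\<lambda>h. \<Psi> a \<bullet> h)) \<le> e'" if "x \<in> cball a (norm (b - a))" for x
          proof -
            have "norm (x - a) < \<delta>"
              using that \<open>norm (b - a) < \<delta>\<close> by (simp add: dist_norm norm_minus_commute)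
            then have "norm (\<Psi> x - \<Psi> a) \<le> e'" by (rule \<delta>(2))
            moreover have "onorm (\<lambda>h. \<Psi> x \<bullet> h - \<Psi> a \<bullet> h) \<le> norm (\<Psi> x - \<Psi> a)"
              by (rule onorm_le) (metis Cauchy_Schwarz_ineq2 inner_diff_left real_norm_def)
            ultimately show ?thesis by (simp add: fun_diff_def)
          qed
        qed auto
        then show ?thesis by simp
      qed
      have "norm (convol \<psi> f x' - convol \<psi> f x - (LBINT y. f y *\<^sub>R \<Psi> (x - y)) \<bullet> (x' - x)) \<le> e * norm (x' - x)"
        if "norm (x' - x) < \<delta>" for x'
      proof -
        have eq: "convol \<psi> f x' - convol \<psi> f x - (LBINT y. f y *\<^sub>R \<Psi> (x - y)) \<bullet> (x' - x)
          = (LBINT y. f y * (\<psi> (x' - y) - \<psi> (x - y) - \<Psi> (x - y) \<bullet> (x' - x)))"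
        proof -
          have J: "(LBINT y. f y * (\<Psi> (x - y) \<bullet> (x' - x))) = (LBINT y. f y *\<^sub>R \<Psi> (x - y)) \<bullet> (x' - x)"
            using integral_inner_left[of "x' - x" lborel "\<lambda>y. f y *\<^sub>R \<Psi> (x - y)"] I by simp
          show ?thesis
            using i[of x'] i[of x] integrable_inner_left[of "x' - x", OF I[of x]]
            unfolding right_diff_distrib[of "f _"] convol_def J[symmetric] by (simp add: mult.commute)
        qed
        have "norm (LBINT y. f y * (\<psi> (x' - y) - \<psi> (x - y) - \<Psi> (x - y) \<bullet> (x' - x)))
          \<le> (LBINT y. (norm (x' - x) * e') * \<bar>f y\<bar>)"
        proof (rule Bochner_Integration.integral_norm_bound_integral)
          show "integrable lborel (\<lambda>y. f y * (\<psi> (x' - y) - \<psi> (x - y) - \<Psi> (x - y) \<bullet> (x' - x)))"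
            using i[of x'] i[of x] integrable_inner_left[of "x' - x", OF I[of x]]
            unfolding right_diff_distrib[of "f _"] by simp
          show "norm (f y * (\<psi> (x' - y) - \<psi> (x - y) - \<Psi> (x - y) \<bullet> (x' - x))) \<le> norm (x' - x) * e' * \<bar>f y\<bar>" for y
            using mult_left_mono[OF lin[of "x' - y" "x - y"], of "\<bar>f y\<bar>"] that
            by (simp add: abs_mult mult.commute)
        qed (use f in auto)
        also have "\<dots> = norm (x' - x) * (e' * M)" by (simp add: M_def)
        also have "\<dots> \<le> norm (x' - x) * e"
          using e M by (intro mult_left_mono) (auto simp: e'_def field_simps)
        finally show ?thesis unfolding eq by (simp add: mult.commute)
      qed
      then show "\<exists>d>0. \<forall>x'. norm (x' - x) < d \<longrightarrow>
        norm (convol \<psi> f x' - convol \<psi> f x - (LBINT y. f y *\<^sub>R \<Psi> (x - y)) \<bullet> (x' - x)) \<le> e * norm (x' - x)"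
        using \<delta>(1) by blast
    qed
  qed
qed

lemma partial_deriv_C0_infinity:
  assumes \<psi>: "\<psi> \<in> C0_infinity \<Omega>" and i: "i \<in> Basis"
  shows "partial_deriv i \<psi> \<in> C0_infinity \<Omega>"
proof -
  obtain K where K: "compact K" "K \<subseteq> \<Omega>" "\<And>x. x \<notin> K \<Longrightarrow> \<psi> x = 0"
    using C0_infinity_support[OF \<psi>] by blast
  have "C_k (Suc k) \<psi>" for k using \<psi> by (auto simp: C0_infinity_def simp del: C_k.simps)
  then have "C_k k (partial_deriv i \<psi>)" for k using i by auto
  moreover have "partial_deriv i \<psi> x = 0" if "x \<notin> K" for x
    using C1_grad_eq_0_off_closed[OF C0_infinity_C1_grad[OF \<psi>] compact_imp_closed[OF K(1)] K(3) that]
      C1_grad_partial_deriv[OF C0_infinity_C1_grad[OF \<psi>], of i x] by simp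
  ultimately show ?thesis using C0_infinityI K by blast
qed

text \<open>The induction ranges over all kernels, since a partial derivative of the convolution is
  the convolution with a partial derivative of the kernel.\<close>

lemma C_k_convol:
  fixes f :: "'a::euclidean_space \<Rightarrow> real"
  assumes f: "integrable lborel f" and \<psi>: "\<psi> \<in> C0_infinity UNIV"
  shows "C_k k (convol \<psi> f)"
  using \<psi>
proof (induction k arbitrary: \<psi>)
  case 0
  obtain K where "compact K" and K: "\<And>x. x \<notin> K \<Longrightarrow> \<psi> x = 0"
    using C0_infinity_support[OF 0] by blast
  from C1_grad_continuous[OF convol_C1_grad[OF f C0_infinity_C1_grad[OF 0] this(1) K]]
  show ?case by simp
next
  case (Suc k)
  obtain K where K: "compact K" "\<And>x. x \<notin> K \<Longrightarrow> \<psi> x = 0"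
    using C0_infinity_support[OF Suc.prems] by blast
  note G = C0_infinity_C1_grad[OF Suc.prems]
  note C = convol_C1_grad[OF f G K]
  have z: "grad \<psi> x = 0" if "x \<notin> K" for x
    using C1_grad_eq_0_off_closed[OF G compact_imp_closed[OF K(1)] K(2) that] .
  have c: "continuous_on UNIV (grad \<psi>)" using G by (simp add: C1_grad_def)
  have "partial_deriv i (convol \<psi> f) = convol (partial_deriv i \<psi>) f" for i
  proof (rule ext)
    fix x
    have "partial_deriv i (convol \<psi> f) x = (LBINT y. f y *\<^sub>R grad \<psi> (x - y)) \<bullet> i"
      by (rule C1_grad_partial_deriv[OF C])
    also have "\<dots> = (LBINT y. (f y *\<^sub>R grad \<psi> (x - y)) \<bullet> i)"
      using integral_inner_left[of i lborel "\<lambda>y. f y *\<^sub>R grad \<psi> (x - y)"]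
        kernel_integrable[OF f c K(1) z] by simp
    also have "\<dots> = convol (partial_deriv i \<psi>) f x"
      unfolding convol_def by (simp add: C1_grad_partial_deriv[OF G] mult.commute)
    finally show "partial_deriv i (convol \<psi> f) x = convol (partial_deriv i \<psi>) f x" .
  qed
  moreover have "convol \<psi> f differentiable at x" for x
    using C unfolding C1_grad_def differentiable_def by blast
  ultimately show ?case using Suc.IH[OF partial_deriv_C0_infinity[OF Suc.prems]] by simp
qed

subsection \<open>Mollification\<close>

lemma mollifier_kernel:
  assumes "mollifier r \<rho>"
  shows "continuous_on UNIV \<rho>" "\<rho> \<in> borel_measurable borel" "integrable lborel \<rho>"
    "\<And>x. 0 \<le> \<rho> x" "\<And>x. x \<notin> cball 0 r \<Longrightarrow> \<rho> x = 0"
  using assms C0_infinity_continuous[of \<rho> UNIV] C0_infinity_integrable[of \<rho> UNIV]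
  by (auto simp: mollifier_def intro: borel_measurable_continuous_onI)

lemma mollifier_integral_shift:
  assumes "mollifier r \<rho>"
  shows "(LBINT y. \<rho> (x - y)) = 1" "integrable lborel (\<lambda>y. \<rho> (x - y))"
  using integral_lborel_minus[OF mollifier_kernel(2)[OF assms], of x] assms
    integrable_lborel_minus[OF mollifier_kernel(3)[OF assms], of x]
  by (auto simp: mollifier_def)

lemma mollifier_integrable:
  fixes f :: "'a::euclidean_space \<Rightarrow> 'b::{banach, second_countable_topology}"
  assumes \<rho>: "mollifier r \<rho>" and f: "integrable lborel f"
  shows "integrable lborel (\<lambda>y. \<rho> (x - y) *\<^sub>R f y)"
proof -
  have "integrable lborel (\<lambda>y. norm (f y) *\<^sub>R \<rho> (x - y))"
    by (rule kernel_integrable[OF _ mollifier_kernel(1)[OF \<rho>] compact_cball[of 0 r] mollifier_kernel(5)[OF \<rho>]])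
      (use f in auto)
  then show ?thesis
  proof (rule Bochner_Integration.integrable_bound)
    show "(\<lambda>y. \<rho> (x - y) *\<^sub>R f y) \<in> borel_measurable lborel"
      using f mollifier_kernel(2)[OF \<rho>] by measurable
  qed (auto simp: mult.commute)
qed

lemma convol_commute:
  fixes f :: "'a::euclidean_space \<Rightarrow> 'b::{banach, second_countable_topology}"
  assumes [measurable]: "\<rho> \<in> borel_measurable borel" "f \<in> borel_measurable borel"
  shows "convol \<rho> f x = (LBINT y. \<rho> y *\<^sub>R f (x - y))"
proof -
  have "(\<lambda>y. \<rho> y *\<^sub>R f (x - y)) \<in> borel_measurable borel" by measurable
  from integral_lborel_minus[OF this, of x] show ?thesis by (simp add: convol_def)
qed

lemma borel_measurable_convol:
  fixes f :: "'a::euclidean_space \<Rightarrow> 'b::{banach, second_countable_topology}"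
  assumes [measurable]: "\<rho> \<in> borel_measurable borel" "f \<in> borel_measurable borel"
  shows "convol \<rho> f \<in> borel_measurable borel"
proof -
  have "(\<lambda>x. \<integral>y. \<rho> (x - y) *\<^sub>R f y \<partial>lborel) \<in> borel_measurable borel" by measurable
  then show ?thesis by (simp add: convol_def[abs_def])
qed

text \<open>As \<rho> has integral 1, the difference is an average of f (x - y) - f x over |y| < r.
  Exchanging the order of integration bounds its L1 norm by the largest translation error.\<close>

lemma convol_diff_L1_bound:
  fixes f :: "'a::euclidean_space \<Rightarrow> 'b::{banach, second_countable_topology}"
  assumes \<rho>: "mollifier r \<rho>" and f: "integrable lborel f" and e: "0 \<le> e"
    and tr: "\<And>y. norm y < r \<Longrightarrow> (LBINT x. norm (f (x - y) - f x)) \<le> e"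
  shows "integrable lborel (\<lambda>x. convol \<rho> f x - f x)"
    "(LBINT x. norm (convol \<rho> f x - f x)) \<le> e"
proof -
  note [measurable] = mollifier_kernel(2)[OF \<rho>] and \<rho>0 = mollifier_kernel(4)[OF \<rho>]
  have fm[measurable]: "f \<in> borel_measurable borel" using f by auto
  have [measurable]: "convol \<rho> f \<in> borel_measurable borel"
    by (rule borel_measurable_convol) measurable
  have pw: "ennreal (norm (convol \<rho> f x - f x)) \<le> (\<integral>\<^sup>+y. ennreal (\<rho> y * norm (f (x - y) - f x)) \<partial>lborel)" for x
  proof -
    have i1: "integrable lborel (\<lambda>y. \<rho> y *\<^sub>R f (x - y))"
      using integrable_lborel_minus[OF mollifier_integrable[OF \<rho> f, of x], of x] by simp
    have i2: "integrable lborel (\<lambda>y. \<rho> y *\<^sub>R f x)"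
      using mollifier_kernel(3)[OF \<rho>] by simp
    have "convol \<rho> f x - f x = (LBINT y. \<rho> y *\<^sub>R f (x - y)) - (LBINT y. \<rho> y *\<^sub>R f x)"
      using \<rho> mollifier_kernel(3)[OF \<rho>] by (simp add: convol_commute mollifier_def)
    also have "\<dots> = (LBINT y. \<rho> y *\<^sub>R (f (x - y) - f x))"
      using i1 i2 by (simp add: scaleR_diff_right)
    finally have eq: "convol \<rho> f x - f x = (LBINT y. \<rho> y *\<^sub>R (f (x - y) - f x))" .
    have "integrable lborel (\<lambda>y. \<rho> y *\<^sub>R (f (x - y) - f x))"
      using i1 i2 by (simp add: scaleR_diff_right)
    from integral_norm_bound_ennreal[OF this] show ?thesis
      unfolding eq using \<rho>0 by simp
  qed
  have "(\<integral>\<^sup>+x. ennreal (norm (convol \<rho> f x - f x)) \<partial>lborel) \<le>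
    (\<integral>\<^sup>+x. (\<integral>\<^sup>+y. ennreal (\<rho> y * norm (f (x - y) - f x)) \<partial>lborel) \<partial>lborel)"
    by (intro nn_integral_mono pw)
  also have "\<dots> = (\<integral>\<^sup>+y. (\<integral>\<^sup>+x. ennreal (\<rho> y * norm (f (x - y) - f x)) \<partial>lborel) \<partial>lborel)"
    by (rule lborel_pair.Fubini') measurable
  also have "\<dots> \<le> (\<integral>\<^sup>+y. ennreal (e * \<rho> y) \<partial>lborel)"
  proof (rule nn_integral_mono)
    fix y
    show "(\<integral>\<^sup>+x. ennreal (\<rho> y * norm (f (x - y) - f x)) \<partial>lborel) \<le> ennreal (e * \<rho> y)"
    proof (cases "norm y < r")
      case True
      have "(\<integral>\<^sup>+x. ennreal (\<rho> y * norm (f (x - y) - f x)) \<partial>lborel) =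
        ennreal (LBINT x. \<rho> y * norm (f (x - y) - f x))"
        using integrable_lborel_translation_diff[OF f, of y] \<rho>0
        by (intro nn_integral_eq_integral) auto
      also have "\<dots> \<le> ennreal (e * \<rho> y)"
        using mult_left_mono[OF tr[OF True] \<rho>0[of y]] by (intro ennreal_leI) (simp add: mult.commute)
      finally show ?thesis .
    qed (use \<rho> in \<open>simp add: mollifier_def\<close>)
  qed
  also have "\<dots> = ennreal (LBINT y. e * \<rho> y)"
    using mollifier_kernel(3)[OF \<rho>] \<rho>0 e by (intro nn_integral_eq_integral) auto
  also have "\<dots> = ennreal e" using \<rho> by (simp add: mollifier_def)
  finally have le: "(\<integral>\<^sup>+x. ennreal (norm (convol \<rho> f x - f x)) \<partial>lborel) \<le> ennreal e" .
  show i: "integrable lborel (\<lambda>x. convol \<rho> f x - f x)"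
    by (rule integrableI_bounded) (use le in \<open>auto simp: order_le_less_trans\<close>)
  then have "integrable lborel (\<lambda>x. norm (convol \<rho> f x - f x))" by simp
  from nn_integral_eq_integral[OF this] le e
  show "(LBINT x. norm (convol \<rho> f x - f x)) \<le> e" by simp
qed

lemma convol_L1_approx:
  fixes f :: "'a::euclidean_space \<Rightarrow> 'b::{banach, second_countable_topology}"
  assumes f: "integrable lborel f" and e: "0 < e"
  shows "\<exists>\<delta>>0. \<forall>r \<rho>. r \<le> \<delta> \<longrightarrow> mollifier r \<rho> \<longrightarrow> integrable lborel (\<lambda>x. convol \<rho> f x - f x) \<and>
    (LBINT x. norm (convol \<rho> f x - f x)) \<le> e"
proof -
  obtain \<delta> where \<delta>: "\<delta> > 0" "\<And>y. norm y < \<delta> \<Longrightarrow> (LBINT x. norm (f (x - y) - f x)) \<le> e"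
    using integrable_L1_translation_continuous[OF f] e unfolding L1_translation_continuous_def by blast
  have "integrable lborel (\<lambda>x. convol \<rho> f x - f x) \<and>
    (LBINT x. norm (convol \<rho> f x - f x)) \<le> e" if "r \<le> \<delta>" "mollifier r \<rho>" for r \<rho>
    using convol_diff_L1_bound[OF that(2) f, of e] \<delta>(2) that(1) e by force
  then show ?thesis using \<delta>(1) by blast
qed

text \<open>The errors are summable in L1, so the pointwise series of their norms converges almost
  everywhere and has an integrable sum. This yields convergence of the whole sequence and a common
  majorant together, as dominated convergence demands.\<close>

lemma summable_L1_errors:
  fixes d :: "nat \<Rightarrow> 'a \<Rightarrow> 'b::{banach, second_countable_topology}"
  assumes i: "\<And>n. integrable M (d n)" and le: "\<And>n. (\<integral>x. norm (d n x) \<partial>M) \<le> (1/2) ^ n"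
  shows "AE x in M. (\<lambda>n. d n x) \<longlonglongrightarrow> 0"
    and "\<exists>S. integrable M S \<and> (AE x in M. \<forall>n. norm (d n x) \<le> S x)"
proof -
  have m[measurable]: "d n \<in> borel_measurable M" for n using i by auto
  have sm: "summable (\<lambda>n. \<integral>x. norm (d n x) \<partial>M)"
    by (rule summable_comparison_test'[OF summable_geometric[of "1/2::real"], of 0]) (use le in auto)
  have "(\<integral>\<^sup>+x. (\<Sum>n. ennreal (norm (d n x))) \<partial>M) = (\<Sum>n. \<integral>\<^sup>+x. ennreal (norm (d n x)) \<partial>M)"
    by (rule nn_integral_suminf) measurable
  also have "\<dots> = (\<Sum>n. ennreal (\<integral>x. norm (d n x) \<partial>M))"
    using i by (intro suminf_cong nn_integral_eq_integral) auto
  also have "\<dots> < \<infinity>"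
    using sm by (simp add: less_top suminf_ennreal2)
  finally have "AE x in M. (\<Sum>n. ennreal (norm (d n x))) \<noteq> \<infinity>"
    by (intro nn_integral_noteq_infinite) (auto simp: less_top)
  then have s: "AE x in M. summable (\<lambda>n. norm (d n x))"
    by eventually_elim (auto intro: summable_suminf_not_top)
  show "AE x in M. (\<lambda>n. d n x) \<longlonglongrightarrow> 0"
    using s by eventually_elim (auto dest: summable_LIMSEQ_zero intro: tendsto_norm_zero_cancel)
  have "integrable M (\<lambda>x. \<Sum>n. norm (d n x))"
    using i s sm by (intro integrable_suminf) auto
  moreover have "AE x in M. \<forall>n. norm (d n x) \<le> (\<Sum>n. norm (d n x))"
    using s
  proof eventually_elim
    case (elim x)
    have "sum (\<lambda>n. norm (d n x)) {n} \<le> (\<Sum>n. norm (d n x))" for n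
      using elim by (intro sum_le_suminf) auto
    then show ?case by simp
  qed
  ultimately show "\<exists>S. integrable M S \<and> (AE x in M. \<forall>n. norm (d n x) \<le> S x)" by blast
qed

text \<open>One sequence has to serve three functions. In the application w is the supersolution
  minus m, g its gradient and h = |g|^p; the first two must converge, the third must have an
  integrable majorant.\<close>

lemma mollifier_sequence:
  fixes w h :: "'a::euclidean_space \<Rightarrow> real" and g :: "'a \<Rightarrow> 'a"
  assumes w: "integrable lborel w" and g: "integrable lborel g" and h: "integrable lborel h"
    and \<delta>: "0 < \<delta>"
  obtains \<rho> S where "\<forall>n::nat. \<exists>r>0. r \<le> \<delta> \<and> mollifier r (\<rho> n)"
    and "AE x in lborel. (\<lambda>n. convol (\<rho> n) w x) \<longlonglongrightarrow> w x"
    and "AE x in lborel. (\<lambda>n. convol (\<rho> n) g x) \<longlonglongrightarrow> g x"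
    and "integrable lborel S" and "AE x in lborel. \<forall>n. convol (\<rho> n) h x \<le> S x"
proof -
  define close :: "nat \<Rightarrow> ('a \<Rightarrow> real) \<Rightarrow> bool" where "close n \<rho> \<longleftrightarrow>
      (integrable lborel (\<lambda>x. convol \<rho> w x - w x) \<and> (LBINT x. norm (convol \<rho> w x - w x)) \<le> (1/2)^n) \<and>
      (integrable lborel (\<lambda>x. convol \<rho> g x - g x) \<and> (LBINT x. norm (convol \<rho> g x - g x)) \<le> (1/2)^n) \<and>
      (integrable lborel (\<lambda>x. convol \<rho> h x - h x) \<and> (LBINT x. norm (convol \<rho> h x - h x)) \<le> (1/2)^n)"
    for n \<rho>
  have "\<exists>\<rho>. (\<exists>r>0. r \<le> \<delta> \<and> mollifier r \<rho>) \<and> close n \<rho>" for n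
  proof -
    have e: "0 < (1/2::real)^n" by simp
    obtain a where a: "a > 0" "\<And>r \<rho>. r \<le> a \<Longrightarrow> mollifier r \<rho> \<Longrightarrow> integrable lborel (\<lambda>x. convol \<rho> w x - w x) \<and>
      (LBINT x. norm (convol \<rho> w x - w x)) \<le> (1/2)^n"
      using convol_L1_approx[OF w e] by auto
    obtain b where b: "b > 0" "\<And>r \<rho>. r \<le> b \<Longrightarrow> mollifier r \<rho> \<Longrightarrow> integrable lborel (\<lambda>x. convol \<rho> g x - g x) \<and>
      (LBINT x. norm (convol \<rho> g x - g x)) \<le> (1/2)^n"
      using convol_L1_approx[OF g e] by auto
    obtain c where c: "c > 0" "\<And>r \<rho>. r \<le> c \<Longrightarrow> mollifier r \<rho> \<Longrightarrow> integrable lborel (\<lambda>x. convol \<rho> h x - h x) \<and>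
      (LBINT x. norm (convol \<rho> h x - h x)) \<le> (1/2)^n"
      using convol_L1_approx[OF h e] by auto
    define r where "r = min (min a b) (min c \<delta>)"
    have r: "r > 0" "r \<le> a" "r \<le> b" "r \<le> c" "r \<le> \<delta>" using a(1) b(1) c(1) \<delta> by (auto simp: r_def)
    obtain \<rho> :: "'a \<Rightarrow> real" where \<rho>: "mollifier r \<rho>" using mollifier_exists[OF r(1)] by blast
    have "close n \<rho>"
      unfolding close_def by (intro conjI[OF a(2)[OF r(2) \<rho>]] conjI[OF b(2)[OF r(3) \<rho>]] c(2)[OF r(4) \<rho>])
    then show ?thesis using r(1,5) \<rho> by auto
  qed
  then have "\<forall>n. \<exists>\<rho>. (\<exists>r>0. r \<le> \<delta> \<and> mollifier r \<rho>) \<and> close n \<rho>" by (rule allI)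
  from choice[OF this] obtain \<rho> where \<rho>': "\<forall>n. (\<exists>r>0. r \<le> \<delta> \<and> mollifier r (\<rho> n)) \<and> close n (\<rho> n)"
    by (rule exE)
  then have \<rho>: "\<exists>r>0. r \<le> \<delta> \<and> mollifier r (\<rho> n)" and cl: "close n (\<rho> n)" for n by auto
  have W: "integrable lborel (\<lambda>x. convol (\<rho> n) w x - w x)"
      "(LBINT x. norm (convol (\<rho> n) w x - w x)) \<le> (1/2)^n"
    and G: "integrable lborel (\<lambda>x. convol (\<rho> n) g x - g x)"
      "(LBINT x. norm (convol (\<rho> n) g x - g x)) \<le> (1/2)^n"
    and H: "integrable lborel (\<lambda>x. convol (\<rho> n) h x - h x)"
      "(LBINT x. norm (convol (\<rho> n) h x - h x)) \<le> (1/2)^n" for n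
    using cl[of n] unfolding close_def by (auto simp only: simp_thms)
  obtain S where S: "integrable lborel S" "AE x in lborel. \<forall>n. norm (convol (\<rho> n) h x - h x) \<le> S x"
    using summable_L1_errors(2)[OF H] by blast
  show thesis
  proof (rule that[OF allI[OF \<rho>]])
    show "AE x in lborel. (\<lambda>n. convol (\<rho> n) w x) \<longlonglongrightarrow> w x"
      using summable_L1_errors(1)[OF W] by eventually_elim (rule LIM_zero_cancel)
    show "AE x in lborel. (\<lambda>n. convol (\<rho> n) g x) \<longlonglongrightarrow> g x"
      using summable_L1_errors(1)[OF G] by eventually_elim (rule LIM_zero_cancel)
    show "integrable lborel (\<lambda>x. h x + S x)" using h S by simp
    show "AE x in lborel. \<forall>n. convol (\<rho> n) h x \<le> h x + S x"
      using S(2)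
    proof eventually_elim
      case (elim x)
      show ?case
      proof
        fix n
        show "convol (\<rho> n) h x \<le> h x + S x" using elim[rule_format, of n] by (simp add: abs_le_iff)
      qed
    qed
  qed
qed

text \<open>Young's inequality for the exponents p / (p - 1) and p, scaled by p. In Y it is the
  tangent line of the p-th power at X, and it is the source of the convexity estimates
  below.\<close>

lemma Young_powr:
  fixes p X Y :: real
  assumes p: "1 < p" and X: "0 \<le> X" and Y: "0 \<le> Y"
  shows "p * X powr (p - 1) * Y \<le> (p - 1) * X powr p + Y powr p"
proof (cases "X = 0 \<or> Y = 0")
  case False
  then have pos: "0 < X" "0 < Y" using X Y by auto
  have "(X powr p) powr ((p - 1) / p) * (Y powr p) powr (1 / p) \<le> (p - 1) / p * X powr p + 1 / p * Y powr p"
    using p pos by (intro Youngs_inequality_0) (auto simp: field_simps)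
  then have "X powr (p - 1) * Y \<le> ((p - 1) * X powr p + Y powr p) / p"
    using p pos by (simp add: powr_powr add_divide_distrib)
  then show ?thesis using p by (simp add: field_simps)
qed (use p in auto)

lemma powr_minus_one_mult: "0 \<le> a \<Longrightarrow> a powr (p - 1) * a = a powr p" for a p :: real
  by (cases "a = 0") (auto simp: powr_diff)

text \<open>Jensen's inequality for the probability density \<rho> (x - y): average the tangent line
  of the p-th power at the mean a of |g|.\<close>

lemma norm_convol_powr_le:
  fixes g :: "'a::euclidean_space \<Rightarrow> 'b::{banach, second_countable_topology}"
  assumes p: "1 < p" and \<rho>: "mollifier r \<rho>" and g: "integrable lborel g"
    and gp: "integrable lborel (\<lambda>x. norm (g x) powr p)"
  shows "norm (convol \<rho> g x) powr p \<le> convol \<rho> (\<lambda>y. norm (g y) powr p) x"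
proof -
  define a where "a = (LBINT y. \<rho> (x - y) * norm (g y))"
  note \<rho>0 = mollifier_kernel(4)[OF \<rho>]
  have i: "integrable lborel (\<lambda>y. \<rho> (x - y) * norm (g y))"
    using mollifier_integrable[OF \<rho> integrable_norm[OF g], of x] by simp
  have j: "integrable lborel (\<lambda>y. \<rho> (x - y) * norm (g y) powr p)"
    using mollifier_integrable[OF \<rho> gp, of x] by simp
  have a0: "0 \<le> a" unfolding a_def using \<rho>0 by simp
  have le: "norm (convol \<rho> g x) \<le> a"
    unfolding convol_def a_def using integral_norm_bound[of lborel "\<lambda>y. \<rho> (x - y) *\<^sub>R g y"] \<rho>0 by simp
  have "p * a powr (p - 1) * a = (LBINT y. p * a powr (p - 1) * (\<rho> (x - y) * norm (g y)))"
    by (simp add: a_def)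
  also have "\<dots> \<le> (LBINT y. (p - 1) * a powr p * \<rho> (x - y) + \<rho> (x - y) * norm (g y) powr p)"
  proof (rule integral_mono)
    fix y
    have "\<rho> (x - y) * (p * a powr (p - 1) * norm (g y)) \<le> \<rho> (x - y) * ((p - 1) * a powr p + norm (g y) powr p)"
      using \<rho>0 by (intro mult_left_mono Young_powr p a0) auto
    then show "p * a powr (p - 1) * (\<rho> (x - y) * norm (g y)) \<le> (p - 1) * a powr p * \<rho> (x - y) + \<rho> (x - y) * norm (g y) powr p"
      by (simp add: algebra_simps)
  qed (use i j mollifier_integral_shift(2)[OF \<rho>] in auto)
  also have "\<dots> = (p - 1) * a powr p + convol \<rho> (\<lambda>y. norm (g y) powr p) x"
    using j mollifier_integral_shift[OF \<rho>] by (simp add: convol_def)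
  finally have "a powr p \<le> convol \<rho> (\<lambda>y. norm (g y) powr p) x"
    unfolding mult.assoc powr_minus_one_mult[OF a0] by (simp add: algebra_simps)
  moreover have "norm (convol \<rho> g x) powr p \<le> a powr p"
    using le p by (intro powr_mono2) auto
  ultimately show ?thesis by simp
qed

subsection \<open>Integration by parts\<close>

text \<open>The convolution of \<psi> with the indicator of a ball reaching beyond the support by a
  margin 1 is constant near 0. Its gradient at 0 therefore vanishes, and differentiation under the
  integral identifies this gradient with the integral of \<Psi>, up to a reflection.\<close>

lemma integral_gradient_eq_0:
  fixes \<psi> :: "'a::euclidean_space \<Rightarrow> real"
  assumes \<psi>: "C1_grad \<psi> \<Psi>" and S: "compact S" "\<And>x. x \<notin> S \<Longrightarrow> \<psi> x = 0"
  shows "(LBINT x. \<Psi> x) = 0"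
proof -
  obtain R where R: "S \<subseteq> ball 0 R" using bounded_subset_ballD[OF compact_imp_bounded[OF S(1)]] by blast
  define f :: "'a \<Rightarrow> real" where "f = indicator (cball 0 (R + 1))"
  have f: "integrable lborel f"
    unfolding f_def using emeasure_bounded_finite[OF bounded_cball, of "0::'a" "R + 1"] by simp
  have c: "continuous_on UNIV \<Psi>" "continuous_on UNIV \<psi>"
    using \<psi> C1_grad_continuous by (auto simp: C1_grad_def)
  have m: "\<Psi> \<in> borel_measurable borel" "\<psi> \<in> borel_measurable borel"
    using c by (auto intro: borel_measurable_continuous_onI)
  have z: "\<Psi> x = 0" if "x \<notin> S" for x
    using C1_grad_eq_0_off_closed[OF \<psi> compact_imp_closed[OF S(1)] S(2) that] by simp
  have const: "convol \<psi> f x = (LBINT y. \<psi> y)" if "x \<in> ball 0 1" for x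
  proof -
    have "\<psi> (x - y) *\<^sub>R f y = \<psi> (x - y)" for y
    proof (cases "x - y \<in> S")
      case True
      then have "norm (x - y) < R" using R by auto
      then have "norm y \<le> R + 1" using that norm_triangle_sub[of y x] by (simp add: norm_minus_commute)
      then show ?thesis by (simp add: f_def)
    qed (simp add: S(2))
    then have "(\<lambda>y. \<psi> (x - y) *\<^sub>R f y) = (\<lambda>y. \<psi> (x - y))" by (rule ext)
    then show ?thesis unfolding convol_def using integral_lborel_minus[OF m(2), of x] by metis
  qed
  have "(convol \<psi> f has_derivative (\<lambda>h. (LBINT y. f y *\<^sub>R \<Psi> (0 - y)) \<bullet> h)) (at 0)"
    using convol_C1_grad[OF f \<psi> S] unfolding C1_grad_def by blast
  moreover have "(convol \<psi> f has_derivative (\<lambda>h. 0)) (at 0)"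
    by (rule has_derivative_transform_within_open[of "\<lambda>_. \<integral>y. \<psi> y \<partial>lborel" _ 0 UNIV "ball 0 1"])
      (use const in auto)
  ultimately have "(\<lambda>h. (LBINT y. f y *\<^sub>R \<Psi> (0 - y)) \<bullet> h) = (\<lambda>h. 0)"
    by (rule has_derivative_unique)
  then have "(LBINT y. f y *\<^sub>R \<Psi> (0 - y)) = 0" by (metis inner_eq_zero_iff)
  moreover have "f y *\<^sub>R \<Psi> (0 - y) = \<Psi> (0 - y)" for y
  proof (cases "0 - y \<in> S")
    case True
    then have "norm y < R" using R by auto
    then show ?thesis by (simp add: f_def)
  next
    case False
    then show ?thesis using z by simp
  qed
  ultimately show ?thesis using integral_lborel_minus[OF m(1), of 0] by simp
qed

lemma C1_grad_mult:
  assumes "C1_grad f F" "C1_grad g G"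
  shows "C1_grad (\<lambda>x. f x * g x) (\<lambda>x. f x *\<^sub>R G x + g x *\<^sub>R F x)"
proof -
  have "continuous_on UNIV f" "continuous_on UNIV g" using assms C1_grad_continuous by auto
  moreover have "((\<lambda>x. f x * g x) has_derivative (\<lambda>h. (f x *\<^sub>R G x + g x *\<^sub>R F x) \<bullet> h)) (at x)" for x
    using assms unfolding C1_grad_def
    by (auto intro!: derivative_eq_intros simp: inner_add_left algebra_simps)
  ultimately show ?thesis
    using assms unfolding C1_grad_def by (auto intro!: continuous_intros)
qed

text \<open>The divergence theorem for the field \<zeta> x, obtained by applying
  \<open>integral_gradient_eq_0\<close> to each product \<zeta> (x \<bullet> i).\<close>

lemma integral_divergence_radial:
  fixes \<zeta> :: "'a::euclidean_space \<Rightarrow> real"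
  assumes \<zeta>: "C1_grad \<zeta> Z" and S: "compact S" "\<And>x. x \<notin> S \<Longrightarrow> \<zeta> x = 0"
  shows "(LBINT x. x \<bullet> Z x + real DIM('a) * \<zeta> x) = 0"
proof -
  have c: "continuous_on UNIV Z" "continuous_on UNIV \<zeta>"
    using \<zeta> C1_grad_continuous by (auto simp: C1_grad_def)
  have z: "Z x = 0" if "x \<notin> S" for x
    using C1_grad_eq_0_off_closed[OF \<zeta> compact_imp_closed[OF S(1)] S(2) that] by simp
  define V where "V i x = \<zeta> x *\<^sub>R i + (x \<bullet> i) *\<^sub>R Z x" for i x :: 'a
  have lin: "C1_grad (\<lambda>x. x \<bullet> i) (\<lambda>x. i)" for i :: 'a
    unfolding C1_grad_def by (auto intro!: derivative_eq_intros simp: inner_commute)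
  have V: "C1_grad (\<lambda>x. \<zeta> x * (x \<bullet> i)) (V i)" for i
    using C1_grad_mult[OF \<zeta> lin[of i]] by (simp add: V_def[abs_def])
  have int0: "(LBINT x. V i x) = 0" for i
    by (rule integral_gradient_eq_0[OF V S(1)]) (simp add: S(2))
  have iV: "integrable lborel (V i)" for i
    by (rule continuous_compact_support_integrable[OF _ S(1)])
      (use V z S in \<open>auto simp: C1_grad_def V_def\<close>)
  have "x \<bullet> Z x + real DIM('a) * \<zeta> x = (\<Sum>i\<in>Basis. V i x \<bullet> i)" for x
    unfolding V_def by (simp add: inner_add_left sum.distrib euclidean_inner[of x "Z x"])
  then have "(LBINT x. x \<bullet> Z x + real DIM('a) * \<zeta> x) = (\<Sum>i\<in>Basis. \<integral>x. V i x \<bullet> i \<partial>lborel)"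
    using iV by simp
  also have "\<dots> = 0" using int0 iV by (simp add: integral_inner_left)
  finally show ?thesis .
qed

text \<open>This makes y \<mapsto> \<rho> (x - y) available as a test function for the weak
  gradient.\<close>

lemma C_k_reflect: "C_k k \<phi> \<Longrightarrow> C_k k (\<lambda>y. \<phi> (x - y))"
proof (induction k arbitrary: \<phi>)
  case 0
  then show ?case by (auto intro!: continuous_on_compose2[of UNIV \<phi>] continuous_intros)
next
  case (Suc k)
  have D: "((\<lambda>y. \<phi> (x - y)) has_derivative (\<lambda>h. frechet_derivative \<phi> (at (x - y)) (- h))) (at y)" for y
  proof -
    have "((\<lambda>y. x - y) has_derivative (\<lambda>h. - h)) (at y)" by (auto intro!: derivative_eq_intros)
    moreover have "(\<phi> has_derivative frechet_derivative \<phi> (at (x - y))) (at (x - y))"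
      using Suc.prems by (simp flip: frechet_derivative_works)
    ultimately show ?thesis by (rule has_derivative_compose)
  qed
  have "linear (frechet_derivative \<phi> (at y))" for y
    using Suc.prems by (auto intro: linear_frechet_derivative)
  then have "partial_deriv i (\<lambda>y. \<phi> (x - y)) = (\<lambda>y. - 1 * partial_deriv i \<phi> (x - y))" for i
    using partial_deriv_eq[OF D] by (auto simp: fun_eq_iff linear_neg partial_deriv_def)
  moreover have "(\<lambda>y. \<phi> (x - y)) differentiable at y" for y
    using D[of y] by (auto simp: differentiable_def)
  moreover have "C_k k (\<lambda>y. - 1 * partial_deriv i \<phi> (x - y))" if "i \<in> Basis" for i
    by (intro C_k_mult C_k_const Suc.IH) (use Suc.prems that in simp)
  ultimately show ?case by simp
qed

lemma mollifier_average_close: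
  fixes F :: "'a::euclidean_space \<Rightarrow> 'b::euclidean_space"
  assumes \<rho>: "mollifier r \<rho>" and F: "continuous_on UNIV F" "compact S" "\<And>x. x \<notin> S \<Longrightarrow> F x = 0"
    and e: "\<And>y. norm y < r \<Longrightarrow> norm (F (x - y) - F x) \<le> e"
  shows "norm ((LBINT y. \<rho> y *\<^sub>R F (x - y)) - F x) \<le> e"
proof -
  note \<rho>0 = mollifier_kernel(4)[OF \<rho>] and \<rho>i = mollifier_kernel(3)[OF \<rho>]
  have \<rho>1: "(LBINT y. \<rho> y) = 1" using \<rho> by (simp add: mollifier_def)
  have i1: "integrable lborel (\<lambda>y. \<rho> y *\<^sub>R F (x - y))" by (rule kernel_integrable[OF \<rho>i F])
  have i2: "integrable lborel (\<lambda>y. \<rho> y *\<^sub>R F x)" using \<rho>i by simp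
  have "(LBINT y. \<rho> y *\<^sub>R F (x - y)) - F x = (LBINT y. \<rho> y *\<^sub>R F (x - y)) - (LBINT y. \<rho> y *\<^sub>R F x)"
    using \<rho>1 \<rho>i by simp
  also have "\<dots> = (LBINT y. \<rho> y *\<^sub>R (F (x - y) - F x))"
    using i1 i2 by (simp add: scaleR_diff_right)
  also have "norm \<dots> \<le> (LBINT y. e * \<rho> y)"
  proof (rule Bochner_Integration.integral_norm_bound_integral)
    show "integrable lborel (\<lambda>y. \<rho> y *\<^sub>R (F (x - y) - F x))"
      using i1 i2 by (simp add: scaleR_diff_right)
    show "norm (\<rho> y *\<^sub>R (F (x - y) - F x)) \<le> e * \<rho> y" for y
    proof (cases "norm y < r")
      case True
      then show ?thesis using mult_left_mono[OF e[OF True] \<rho>0[of y]] \<rho>0[of y] by (simp add: mult.commute)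
    qed (use \<rho> in \<open>simp add: mollifier_def\<close>)
  qed (use \<rho>i in auto)
  also have "\<dots> = e" using \<rho>1 by simp
  finally show ?thesis .
qed

lemma integrable_inner_compact_support:
  fixes A \<Phi> :: "'a::euclidean_space \<Rightarrow> 'b::euclidean_space"
  assumes A: "integrable lborel A" and \<Phi>: "continuous_on UNIV \<Phi>" "compact K" "\<And>x. x \<notin> K \<Longrightarrow> \<Phi> x = 0"
  shows "integrable lborel (\<lambda>x. A x \<bullet> \<Phi> x)"
proof -
  obtain B where B: "B \<ge> 0" "\<And>x. norm (\<Phi> x) \<le> B"
    using continuous_compact_support_bounded[OF \<Phi>] by auto
  have m: "\<Phi> \<in> borel_measurable borel" using \<Phi>(1) by (simp add: borel_measurable_continuous_onI)
  show ?thesis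
  proof (rule Bochner_Integration.integrable_bound)
    show "integrable lborel (\<lambda>x. B * norm (A x))" using A by simp
    show "(\<lambda>x. A x \<bullet> \<Phi> x) \<in> borel_measurable lborel" using A m by measurable
    show "AE x in lborel. norm (A x \<bullet> \<Phi> x) \<le> norm (B * norm (A x))"
    proof (intro AE_I2)
      fix x
      have "norm (A x \<bullet> \<Phi> x) \<le> norm (A x) * norm (\<Phi> x)" using Cauchy_Schwarz_ineq2 by simp
      also have "\<dots> \<le> norm (A x) * B" using B by (intro mult_left_mono) auto
      finally show "norm (A x \<bullet> \<Phi> x) \<le> norm (B * norm (A x))" using B(1) by (simp add: mult.commute)
    qed
  qed
qed

text \<open>Mollifying \<phi> moves it and its gradient by at most e uniformly and enlarges the
  support only slightly, so each integral changes by at most e times an L1 norm. Integrability of M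
  is asked for on compact subsets of W alone, because in the application M carries the Hardy weight
  and W omits the origin.\<close>

lemma weak_inequality_C1_test:
  fixes A :: "'a::euclidean_space \<Rightarrow> 'a" and M \<phi> :: "'a \<Rightarrow> real"
  assumes A: "integrable lborel A" and W: "open W"
    and M: "\<And>K. compact K \<Longrightarrow> K \<subseteq> W \<Longrightarrow> integrable lborel (\<lambda>x. indicator K x * M x)"
    and smooth: "\<And>\<phi>. \<phi> \<in> C0_infinity W \<Longrightarrow> (\<And>x. 0 \<le> \<phi> x) \<Longrightarrow>
      (LBINT x. M x * \<phi> x) \<le> (LBINT x. A x \<bullet> grad \<phi> x)"
    and \<phi>: "C1_grad \<phi> \<Phi>" "\<And>x. 0 \<le> \<phi> x" and K: "compact K" "K \<subseteq> W" "\<And>x. x \<notin> K \<Longrightarrow> \<phi> x = 0"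
  shows "integrable lborel (\<lambda>x. M x * \<phi> x)" "integrable lborel (\<lambda>x. A x \<bullet> \<Phi> x)"
    "(LBINT x. M x * \<phi> x) \<le> (LBINT x. A x \<bullet> \<Phi> x)"
proof -
  have c: "continuous_on UNIV \<Phi>" "continuous_on UNIV \<phi>"
    using \<phi>(1) C1_grad_continuous by (auto simp: C1_grad_def)
  have z: "\<Phi> x = 0" if "x \<notin> K" for x
    using C1_grad_eq_0_off_closed[OF \<phi>(1) compact_imp_closed[OF K(1)] K(3) that] .
  have \<phi>i: "integrable lborel \<phi>" by (rule continuous_compact_support_integrable[OF c(2) K(1,3)])
  have \<phi>m: "\<phi> \<in> borel_measurable borel" using c(2) by (rule borel_measurable_continuous_onI)
  have iM: "integrable lborel (\<lambda>x. M x * \<psi> x)"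
    if L: "compact L" "L \<subseteq> W" and \<psi>: "continuous_on UNIV \<psi>" "\<And>x. x \<notin> L \<Longrightarrow> \<psi> x = 0" for L and \<psi> :: "'a \<Rightarrow> real"
  proof -
    have "integrable lborel (\<lambda>x. (indicator L x * M x) \<bullet> \<psi> x)"
      by (rule integrable_inner_compact_support[OF M[OF L] \<psi>(1) L(1) \<psi>(2)])
    moreover have "(\<lambda>x. (indicator L x * M x) \<bullet> \<psi> x) = (\<lambda>x. M x * \<psi> x)"
      using \<psi>(2) by (auto simp: indicator_def fun_eq_iff)
    ultimately show ?thesis by simp
  qed
  show iM\<phi>: "integrable lborel (\<lambda>x. M x * \<phi> x)" by (rule iM[OF K(1,2) c(2) K(3)])
  show iA\<Phi>: "integrable lborel (\<lambda>x. A x \<bullet> \<Phi> x)"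
    by (rule integrable_inner_compact_support[OF A c(1) K(1) z])
  obtain d where d: "d > 0" "(\<Union>x\<in>K. cball x d) \<subseteq> W"
    using compact_subset_open_imp_cball_epsilon_subset[OF K(1) W K(2)] by blast
  \<comment> \<open>A fixed compact neighbourhood of K inside W. It contains the supports of all
    mollifications used below, so that C does not depend on e.\<close>
  define L where "L = (\<Union>x\<in>K. cball x d)"
  have L: "compact L" "L \<subseteq> W"
    unfolding L_def using compact_minkowski_sum_cball[OF K(1)] d(2) by auto
  define C where "C = (LBINT x. indicator L x * \<bar>M x\<bar>) + (LBINT x. norm (A x))"
  have C: "0 \<le> C" by (auto simp: C_def)
  have iLM: "integrable lborel (\<lambda>x. indicator L x * \<bar>M x\<bar>)"
    using integrable_abs[OF M[OF L]] by (simp add: abs_mult)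
  have key: "(LBINT x. M x * \<phi> x) \<le> (LBINT x. A x \<bullet> \<Phi> x) + e * C" if e: "0 < e" for e
  proof -
    obtain \<delta>1 where \<delta>1: "\<delta>1 > 0" "\<And>x y. norm (x - y) < \<delta>1 \<Longrightarrow> norm (\<phi> x - \<phi> y) \<le> e"
      using uniformly_continuous_compact_support[OF c(2) K(1,3) e] by auto
    obtain \<delta>2 where \<delta>2: "\<delta>2 > 0" "\<And>x y. norm (x - y) < \<delta>2 \<Longrightarrow> norm (\<Phi> x - \<Phi> y) \<le> e"
      using uniformly_continuous_compact_support[OF c(1) K(1) z e] by auto
    define r where "r = min (min \<delta>1 \<delta>2) d"
    have r: "r > 0" "r \<le> \<delta>1" "r \<le> \<delta>2" "r \<le> d" using \<delta>1(1) \<delta>2(1) d(1) by (auto simp: r_def)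
    obtain \<rho> :: "'a \<Rightarrow> real" where \<rho>: "mollifier r \<rho>" using mollifier_exists[OF r(1)] by blast
    note \<rho>m = mollifier_kernel(2)[OF \<rho>] and \<rho>0 = mollifier_kernel(4)[OF \<rho>] and \<rho>i = mollifier_kernel(3)[OF \<rho>]
    define \<psi> where "\<psi> = convol \<rho> \<phi>"
    define \<Psi> where "\<Psi> x = (LBINT y. \<rho> y *\<^sub>R \<Phi> (x - y))" for x
    have \<psi>alt: "\<psi> x = (LBINT y. \<rho> y *\<^sub>R \<phi> (x - y))" for x
      unfolding \<psi>_def by (rule convol_commute[OF \<rho>m \<phi>m])
    then have "\<psi> = convol \<phi> \<rho>" by (simp add: fun_eq_iff convol_def mult.commute)
    then have \<psi>C: "C1_grad \<psi> \<Psi>"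
      using convol_C1_grad[OF \<rho>i \<phi>(1) K(1,3)] by (simp add: \<Psi>_def[abs_def])
    have \<psi>0: "\<psi> x = 0" if "x \<notin> L" for x
    proof -
      have "\<rho> y *\<^sub>R \<phi> (x - y) = 0" for y
      proof (cases "x - y \<in> K")
        case True
        then have "\<not> norm y \<le> d" using that by (auto simp: L_def dist_norm)
        then show ?thesis using \<rho> r(4) by (auto simp: mollifier_def)
      qed (simp add: K(3))
      then show ?thesis unfolding \<psi>alt by (simp only: Bochner_Integration.integral_zero)
    qed
    have \<psi>pos: "0 \<le> \<psi> x" for x unfolding \<psi>alt using \<rho>0 \<phi>(2) by (intro Bochner_Integration.integral_nonneg) auto
    have Ck: "C_k k \<psi>" for k
      unfolding \<psi>_def using \<rho> by (intro C_k_convol \<phi>i) (simp add: mollifier_def)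
    have \<psi>W: "\<psi> \<in> C0_infinity W" by (rule C0_infinityI[OF Ck L \<psi>0])
    have c': "continuous_on UNIV \<Psi>" "continuous_on UNIV \<psi>"
      using \<psi>C C1_grad_continuous by (auto simp: C1_grad_def)
    have z': "\<Psi> x = 0" if "x \<notin> L" for x
      using C1_grad_eq_0_off_closed[OF \<psi>C compact_imp_closed[OF L(1)] \<psi>0 that] .
    have cl1: "norm (\<psi> x - \<phi> x) \<le> e" for x
      unfolding \<psi>alt by (rule mollifier_average_close[OF \<rho> c(2) K(1,3)]) (use \<delta>1(2) r(2) in auto)
    have cl2: "norm (\<Psi> x - \<Phi> x) \<le> e" for x
      unfolding \<Psi>_def by (rule mollifier_average_close[OF \<rho> c(1) K(1) z]) (use \<delta>2(2) r(3) in auto)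
    have KL: "x \<in> K \<Longrightarrow> x \<in> L" for x using d(1) by (auto simp: L_def intro!: bexI[of _ x])
    have iM\<psi>: "integrable lborel (\<lambda>x. M x * \<psi> x)" by (rule iM[OF L c'(2) \<psi>0])
    have iA\<Psi>: "integrable lborel (\<lambda>x. A x \<bullet> \<Psi> x)"
      by (rule integrable_inner_compact_support[OF A c'(1) L(1) z'])
    have "(LBINT x. M x * \<phi> x) \<le> (LBINT x. M x * \<psi> x + e * (indicator L x * \<bar>M x\<bar>))"
    proof (rule integral_mono)
      fix x
      show "M x * \<phi> x \<le> M x * \<psi> x + e * (indicator L x * \<bar>M x\<bar>)"
      proof (cases "x \<in> L")
        case True
        have "M x * (\<phi> x - \<psi> x) \<le> \<bar>M x\<bar> * \<bar>\<phi> x - \<psi> x\<bar>" by (metis abs_ge_self abs_mult)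
        also have "\<dots> \<le> \<bar>M x\<bar> * e" using cl1[of x] by (intro mult_left_mono) auto
        finally show ?thesis using True by (simp add: algebra_simps)
      next
        case False
        then have "\<phi> x = 0" "\<psi> x = 0" using KL K(3) \<psi>0 by auto
        then show ?thesis using False by simp
      qed
    qed (use iM\<phi> iM\<psi> iLM in auto)
    also have "\<dots> = (LBINT x. M x * \<psi> x) + e * (LBINT x. indicator L x * \<bar>M x\<bar>)"
      using iM\<psi> iLM by simp
    also have "(LBINT x. M x * \<psi> x) \<le> (LBINT x. A x \<bullet> \<Psi> x)"
      using smooth[OF \<psi>W \<psi>pos] C1_grad_grad[OF \<psi>C] by simp
    also have "(LBINT x. A x \<bullet> \<Psi> x) \<le> (LBINT x. A x \<bullet> \<Phi> x + e * norm (A x))"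
    proof (rule integral_mono)
      fix x
      have "A x \<bullet> (\<Psi> x - \<Phi> x) \<le> norm (A x) * norm (\<Psi> x - \<Phi> x)" by (rule norm_cauchy_schwarz)
      also have "\<dots> \<le> norm (A x) * e" using cl2 by (intro mult_left_mono) auto
      finally show "A x \<bullet> \<Psi> x \<le> A x \<bullet> \<Phi> x + e * norm (A x)" by (simp add: inner_diff_right mult.commute)
    qed (use iA\<Phi> iA\<Psi> A in auto)
    also have "\<dots> = (LBINT x. A x \<bullet> \<Phi> x) + e * (LBINT x. norm (A x))"
      using iA\<Phi> A by simp
    finally show ?thesis by (simp add: C_def algebra_simps)
  qed
  show "(LBINT x. M x * \<phi> x) \<le> (LBINT x. A x \<bullet> \<Phi> x)"
  proof (rule field_le_epsilon)
    fix e :: real assume e: "0 < e"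
    have C1: "0 < C + 1" using C by simp
    have "e / (C + 1) * C \<le> e" using e C1 by (simp add: field_simps)
    then show "(LBINT x. M x * \<phi> x) \<le> (LBINT x. A x \<bullet> \<Phi> x) + e"
      using key[of "e / (C + 1)"] e C1 by simp
  qed
qed

subsection \<open>Comparison in logarithmic variables\<close>

text \<open>The square makes the positive part continuously differentiable without changing where it
  vanishes, which makes the test functions admissible in
  \<open>weak_inequality_C1_test\<close>.\<close>

definition pos_sq :: "real \<Rightarrow> real"
  where "pos_sq t = (max 0 t)\<^sup>2"

lemma pos_sq_nonneg: "0 \<le> pos_sq t"
  by (simp add: pos_sq_def)

lemma pos_sq_eq_0_iff: "pos_sq t = 0 \<longleftrightarrow> t \<le> 0"
  by (auto simp: pos_sq_def)

lemma DERIV_pos_sq: "(pos_sq has_real_derivative 2 * max 0 t) (at t)"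
proof -
  consider "t < 0" | "t = 0" | "0 < t" by linarith
  then show ?thesis
  proof cases
    case 1
    have "((\<lambda>_. 0) has_real_derivative 2 * max 0 t) (at t)" using 1 by simp
    then show ?thesis
      by (rule has_field_derivative_transform_within_open[where S = "{..<0}"])
        (use 1 in \<open>auto simp: pos_sq_def\<close>)
  next
    case 2
    have "((\<lambda>h. (pos_sq (0 + h) - pos_sq 0) / h) \<longlongrightarrow> 0) (at 0)"
    proof (rule Lim_null_comparison)
      show "\<forall>\<^sub>F h in at 0. norm ((pos_sq (0 + h) - pos_sq 0) / h) \<le> \<bar>h\<bar>"
      proof (rule eventually_at_filter[THEN iffD2], rule always_eventually, intro allI impI)
        fix h :: real assume "h \<noteq> 0"
        then show "norm ((pos_sq (0 + h) - pos_sq 0) / h) \<le> \<bar>h\<bar>"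
          by (auto simp: pos_sq_def power2_eq_square max_def)
      qed
      show "((\<lambda>h. \<bar>h\<bar>) \<longlongrightarrow> 0) (at (0::real))" by (auto intro!: tendsto_eq_intros)
    qed
    then show ?thesis using 2 by (simp add: DERIV_def)
  next
    case 3
    have "((\<lambda>t. t\<^sup>2) has_real_derivative 2 * max 0 t) (at t)"
      using 3 by (auto intro!: derivative_eq_intros)
    then show ?thesis
      by (rule has_field_derivative_transform_within_open[where S = "{0<..}"])
        (use 3 in \<open>auto simp: pos_sq_def\<close>)
  qed
qed

lemma powr_flux_inner:
  fixes a :: "'a::real_inner"
  shows "(norm a powr (p - 2) *\<^sub>R a) \<bullet> a = norm a powr p"
    and "norm (norm a powr (p - 2) *\<^sub>R a) = norm a powr (p - 1)"
proof -
  show "(norm a powr (p - 2) *\<^sub>R a) \<bullet> a = norm a powr p"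
    by (cases "a = 0") (simp_all add: dot_square_norm powr_diff)
  show "norm (norm a powr (p - 2) *\<^sub>R a) = norm a powr (p - 1)"
    by (cases "a = 0") (simp_all add: powr_diff field_simps power2_eq_square)
qed

text \<open>
  The integrand of the comparison argument, with \<open>t\<close> in the place of the supersolution and \<open>c\<close> in
  that of its gradient: \<open>A\<close> is the flux of the supersolution, \<open>- k x\<close> the one of \<open>V\<close>. Young's
  inequality bounds both the coefficient of \<open>P\<close> and the one of \<open>Q\<close>.
\<close>

lemma comparison_integrand_le:
  fixes b c x :: "'a::real_inner" and p t P Q :: real
  assumes p: "1 < p" and t: "0 < t" and P: "0 \<le> P" and Q: "0 \<le> Q"
    and flux: "norm b powr (p - 2) *\<^sub>R b = - k *\<^sub>R x"
    and A: "A = norm c powr (p - 2) *\<^sub>R c"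
  shows "exp (p * V - (p - 1) * ln t) * (P * (p * (A \<bullet> b) - (p - 1) / t * (A \<bullet> c)) + Q * (A \<bullet> b - A \<bullet> c / t))
      - h * t powr (p - 1) * (exp (p * V - (p - 1) * ln t) * P)
      + exp (p * V) * (P * (p * k * (x \<bullet> b) + D) + Q * k * (x \<bullet> b - x \<bullet> c / t))
    \<le> exp (p * V) * P * (D - (p - 1) * norm b powr p - h)"
proof -
  \<comment> \<open>If t is the value of u, then a is the gradient of ln u and \<alpha> the
    corresponding flux. By homogeneity A carries the factor t^(p - 1), which the exponential weight
    of the test function absorbs.\<close>
  define a where "a = c /\<^sub>R t"
  define \<alpha> where "\<alpha> = norm a powr (p - 2) *\<^sub>R a"
  define \<beta> where "\<beta> = norm b powr (p - 2) *\<^sub>R b"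
  have c: "c = t *\<^sub>R a" using t by (simp add: a_def)
  have A': "A = t powr (p - 1) *\<^sub>R \<alpha>"
  proof (cases "a = 0")
    case False
    have "t powr (p - 1) = t powr (p - 2) * t" using t by (simp add: powr_diff field_simps power2_eq_square)
    then show ?thesis using t by (simp add: A c \<alpha>_def powr_mult)
  qed (simp add: A c \<alpha>_def)
  have E: "exp (p * V - (p - 1) * ln t) * t powr (p - 1) = exp (p * V)"
    using t by (simp add: powr_def flip: exp_add)
  have kx: "k * (x \<bullet> y) = - (\<beta> \<bullet> y)" for y using flux by (simp add: \<beta>_def)
  have y1: "p * (\<alpha> \<bullet> b) \<le> (p - 1) * norm a powr p + norm b powr p"
  proof -
    have "\<alpha> \<bullet> b \<le> norm \<alpha> * norm b" by (rule norm_cauchy_schwarz)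
    also have "norm \<alpha> = norm a powr (p - 1)" unfolding \<alpha>_def by (rule powr_flux_inner)
    finally have "p * (\<alpha> \<bullet> b) \<le> p * (norm a powr (p - 1) * norm b)" using p by (intro mult_left_mono) auto
    also have "\<dots> \<le> (p - 1) * norm a powr p + norm b powr p"
      using Young_powr[OF p norm_ge_zero norm_ge_zero, of a b] by (simp add: mult.assoc)
    finally show ?thesis .
  qed
  have y2: "p * (\<beta> \<bullet> a) \<le> (p - 1) * norm b powr p + norm a powr p"
  proof -
    have "\<beta> \<bullet> a \<le> norm \<beta> * norm a" by (rule norm_cauchy_schwarz)
    also have "norm \<beta> = norm b powr (p - 1)" unfolding \<beta>_def by (rule powr_flux_inner)
    finally have "p * (\<beta> \<bullet> a) \<le> p * (norm b powr (p - 1) * norm a)" using p by (intro mult_left_mono) auto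
    also have "\<dots> \<le> (p - 1) * norm b powr p + norm a powr p"
      using Young_powr[OF p norm_ge_zero norm_ge_zero, of b a] by (simp add: mult.assoc)
    finally show ?thesis .
  qed
  have aa: "\<alpha> \<bullet> a = norm a powr p" "\<beta> \<bullet> b = norm b powr p"
    unfolding \<alpha>_def \<beta>_def by (rule powr_flux_inner)+
  define eV where "eV = exp (p * V)"
  have eV: "0 < eV" by (simp add: eV_def)
  define E1 where "E1 = exp (p * V - (p - 1) * ln t)"
  have E': "E1 * t powr (p - 1) = eV" unfolding E1_def eV_def by (rule E)
  have e1: "E1 * (P * (p * (A \<bullet> b) - (p - 1) / t * (A \<bullet> c)) + Q * (A \<bullet> b - A \<bullet> c / t))
    = eV * (P * (p * (\<alpha> \<bullet> b) - (p - 1) * (\<alpha> \<bullet> a)) + Q * (\<alpha> \<bullet> b - \<alpha> \<bullet> a))"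
  proof -
    have Ab: "A \<bullet> b = t powr (p - 1) * (\<alpha> \<bullet> b)" by (simp add: A')
    have Ac: "A \<bullet> c = t * (t powr (p - 1) * (\<alpha> \<bullet> a))" by (simp add: A' c)
    have Ac': "(p - 1) / t * (A \<bullet> c) = (p - 1) * (t powr (p - 1) * (\<alpha> \<bullet> a))"
      "A \<bullet> c / t = t powr (p - 1) * (\<alpha> \<bullet> a)"
      using t by (simp_all add: Ac)
    show ?thesis unfolding Ab Ac' E'[symmetric] by (simp add: algebra_simps)
  qed
  have e2: "h * t powr (p - 1) * (E1 * P) = eV * P * h" unfolding E'[symmetric] by simp
  have e3: "eV * (P * (p * k * (x \<bullet> b) + D) + Q * k * (x \<bullet> b - x \<bullet> c / t))
    = eV * (P * (D - p * (\<beta> \<bullet> b)) + Q * (\<beta> \<bullet> a - \<beta> \<bullet> b))"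
  proof -
    have "Q * k * (x \<bullet> b - x \<bullet> c / t) = Q * (k * (x \<bullet> b) - k * (x \<bullet> a))"
      using t by (simp add: c algebra_simps)
    moreover have "p * k * (x \<bullet> b) = p * (k * (x \<bullet> b))" by simp
    ultimately show ?thesis unfolding kx by simp
  qed
  have "E1 * (P * (p * (A \<bullet> b) - (p - 1) / t * (A \<bullet> c)) + Q * (A \<bullet> b - A \<bullet> c / t))
      - h * t powr (p - 1) * (E1 * P) + eV * (P * (p * k * (x \<bullet> b) + D) + Q * k * (x \<bullet> b - x \<bullet> c / t))
    = eV * (P * (p * (\<alpha> \<bullet> b) - (p - 1) * norm a powr p - p * norm b powr p + D - h)
      + Q * (\<alpha> \<bullet> b + \<beta> \<bullet> a - norm a powr p - norm b powr p))"
    unfolding e1 e2 e3 aa by (simp add: algebra_simps)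
  \<comment> \<open>The coefficient of Q is - (\<alpha> - \<beta>) \<bullet> (a - b), so its sign is
    the monotonicity of the p-Laplacian flux. The bound for the coefficient of P is Picone's
    inequality in logarithmic form.\<close>
  also have "\<dots> \<le> eV * (P * (D - (p - 1) * norm b powr p - h) + Q * 0)"
  proof -
    have "p * (\<alpha> \<bullet> b + \<beta> \<bullet> a - norm a powr p - norm b powr p) \<le> 0"
      using y1 y2 by (simp add: algebra_simps)
    then have q: "\<alpha> \<bullet> b + \<beta> \<bullet> a - norm a powr p - norm b powr p \<le> 0"
      using p by (simp add: mult_le_0_iff)
    have "p * (\<alpha> \<bullet> b) - (p - 1) * norm a powr p - p * norm b powr p + D - h
      \<le> D - (p - 1) * norm b powr p - h"
      using y1 by (simp add: algebra_simps)
    then show ?thesis using q P Q eV by (intro mult_left_mono add_mono) auto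
  qed
  finally show ?thesis unfolding E1_def eV_def by simp
qed

lemma powr_le_one_plus_powr:
  fixes q p t :: real
  assumes "0 \<le> q" "q \<le> p" "0 \<le> t"
  shows "t powr q \<le> 1 + t powr p"
proof (cases "1 \<le> t")
  case True
  then show ?thesis using powr_mono[of q p t] assms by simp
next
  case False
  then have "t powr q \<le> 1" using assms by (intro powr_le1) auto
  then show ?thesis by (simp add: add_increasing2)
qed

section \<open>The comparison principle in an annulus\<close>

text \<open>The supersolution is u = m + w. Splitting off m leaves a w that stays integrable when
  extended by 0, and every mollification of it, added to m, is at least m, so logarithms are
  harmless. The term with f has already been discarded by its sign. The tests avoid the origin,
  where the Hardy weight is singular.\<close>

locale positive_supersolution =
  fixes p \<mu> d m :: real and w :: "'a::euclidean_space \<Rightarrow> real" and g :: "'a \<Rightarrow> 'a"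
  assumes p: "1 < p" and m: "0 < m"
    and w: "integrable lborel w" "\<And>x. 0 \<le> w x"
    and g: "integrable lborel g" "integrable lborel (\<lambda>x. norm (g x) powr p)"
      "\<And>x. x \<notin> ball 0 d \<Longrightarrow> g x = 0"
    and weak_gradient: "\<And>\<phi> i. \<phi> \<in> C0_infinity (ball 0 d) \<Longrightarrow> i \<in> Basis \<Longrightarrow>
      (LBINT x. w x * partial_deriv i \<phi> x) = - (LBINT x. (g x \<bullet> i) * \<phi> x)"
    and power_integrable: "integrable lborel (\<lambda>x. indicator (ball 0 d) x * (m + w x) powr (p - 1))"
    and supersolution: "\<And>\<phi>. \<phi> \<in> C0_infinity (ball 0 d - {0}) \<Longrightarrow> (\<And>x. 0 \<le> \<phi> x) \<Longrightarrow>
      0 \<le> (LBINT x. (norm (g x) powr (p - 2) *\<^sub>R g x) \<bullet> grad \<phi> x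
        - \<mu> / norm x powr p * (m + w x) powr (p - 1) * \<phi> x)"

text \<open>Here b is the gradient of V, - k x its flux and \<kappa> the gradient of k, so that
  \<open>x \<bullet> \<kappa> x + real DIM('a) * k x\<close> is the divergence of the field k x.
  \<open>subsolution\<close> is the inequality for exp V divided by exp ((p - 1) V).
  \<open>V_le\<close> gives V \<le> ln u outside the annulus and thereby confines the test functions
  to it.\<close>

locale supersolution_comparison = positive_supersolution p \<mu> d m w g
  for p \<mu> d m :: real and w :: "'a::euclidean_space \<Rightarrow> real" and g :: "'a \<Rightarrow> 'a" +
  fixes \<mu>' r1 r0 :: real and V k :: "'a \<Rightarrow> real" and b \<kappa> :: "'a \<Rightarrow> 'a"
  assumes \<mu>: "\<mu>' < \<mu>" and r: "0 < r1" "r0 < d"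
    and V: "\<And>x. x \<noteq> 0 \<Longrightarrow> (V has_derivative (\<lambda>h. b x \<bullet> h)) (at x)" "continuous_on (- {0}) b"
    and k: "\<And>x. x \<noteq> 0 \<Longrightarrow> (k has_derivative (\<lambda>h. \<kappa> x \<bullet> h)) (at x)" "continuous_on (- {0}) \<kappa>"
    and flux: "\<And>x. x \<noteq> 0 \<Longrightarrow> norm (b x) powr (p - 2) *\<^sub>R b x = - k x *\<^sub>R x"
    and subsolution: "\<And>x. r1 \<le> norm x \<Longrightarrow> norm x \<le> r0 \<Longrightarrow>
      x \<bullet> \<kappa> x + real DIM('a) * k x - (p - 1) * norm (b x) powr p \<le> \<mu>' / norm x powr p"
    and V_le: "\<And>x. norm x < r1 \<or> r0 < norm x \<Longrightarrow> V x \<le> ln m"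
begin

definition annulus :: "'a set"
  where "annulus = {x. r1 \<le> norm x \<and> norm x \<le> r0}"

definition flux_u :: "'a \<Rightarrow> 'a"
  where "flux_u x = norm (g x) powr (p - 2) *\<^sub>R g x"

text \<open>The tested supersolution inequality plus the divergence of \<zeta> x, where \<zeta> =
  exp (p V) k P(V - ln t). The arguments t and c enter through the test functions and will be
  mollifications; \<open>flux_u\<close> and the power of m + w always belong to u itself.\<close>

definition integrand :: "'a \<Rightarrow> real \<Rightarrow> 'a \<Rightarrow> real"
  where "integrand x t c =
    exp (p * V x - (p - 1) * ln t) * (pos_sq (V x - ln t) * (p * (flux_u x \<bullet> b x) - (p - 1) / t * (flux_u x \<bullet> c))
        + 2 * max 0 (V x - ln t) * (flux_u x \<bullet> b x - flux_u x \<bullet> c / t))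
      - \<mu> / norm x powr p * (m + w x) powr (p - 1) * (exp (p * V x - (p - 1) * ln t) * pos_sq (V x - ln t))
      + exp (p * V x) * (pos_sq (V x - ln t) * (p * k x * (x \<bullet> b x) + (x \<bullet> \<kappa> x + real DIM('a) * k x))
        + 2 * max 0 (V x - ln t) * k x * (x \<bullet> b x - x \<bullet> c / t))"

lemma annulus: "compact annulus" "0 \<notin> annulus" "annulus \<subseteq> ball 0 d - {0}"
proof -
  have "annulus = cball 0 r0 - ball 0 r1" by (auto simp: annulus_def)
  then show "compact annulus" by (simp add: compact_diff)
  show "0 \<notin> annulus" "annulus \<subseteq> ball 0 d - {0}" using r by (auto simp: annulus_def)
qed

lemma V_le_off_annulus: "x \<notin> annulus \<Longrightarrow> V x \<le> ln m"
  using V_le[of x] by (auto simp: annulus_def)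

lemma integrand_off_annulus: "x \<notin> annulus \<Longrightarrow> m \<le> t \<Longrightarrow> integrand x t c = 0"
proof -
  assume "x \<notin> annulus" "m \<le> t"
  then have "V x - ln t \<le> 0" using V_le_off_annulus[of x] ln_mono[OF _ m, of t] by fastforce
  then have "pos_sq (V x - ln t) = 0" "max 0 (V x - ln t) = 0" by (auto simp: pos_sq_def)
  then show "integrand x t c = 0" by (simp add: integrand_def)
qed

text \<open>V and f may be singular at the origin, but there V \<le> ln m \<le> ln u, so
  \<open>pos_sq\<close> makes the product vanish on the ball of radius r1. That ball and the
  complement of 0 are open and cover the space.\<close>

lemma C1_grad_truncated:
  assumes u: "C1_grad u U" "\<And>x. m \<le> u x"
    and f: "\<And>x. x \<noteq> 0 \<Longrightarrow> (f has_derivative (\<lambda>h. F x \<bullet> h)) (at x)" "continuous_on (- {0}) F"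
  shows "C1_grad (\<lambda>x. f x * pos_sq (V x - ln (u x)))
    (\<lambda>x. pos_sq (V x - ln (u x)) *\<^sub>R F x + (f x * (2 * max 0 (V x - ln (u x)))) *\<^sub>R (b x - U x /\<^sub>R u x))"
    (is "C1_grad ?f ?F")
proof -
  have upos: "0 < u x" for x using u(2)[of x] m by simp
  have zero: "V x - ln (u x) \<le> 0" if "x \<in> ball 0 r1" for x
    using V_le[of x] that ln_mono[OF u(2)[of x] m] by fastforce
  have z: "?f x = 0" "?F x = 0" if "x \<in> ball 0 r1" for x
    using zero[OF that] by (auto simp: pos_sq_def)
  have cf: "continuous_on (- {0}) f" "continuous_on (- {0}) V"
    using f(1) V(1) by (auto intro!: continuous_at_imp_continuous_on has_derivative_continuous)
  have cu: "continuous_on (- {0}) u" "continuous_on (- {0}) U"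
    using C1_grad_continuous[OF u(1)] u(1) by (auto simp: C1_grad_def intro: continuous_on_subset)
  have Dlog: "((\<lambda>x. V x - ln (u x)) has_derivative (\<lambda>h. (b x - U x /\<^sub>R u x) \<bullet> h)) (at x)" if "x \<noteq> 0" for x
  proof -
    have "(u has_derivative (\<lambda>h. U x \<bullet> h)) (at x)" using u(1) by (simp add: C1_grad_def)
    then show ?thesis
      using V(1)[OF that] upos[of x]
      by (auto intro!: derivative_eq_intros simp: inner_diff_left divide_inverse)
  qed
  have D: "(?f has_derivative (\<lambda>h. ?F x \<bullet> h)) (at x)" for x
  proof (cases "x = 0")
    case True
    have "((\<lambda>_. 0) has_derivative (\<lambda>h. ?F x \<bullet> h)) (at x)"
      using z(2)[of 0] r True by simp
    then show ?thesis
      by (rule has_derivative_transform_within_open[of _ _ _ _ "ball 0 r1"]) (use True r z in auto)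
  next
    case False
    have "((\<lambda>x. pos_sq (V x - ln (u x))) has_derivative
      (\<lambda>h. 2 * max 0 (V x - ln (u x)) * ((b x - U x /\<^sub>R u x) \<bullet> h))) (at x)"
      using has_derivative_compose[OF Dlog[OF False] DERIV_pos_sq[of "V x - ln (u x)", unfolded has_field_derivative_def]]
      by simp
    from has_derivative_mult[OF f(1)[OF False] this] show ?thesis
      by (rule has_derivative_eq_rhs) (simp add: fun_eq_iff inner_add_left algebra_simps)
  qed
  have "continuous_on (- {0}) ?F"
  proof -
    have ne: "\<forall>x\<in>- {0}. u x \<noteq> 0" using upos by (metis less_irrefl)
    have cT: "continuous_on (- {0}) (\<lambda>x. V x - ln (u x))"
      using cf cu ne by (intro continuous_intros)
    have cP: "continuous_on (- {0}) (\<lambda>x. pos_sq (V x - ln (u x)))"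
      unfolding pos_sq_def by (intro continuous_intros cT)
    have cQ: "continuous_on (- {0}) (\<lambda>x. 2 * max 0 (V x - ln (u x)))"
      by (intro continuous_intros cT)
    show ?thesis
      by (intro continuous_intros cP cQ f(2) cf V(2) cu ne)
  qed
  moreover have "continuous_on (ball 0 r1) ?F"
  proof -
    have "continuous_on (ball 0 r1) (\<lambda>x::'a. 0::'a)" by simp
    then show ?thesis using z(2) by (metis (no_types, lifting) continuous_on_cong)
  qed
  ultimately have "continuous_on (- {0} \<union> ball 0 r1) ?F"
    by (intro continuous_on_open_Un) (auto simp: open_Compl)
  moreover have "- {0} \<union> ball 0 r1 = (UNIV :: 'a set)" using r by auto
  ultimately have "continuous_on UNIV ?F" by simp
  then show ?thesis using D unfolding C1_grad_def by blast
qed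

lemma norm_flux_u: "norm (flux_u x) = norm (g x) powr (p - 1)"
  unfolding flux_u_def by (rule powr_flux_inner)

lemma flux_u_integrable: "integrable lborel flux_u"
proof (rule Bochner_Integration.integrable_bound)
  show "integrable lborel (\<lambda>x. indicator (ball 0 d) x + norm (g x) powr p)"
    using g(2) emeasure_bounded_finite[OF bounded_ball, of "0::'a" d] by auto
  have [measurable]: "g \<in> borel_measurable borel" using g by auto
  show "flux_u \<in> borel_measurable lborel" unfolding flux_u_def[abs_def] by measurable
  show "AE x in lborel. norm (flux_u x) \<le> norm (indicator (ball 0 d) x + norm (g x) powr p)"
  proof (intro AE_I2)
    fix x
    show "norm (flux_u x) \<le> norm (indicator (ball 0 d) x + norm (g x) powr p)"
      using powr_le_one_plus_powr[of "p - 1" p "norm (g x)"] p g(3)[of x]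
      by (cases "x \<in> ball 0 d") (auto simp: norm_flux_u)
  qed
qed

text \<open>The supersolution inequality tested with \<phi> gives a nonnegative contribution, and
  the divergence of \<zeta> x integrates to 0. Both tests carry the same truncation P(V - ln
  u).\<close>

lemma approximate_integral_nonneg:
  assumes u: "C1_grad u U" "\<And>x. m \<le> u x"
  shows "integrable lborel (\<lambda>x. integrand x (u x) (U x))"
    "0 \<le> (LBINT x. integrand x (u x) (U x))"
proof -
  have upos: "0 < u x" for x using u(2)[of x] m by simp
  have cV: "continuous_on (- {0}) V" "continuous_on (- {0}) k"
    using V(1) k(1) by (auto intro!: continuous_at_imp_continuous_on has_derivative_continuous)
  have cu: "continuous_on (- {0}) u" "continuous_on (- {0}) U"
    using C1_grad_continuous[OF u(1)] u(1) by (auto simp: C1_grad_def intro: continuous_on_subset)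
  have ne: "\<forall>x\<in>- {0}. u x \<noteq> 0" using upos by (metis less_irrefl)
  define T where "T x = V x - ln (u x)" for x
  \<comment> \<open>In terms of v = exp V this is v^p u^(1 - p), the weight of Picone's
    inequality.\<close>
  define f where "f x = exp (p * V x - (p - 1) * ln (u x))" for x
  define F where "F x = f x *\<^sub>R (p *\<^sub>R b x - ((p - 1) / u x) *\<^sub>R U x)" for x
  have f: "(f has_derivative (\<lambda>h. F x \<bullet> h)) (at x)" if "x \<noteq> 0" for x
  proof -
    have "(u has_derivative (\<lambda>h. U x \<bullet> h)) (at x)" using u(1) by (simp add: C1_grad_def)
    from has_derivative_ln[OF upos this] have "((\<lambda>x. p * V x - (p - 1) * ln (u x)) has_derivative
      (\<lambda>h. p * (b x \<bullet> h) - (p - 1) * ((U x \<bullet> h) * inverse (u x)))) (at x)"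
      by (intro has_derivative_diff has_derivative_mult_right V(1)[OF that]) simp
    from has_derivative_exp[OF this] show ?thesis
      unfolding f_def[abs_def] F_def
      by (rule has_derivative_eq_rhs) (simp add: fun_eq_iff inner_diff_left divide_inverse)
  qed
  have cF: "continuous_on (- {0}) F"
    unfolding F_def f_def by (intro continuous_intros cV cu V(2) ne)
  define \<phi> where "\<phi> x = f x * pos_sq (T x)" for x
  define \<Phi> where "\<Phi> x = pos_sq (T x) *\<^sub>R F x + (f x * (2 * max 0 (T x))) *\<^sub>R (b x - U x /\<^sub>R u x)" for x
  have \<phi>: "C1_grad \<phi> \<Phi>"
    using C1_grad_truncated[OF u f cF] unfolding \<phi>_def[abs_def] \<Phi>_def[abs_def] T_def .
  define f2 where "f2 x = exp (p * V x) * k x" for x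
  define F2 where "F2 x = exp (p * V x) *\<^sub>R ((p * k x) *\<^sub>R b x + \<kappa> x)" for x
  have f2: "(f2 has_derivative (\<lambda>h. F2 x \<bullet> h)) (at x)" if "x \<noteq> 0" for x
    unfolding f2_def[abs_def] F2_def
    by (rule has_derivative_eq_rhs[OF has_derivative_mult[OF
          has_derivative_exp[OF has_derivative_mult_right[OF V(1)[OF that]]] k(1)[OF that]]])
      (simp add: fun_eq_iff inner_add_left algebra_simps)
  have cF2: "continuous_on (- {0}) F2"
    unfolding F2_def by (intro continuous_intros cV k(2) V(2))
  define \<zeta> where "\<zeta> x = f2 x * pos_sq (T x)" for x
  define Z where "Z x = pos_sq (T x) *\<^sub>R F2 x + (f2 x * (2 * max 0 (T x))) *\<^sub>R (b x - U x /\<^sub>R u x)" for x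
  have \<zeta>: "C1_grad \<zeta> Z"
    using C1_grad_truncated[OF u f2 cF2] unfolding \<zeta>_def[abs_def] Z_def[abs_def] T_def .
  have T0: "pos_sq (T x) = 0" if "x \<notin> annulus" for x
    using V_le_off_annulus[OF that] ln_mono[OF u(2)[of x] m] unfolding T_def pos_sq_eq_0_iff by linarith
  define M where "M x = \<mu> / norm x powr p * (m + w x) powr (p - 1)" for x
  have wm[measurable]: "w \<in> borel_measurable borel" using w by auto
  \<comment> \<open>K stays away from the origin, so the Hardy weight is continuous and bounded on
    it.\<close>
  have MK: "integrable lborel (\<lambda>x. indicator K x * M x)" if K: "compact K" "K \<subseteq> ball 0 d - {0}" for K
  proof -
    have "continuous_on K (\<lambda>x. \<mu> / norm x powr p)"
      using K(2) by (intro continuous_intros) auto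
    then have "compact ((\<lambda>x. \<mu> / norm x powr p) ` K)" using K(1) by (rule compact_continuous_image)
    from compact_imp_bounded[OF this] obtain B where "\<forall>y\<in>(\<lambda>x. \<mu> / norm x powr p) ` K. norm y \<le> B"
      unfolding bounded_iff by blast
    then have B: "\<bar>\<mu> / norm x powr p\<bar> \<le> B" if "x \<in> K" for x
      using that by auto
    have KB: "K \<in> sets borel" using K(1) by (simp add: borel_compact)
    show ?thesis
    proof (rule Bochner_Integration.integrable_bound)
      show "integrable lborel (\<lambda>x. B * (indicator (ball 0 d) x * (m + w x) powr (p - 1)))"
        using power_integrable by simp
      show "(\<lambda>x. indicator K x * M x) \<in> borel_measurable lborel"
        unfolding M_def using KB by measurable
      show "AE x in lborel. norm (indicator K x * M x) \<le>
        norm (B * (indicator (ball 0 d) x * (m + w x) powr (p - 1)))"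
      proof (intro AE_I2)
        fix x
        show "norm (indicator K x * M x) \<le> norm (B * (indicator (ball 0 d) x * (m + w x) powr (p - 1)))"
        proof (cases "x \<in> K")
          case True
          then have "x \<in> ball 0 d" using K(2) by auto
          moreover have "\<bar>\<mu> / norm x powr p\<bar> * (m + w x) powr (p - 1) \<le> \<bar>B\<bar> * (m + w x) powr (p - 1)"
            using B[OF True] by (intro mult_right_mono) auto
          ultimately show ?thesis using True by (simp add: M_def abs_mult)
        qed simp
      qed
    qed
  qed
  have sup: "(LBINT x. M x * \<phi> x) \<le> (LBINT x. flux_u x \<bullet> grad \<phi> x)"
    if that': "\<phi> \<in> C0_infinity (ball 0 d - {0})" "\<And>x. 0 \<le> \<phi> x" for \<phi>
  proof -
    obtain K where K: "compact K" "K \<subseteq> ball 0 d - {0}" "\<And>x. x \<notin> K \<Longrightarrow> \<phi> x = 0"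
      using C0_infinity_support[OF that'(1)] by blast
    have "integrable lborel (\<lambda>x. (indicator K x * M x) \<bullet> \<phi> x)"
      by (rule integrable_inner_compact_support[OF MK[OF K(1,2)] C0_infinity_continuous[OF that'(1)] K(1,3)])
    moreover have "(\<lambda>x. (indicator K x * M x) \<bullet> \<phi> x) = (\<lambda>x. M x * \<phi> x)"
      using K(3) by (auto simp: indicator_def fun_eq_iff)
    ultimately have i1: "integrable lborel (\<lambda>x. M x * \<phi> x)" by simp
    have G: "C1_grad \<phi> (grad \<phi>)" by (rule C0_infinity_C1_grad[OF that'(1)])
    have cg: "continuous_on UNIV (grad \<phi>)" using G by (simp add: C1_grad_def)
    have i2: "integrable lborel (\<lambda>x. flux_u x \<bullet> grad \<phi> x)"
      by (rule integrable_inner_compact_support[OF flux_u_integrable cg K(1)])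
        (rule C1_grad_eq_0_off_closed[OF G compact_imp_closed[OF K(1)] K(3)])
    have "0 \<le> (LBINT x. flux_u x \<bullet> grad \<phi> x - M x * \<phi> x)"
      using supersolution[OF that'] unfolding M_def flux_u_def .
    then show ?thesis using Bochner_Integration.integral_diff[OF i2 i1] by linarith
  qed
  have op: "open (ball 0 d - {0} :: 'a set)" by (intro open_Diff) auto
  have \<phi>0: "0 \<le> \<phi> x" for x by (simp add: \<phi>_def f_def pos_sq_nonneg)
  have \<phi>z: "\<phi> x = 0" if "x \<notin> annulus" for x by (simp add: \<phi>_def T0[OF that])
  have test: "integrable lborel (\<lambda>x. M x * \<phi> x)" "integrable lborel (\<lambda>x. flux_u x \<bullet> \<Phi> x)"
    "(LBINT x. M x * \<phi> x) \<le> (LBINT x. flux_u x \<bullet> \<Phi> x)"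
    by (rule weak_inequality_C1_test[OF flux_u_integrable op MK sup \<phi> \<phi>0 annulus(1,3) \<phi>z]; assumption?; blast?)+
  have \<zeta>z: "\<zeta> x = 0" if "x \<notin> annulus" for x by (simp add: \<zeta>_def T0[OF that])
  have Zz: "Z x = 0" if "x \<notin> annulus" for x
    using C1_grad_eq_0_off_closed[OF \<zeta> compact_imp_closed[OF annulus(1)] \<zeta>z that] .
  have iZ: "integrable lborel (\<lambda>x. x \<bullet> Z x + real DIM('a) * \<zeta> x)"
    by (rule continuous_compact_support_integrable[OF _ annulus(1)])
      (use \<zeta> C1_grad_continuous[OF \<zeta>] Zz \<zeta>z in \<open>auto simp: C1_grad_def intro!: continuous_intros\<close>)
  have eq: "integrand x (u x) (U x) = flux_u x \<bullet> \<Phi> x - M x * \<phi> x + (x \<bullet> Z x + real DIM('a) * \<zeta> x)" for x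
  proof -
    have "flux_u x \<bullet> \<Phi> x = f x * (pos_sq (T x) * (p * (flux_u x \<bullet> b x) - (p - 1) / u x * (flux_u x \<bullet> U x))
        + 2 * max 0 (T x) * (flux_u x \<bullet> b x - flux_u x \<bullet> U x / u x))"
    proof -
      have "flux_u x \<bullet> F x = f x * (p * (flux_u x \<bullet> b x) - (p - 1) / u x * (flux_u x \<bullet> U x))"
        unfolding F_def by (simp add: inner_diff_right)
      moreover have "flux_u x \<bullet> (b x - U x /\<^sub>R u x) = flux_u x \<bullet> b x - flux_u x \<bullet> U x / u x"
        by (simp add: inner_diff_right divide_inverse mult.commute)
      moreover have "P * (f x * Y) + f x * Q * X = f x * (P * Y + Q * X)" for P Q X Y :: real
        by (simp add: distrib_left)
      ultimately show ?thesis unfolding \<Phi>_def by (simp only: inner_add_right inner_scaleR_right)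
    qed
    moreover have "x \<bullet> Z x + real DIM('a) * \<zeta> x = exp (p * V x) *
        (pos_sq (T x) * (p * k x * (x \<bullet> b x) + (x \<bullet> \<kappa> x + real DIM('a) * k x))
        + 2 * max 0 (T x) * k x * (x \<bullet> b x - x \<bullet> U x / u x))"
    proof -
      have "x \<bullet> F2 x = exp (p * V x) * (p * k x * (x \<bullet> b x) + x \<bullet> \<kappa> x)"
        unfolding F2_def by (simp add: inner_add_right)
      moreover have "x \<bullet> (b x - U x /\<^sub>R u x) = x \<bullet> b x - x \<bullet> U x / u x"
        by (simp add: inner_diff_right divide_inverse mult.commute)
      moreover have "P * (E * (Y + X)) + E * l * Q * R + N * (E * l * P) = E * (P * (Y + (X + N * l)) + Q * l * R)"
        for P E Y X l Q R N :: real
        by (simp add: distrib_left)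
      ultimately show ?thesis
        unfolding Z_def \<zeta>_def f2_def by (simp only: inner_add_right inner_scaleR_right)
    qed
    ultimately show ?thesis unfolding integrand_def \<phi>_def M_def f_def T_def by (simp only:)
  qed
  show "integrable lborel (\<lambda>x. integrand x (u x) (U x))"
    unfolding eq by (intro Bochner_Integration.integrable_add Bochner_Integration.integrable_diff test(2,1) iZ)
  have "(LBINT x. integrand x (u x) (U x)) = (LBINT x. flux_u x \<bullet> \<Phi> x - M x * \<phi> x)
      + (LBINT x. x \<bullet> Z x + real DIM('a) * \<zeta> x)"
    unfolding eq
    by (rule Bochner_Integration.integral_add[OF Bochner_Integration.integrable_diff[OF test(2,1)] iZ])
  also have "(LBINT x. flux_u x \<bullet> \<Phi> x - M x * \<phi> x)
      = (LBINT x. flux_u x \<bullet> \<Phi> x) - (LBINT x. M x * \<phi> x)"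
    by (rule Bochner_Integration.integral_diff[OF test(2,1)])
  also have "(LBINT x. x \<bullet> Z x + real DIM('a) * \<zeta> x) = 0"
    by (rule integral_divergence_radial[OF \<zeta> annulus(1) \<zeta>z])
  finally show "0 \<le> (LBINT x. integrand x (u x) (U x))" using test(3) by linarith
qed

end

section \<open>Domination of the integrand uniformly in the mollification\<close>

text \<open>The constant is hidden so that a bound for a long expression can be assembled along its
  syntax. For the weight 1 the relation means boundedness; in the product rules one factor is
  bounded and the other carries the weight.\<close>

definition dominated_on :: "'i set \<Rightarrow> ('i \<Rightarrow> real) \<Rightarrow> ('i \<Rightarrow> real) \<Rightarrow> bool"
  where "dominated_on S W f \<longleftrightarrow> (\<exists>C. \<forall>z\<in>S. \<bar>f z\<bar> \<le> C * W z)"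

lemma dominated_onI: "(\<And>z. z \<in> S \<Longrightarrow> \<bar>f z\<bar> \<le> C * W z) \<Longrightarrow> dominated_on S W f"
  unfolding dominated_on_def by blast

lemma dominated_on_le:
  assumes "dominated_on S W g" "\<And>z. z \<in> S \<Longrightarrow> \<bar>f z\<bar> \<le> \<bar>g z\<bar>"
  shows "dominated_on S W f"
proof -
  obtain C where C: "\<And>z. z \<in> S \<Longrightarrow> \<bar>g z\<bar> \<le> C * W z" using assms(1) unfolding dominated_on_def by blast
  show ?thesis
  proof (rule dominated_onI)
    show "\<bar>f z\<bar> \<le> C * W z" if "z \<in> S" for z using assms(2)[OF that] C[OF that] by linarith
  qed
qed

lemma dominated_on_add:
  assumes "dominated_on S W f" "dominated_on S W g"
  shows "dominated_on S W (\<lambda>z. f z + g z)" "dominated_on S W (\<lambda>z. f z - g z)"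
proof -
  obtain C where C: "\<And>z. z \<in> S \<Longrightarrow> \<bar>f z\<bar> \<le> C * W z" using assms(1) unfolding dominated_on_def by blast
  obtain D where D: "\<And>z. z \<in> S \<Longrightarrow> \<bar>g z\<bar> \<le> D * W z" using assms(2) unfolding dominated_on_def by blast
  have "\<bar>f z + g z\<bar> \<le> (C + D) * W z" "\<bar>f z - g z\<bar> \<le> (C + D) * W z" if "z \<in> S" for z
    using C[OF that] D[OF that] unfolding distrib_right by linarith+
  then show "dominated_on S W (\<lambda>z. f z + g z)" "dominated_on S W (\<lambda>z. f z - g z)"
    by (auto intro!: dominated_onI[where C = "C + D"])
qed

lemma dominated_on_mult:
  assumes "dominated_on S (\<lambda>_. 1) f" "dominated_on S W g"
  shows "dominated_on S W (\<lambda>z. f z * g z)" "dominated_on S W (\<lambda>z. g z * f z)"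
proof -
  obtain C where C: "\<And>z. z \<in> S \<Longrightarrow> \<bar>f z\<bar> \<le> C * 1" using assms(1) unfolding dominated_on_def by blast
  obtain D where D: "\<And>z. z \<in> S \<Longrightarrow> \<bar>g z\<bar> \<le> D * W z" using assms(2) unfolding dominated_on_def by blast
  have "\<bar>f z\<bar> * \<bar>g z\<bar> \<le> (C * D) * W z" if "z \<in> S" for z
  proof -
    have "\<bar>f z\<bar> * \<bar>g z\<bar> \<le> C * (D * W z)"
      using C[OF that] D[OF that] by (intro mult_mono) linarith+
    then show ?thesis by (simp add: mult.assoc)
  qed
  then have "\<bar>f z * g z\<bar> \<le> (C * D) * W z" "\<bar>g z * f z\<bar> \<le> (C * D) * W z" if "z \<in> S" for z
    using that by (simp_all add: abs_mult mult.commute[of "\<bar>g z\<bar>"])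
  then show "dominated_on S W (\<lambda>z. f z * g z)" "dominated_on S W (\<lambda>z. g z * f z)"
    by (auto intro!: dominated_onI[where C = "C * D"])
qed

lemma dominated_on_const: "dominated_on S (\<lambda>_. 1) (\<lambda>_. c)"
  by (rule dominated_onI[where C = "\<bar>c\<bar>"]) simp

lemma dominated_on_weaken:
  assumes "dominated_on S (\<lambda>_. 1) f" "\<And>z. z \<in> S \<Longrightarrow> 1 \<le> W z"
  shows "dominated_on S W f"
proof -
  obtain C where C: "\<And>z. z \<in> S \<Longrightarrow> \<bar>f z\<bar> \<le> C * 1" using assms(1) unfolding dominated_on_def by blast
  have "\<bar>f z\<bar> \<le> max C 0 * W z" if "z \<in> S" for z
  proof -
    have "max C 0 * 1 \<le> max C 0 * W z" using assms(2)[OF that] by (intro mult_left_mono) auto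
    then show ?thesis using C[OF that] by linarith
  qed
  then show ?thesis by (rule dominated_onI)
qed

context supersolution_comparison
begin

text \<open>The weight has to stay controlled when mollified gradients are inserted for c. Young's
  inequality splits the product of the flux and c into p-th powers, and Jensen's inequality then
  handles the power of c.\<close>

definition weight :: "'a \<Rightarrow> 'a \<Rightarrow> real"
  where "weight x c = 1 + norm (g x) powr p + norm c powr p + indicator (ball 0 d) x * (m + w x) powr (p - 1)"

text \<open>The factors built from V, b, k and \<kappa> are continuous on the compact annulus. The
  bound is uniform in t \<ge> m because t enters through exp (- (p - 1) ln t), 1 / t, P(V - ln t)
  and its derivative, all of them nonincreasing in t, so t = m is the worst case.\<close>

lemma integrand_bounded:
  "\<exists>C\<ge>0. \<forall>x t c. m \<le> t \<longrightarrow> \<bar>integrand x t c\<bar> \<le> C * (indicator annulus x * weight x c)"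
proof -
  define X where "X z = fst z" for z :: "'a \<times> real \<times> 'a"
  define t where "t z = fst (snd z)" for z :: "'a \<times> real \<times> 'a"
  define c where "c z = snd (snd z)" for z :: "'a \<times> real \<times> 'a"
  define S where "S = {z. X z \<in> annulus \<and> m \<le> t z}"
  define W where "W z = weight (X z) (c z)" for z
  have S: "X z \<in> annulus" "m \<le> t z" "0 < t z" "X z \<in> ball 0 d" "r1 \<le> norm (X z)" if "z \<in> S" for z
    using that m annulus(3) by (auto simp: S_def annulus_def)
  have W1: "1 \<le> W z" for z unfolding W_def weight_def by simp
  have cont_bdd: "dominated_on S (\<lambda>_. 1) (\<lambda>z. f (X z))"
    if f: "continuous_on (- {0}) f" for f :: "'a \<Rightarrow> real"
  proof -
    have "continuous_on annulus f" using f annulus(2) by (auto intro: continuous_on_subset)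
    then have "compact (f ` annulus)" using annulus(1) by (rule compact_continuous_image)
    from compact_imp_bounded[OF this] obtain B where "\<forall>y\<in>f ` annulus. norm y \<le> B"
      unfolding bounded_iff by blast
    then have "\<bar>f x\<bar> \<le> B" if "x \<in> annulus" for x using that by auto
    then show ?thesis using S(1) by (intro dominated_onI[where C = B]) simp
  qed
  have cV: "continuous_on (- {0}) V" "continuous_on (- {0}) k"
    using V(1) k(1) by (auto intro!: continuous_at_imp_continuous_on has_derivative_continuous)
  have k_bdd: "dominated_on S (\<lambda>_. 1) (\<lambda>z. k (X z))" by (rule cont_bdd[OF cV(2)])
  have xb_bdd: "dominated_on S (\<lambda>_. 1) (\<lambda>z. X z \<bullet> b (X z))"
    by (rule cont_bdd) (intro continuous_intros V(2))
  have xk_bdd: "dominated_on S (\<lambda>_. 1) (\<lambda>z. X z \<bullet> \<kappa> (X z))"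
    by (rule cont_bdd) (intro continuous_intros k(2))
  have h_bdd: "dominated_on S (\<lambda>_. 1) (\<lambda>z. \<mu> / norm (X z) powr p)"
    by (rule cont_bdd) (auto intro!: continuous_intros)
  have eV_bdd: "dominated_on S (\<lambda>_. 1) (\<lambda>z. exp (p * V (X z)))"
    by (rule cont_bdd) (intro continuous_intros cV)
  have lnt: "ln m \<le> ln (t z)" if "z \<in> S" for z using S[OF that] m by (intro ln_mono) auto
  have E_bdd: "dominated_on S (\<lambda>_. 1) (\<lambda>z. exp (p * V (X z) - (p - 1) * ln (t z)))"
  proof -
    have "dominated_on S (\<lambda>_. 1) (\<lambda>z. exp (p * V (X z) - (p - 1) * ln m))"
      by (rule cont_bdd) (intro continuous_intros cV)
    then obtain C where C: "\<And>z. z \<in> S \<Longrightarrow> \<bar>exp (p * V (X z) - (p - 1) * ln m)\<bar> \<le> C * 1"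
      unfolding dominated_on_def by blast
    have "\<bar>exp (p * V (X z) - (p - 1) * ln (t z))\<bar> \<le> C * 1" if "z \<in> S" for z
    proof -
      have "exp (p * V (X z) - (p - 1) * ln (t z)) \<le> exp (p * V (X z) - (p - 1) * ln m)"
        using mult_left_mono[OF lnt[OF that], of "p - 1"] p by simp
      then show ?thesis using C[OF that] unfolding abs_exp_cancel by linarith
    qed
    then show ?thesis by (rule dominated_onI)
  qed
  have Q_bdd: "dominated_on S (\<lambda>_. 1) (\<lambda>z. 2 * max 0 (V (X z) - ln (t z)))"
  proof -
    have "dominated_on S (\<lambda>_. 1) (\<lambda>z. 2 * max 0 (V (X z) - ln m))"
      by (rule cont_bdd) (intro continuous_intros cV)
    then obtain C where C: "\<And>z. z \<in> S \<Longrightarrow> \<bar>2 * max 0 (V (X z) - ln m)\<bar> \<le> C * 1"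
      unfolding dominated_on_def by blast
    have "\<bar>2 * max 0 (V (X z) - ln (t z))\<bar> \<le> C * 1" if "z \<in> S" for z
    proof -
      have "max 0 (V (X z) - ln (t z)) \<le> max 0 (V (X z) - ln m)" using lnt[OF that] by auto
      moreover have "0 \<le> max 0 (V (X z) - ln (t z))" "2 * max 0 (V (X z) - ln m) \<le> C * 1"
        using C[OF that] by (auto simp only: abs_le_iff max.cobounded1)
      moreover have "\<bar>2 * x\<bar> \<le> C * 1" if "x \<le> y" "0 \<le> x" "2 * y \<le> C * 1" for x y :: real
        using that by simp
      ultimately show ?thesis by blast
    qed
    then show ?thesis by (rule dominated_onI)
  qed
  have P_bdd: "dominated_on S (\<lambda>_. 1) (\<lambda>z. pos_sq (V (X z) - ln (t z)))"
  proof -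
    have "pos_sq (V (X z) - ln (t z)) = (2 * max 0 (V (X z) - ln (t z))) * (2 * max 0 (V (X z) - ln (t z))) * (1/4)" for z
      by (simp add: pos_sq_def power2_eq_square)
    then show ?thesis
      by (simp only:) (intro dominated_on_mult dominated_on_const Q_bdd)
  qed
  have it_bdd: "dominated_on S (\<lambda>_. 1) (\<lambda>z. inverse (t z))"
  proof -
    have "\<bar>inverse (t z)\<bar> \<le> inverse m * 1" if "z \<in> S" for z
      using S(2,3)[OF that] m by (simp add: le_imp_inverse_le)
    then show ?thesis by (rule dominated_onI)
  qed
  have gW: "norm (flux_u (X z)) \<le> W z" "norm (flux_u (X z)) * norm (c z) \<le> W z" "norm (c z) \<le> W z" for z
  proof -
    have *: "norm (flux_u (X z)) = norm (g (X z)) powr (p - 1)" by (rule norm_flux_u)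
    show "norm (flux_u (X z)) \<le> W z"
      using powr_le_one_plus_powr[of "p - 1" p "norm (g (X z))"] p
      unfolding * W_def weight_def by (smt (verit) indicator_pos_le mult_nonneg_nonneg norm_ge_zero powr_ge_zero)
    show "norm (c z) \<le> W z"
      using powr_le_one_plus_powr[of 1 p "norm (c z)"] p
      unfolding W_def weight_def by (smt (verit) indicator_pos_le mult_nonneg_nonneg norm_ge_zero powr_ge_zero powr_one_gt_zero_iff powr_one)
    have "p * (norm (flux_u (X z)) * norm (c z)) \<le> (p - 1) * norm (g (X z)) powr p + norm (c z) powr p"
      unfolding * using Young_powr[OF p norm_ge_zero norm_ge_zero, of "g (X z)" "c z"] by (simp add: mult.assoc)
    also have "\<dots> \<le> p * (norm (g (X z)) powr p) + p * norm (c z) powr p"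
      using p mult_right_mono[of 1 p "norm (c z) powr p"] by (intro add_mono mult_right_mono) auto
    finally have "norm (flux_u (X z)) * norm (c z) \<le> norm (g (X z)) powr p + norm (c z) powr p"
      using p by (simp flip: distrib_left)
    then show "norm (flux_u (X z)) * norm (c z) \<le> W z"
      unfolding W_def weight_def by (smt (verit) indicator_pos_le mult_nonneg_nonneg powr_ge_zero)
  qed
  have Ab: "dominated_on S W (\<lambda>z. flux_u (X z) \<bullet> b (X z))"
  proof -
    have "dominated_on S (\<lambda>_. 1) (\<lambda>z. norm (b (X z)))"
      by (rule cont_bdd) (intro continuous_intros V(2))
    moreover have "dominated_on S W (\<lambda>z. norm (flux_u (X z)))"
      using gW(1) by (intro dominated_onI[where C = 1]) simp
    ultimately have "dominated_on S W (\<lambda>z. norm (b (X z)) * norm (flux_u (X z)))"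
      by (rule dominated_on_mult)
    moreover have "\<bar>flux_u (X z) \<bullet> b (X z)\<bar> \<le> \<bar>norm (b (X z)) * norm (flux_u (X z))\<bar>" for z
      using Cauchy_Schwarz_ineq2[of "flux_u (X z)" "b (X z)"] by (simp add: abs_mult mult.commute)
    ultimately show ?thesis by (rule dominated_on_le)
  qed
  have Ac: "dominated_on S W (\<lambda>z. flux_u (X z) \<bullet> c z)"
  proof (rule dominated_onI[where C = 1])
    fix z
    show "\<bar>flux_u (X z) \<bullet> c z\<bar> \<le> 1 * W z"
      using Cauchy_Schwarz_ineq2[of "flux_u (X z)" "c z"] gW(2)[of z] by simp
  qed
  have xc: "dominated_on S W (\<lambda>z. X z \<bullet> c z)"
  proof -
    have "dominated_on S (\<lambda>_. 1) (\<lambda>z. norm (X z))"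
      by (rule cont_bdd) (intro continuous_intros)
    moreover have "dominated_on S W (\<lambda>z. norm (c z))"
      using gW(3) by (intro dominated_onI[where C = 1]) simp
    ultimately have "dominated_on S W (\<lambda>z. norm (X z) * norm (c z))"
      by (rule dominated_on_mult)
    moreover have "\<bar>X z \<bullet> c z\<bar> \<le> \<bar>norm (X z) * norm (c z)\<bar>" for z
      using Cauchy_Schwarz_ineq2[of "X z" "c z"] by (simp add: abs_mult)
    ultimately show ?thesis by (rule dominated_on_le)
  qed
  have MW: "dominated_on S W (\<lambda>z. (m + w (X z)) powr (p - 1))"
    using S(4) by (intro dominated_onI[where C = 1]) (simp add: W_def weight_def)
  note bdd = k_bdd xb_bdd xk_bdd h_bdd eV_bdd E_bdd Q_bdd P_bdd it_bdd dominated_on_const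
  have wk: "dominated_on S W f" if "dominated_on S (\<lambda>_. 1) f" for f
    using that W1 by (rule dominated_on_weaken)
  have Act: "dominated_on S W (\<lambda>z. flux_u (X z) \<bullet> c z / t z)"
    unfolding divide_inverse by (rule dominated_on_mult(2)[OF it_bdd Ac])
  have xct: "dominated_on S W (\<lambda>z. X z \<bullet> c z / t z)"
    unfolding divide_inverse by (rule dominated_on_mult(2)[OF it_bdd xc])
  have pt_bdd: "dominated_on S (\<lambda>_. 1) (\<lambda>z. (p - 1) / t z)"
    unfolding divide_inverse by (intro dominated_on_mult bdd)
  have "dominated_on S W (\<lambda>z. integrand (X z) (t z) (c z))"
    unfolding integrand_def
  proof (rule dominated_on_add(1)[OF dominated_on_add(2)])
    show "dominated_on S W (\<lambda>z. exp (p * V (X z) - (p - 1) * ln (t z)) *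
      (pos_sq (V (X z) - ln (t z)) * (p * (flux_u (X z) \<bullet> b (X z)) - (p - 1) / t z * (flux_u (X z) \<bullet> c z))
       + 2 * max 0 (V (X z) - ln (t z)) * (flux_u (X z) \<bullet> b (X z) - flux_u (X z) \<bullet> c z / t z)))"
      by (intro dominated_on_mult(1)[OF E_bdd] dominated_on_add dominated_on_mult(1)[OF P_bdd]
          dominated_on_mult(1)[OF Q_bdd] dominated_on_mult(1)[OF dominated_on_const]
          dominated_on_mult(1)[OF pt_bdd] Ab Ac Act)
    show "dominated_on S W (\<lambda>z. \<mu> / norm (X z) powr p * (m + w (X z)) powr (p - 1) *
      (exp (p * V (X z) - (p - 1) * ln (t z)) * pos_sq (V (X z) - ln (t z))))"
      by (rule dominated_on_mult(2)[OF dominated_on_mult(1)[OF E_bdd P_bdd] dominated_on_mult(1)[OF h_bdd MW]])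
    have "dominated_on S (\<lambda>_. 1) (\<lambda>z. pos_sq (V (X z) - ln (t z)) *
        (p * k (X z) * (X z \<bullet> b (X z)) + (X z \<bullet> \<kappa> (X z) + real DIM('a) * k (X z))))"
      by (intro dominated_on_mult(1) dominated_on_add(1) bdd)
    then have 1: "dominated_on S W (\<lambda>z. pos_sq (V (X z) - ln (t z)) *
        (p * k (X z) * (X z \<bullet> b (X z)) + (X z \<bullet> \<kappa> (X z) + real DIM('a) * k (X z))))" by (rule wk)
    have 2: "dominated_on S W (\<lambda>z. 2 * max 0 (V (X z) - ln (t z)) * k (X z) * (X z \<bullet> b (X z) - X z \<bullet> c z / t z))"
      by (rule dominated_on_mult(1)[OF dominated_on_mult(1)[OF Q_bdd k_bdd] dominated_on_add(2)[OF wk[OF xb_bdd] xct]])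
    show "dominated_on S W (\<lambda>z. exp (p * V (X z)) * (pos_sq (V (X z) - ln (t z)) *
        (p * k (X z) * (X z \<bullet> b (X z)) + (X z \<bullet> \<kappa> (X z) + real DIM('a) * k (X z)))
        + 2 * max 0 (V (X z) - ln (t z)) * k (X z) * (X z \<bullet> b (X z) - X z \<bullet> c z / t z)))"
      by (rule dominated_on_mult(1)[OF eV_bdd dominated_on_add(1)[OF 1 2]])
  qed
  then obtain C where C: "\<And>z. z \<in> S \<Longrightarrow> \<bar>integrand (X z) (t z) (c z)\<bar> \<le> C * W z"
    unfolding dominated_on_def by blast
  have "\<bar>integrand x s y\<bar> \<le> max C 0 * (indicator annulus x * weight x y)" if "m \<le> s" for x s y
  proof (cases "x \<in> annulus")
    case True
    have z: "(x, s, y) \<in> S" using True that by (simp add: S_def X_def t_def)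
    have "C * W (x, s, y) \<le> max C 0 * W (x, s, y)"
      using W1[of "(x, s, y)"] by (intro mult_right_mono) auto
    then show ?thesis using C[OF z] True by (simp add: X_def t_def c_def W_def)
  qed (simp add: integrand_off_annulus[OF _ that])
  then show ?thesis by (intro exI[of _ "max C 0"]) auto
qed

text \<open>The pointwise inequality requires that \<open>flux_u\<close> be the flux of c, which
  holds at c = g. For a mollified gradient it may fail, and so the sign is available only after
  passing to the limit.\<close>

lemma integrand_le:
  assumes x: "x \<in> annulus"
  shows "integrand x (m + w x) (g x) \<le>
    - (exp (p * V x) * pos_sq (V x - ln (m + w x)) * ((\<mu> - \<mu>') / norm x powr p))"
proof -
  have x0: "x \<noteq> 0" and xr: "r1 \<le> norm x" "norm x \<le> r0" using x annulus(2) by (auto simp: annulus_def)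
  have t: "0 < m + w x" using m w(2)[of x] by simp
  have "integrand x (m + w x) (g x) \<le> exp (p * V x) * pos_sq (V x - ln (m + w x)) *
    ((x \<bullet> \<kappa> x + real DIM('a) * k x) - (p - 1) * norm (b x) powr p - \<mu> / norm x powr p)"
    unfolding integrand_def
    by (rule comparison_integrand_le[OF p t pos_sq_nonneg _ flux[OF x0]]) (auto simp: flux_u_def)
  also have "\<dots> \<le> exp (p * V x) * pos_sq (V x - ln (m + w x)) * (\<mu>' / norm x powr p - \<mu> / norm x powr p)"
    using subsolution[OF xr] by (intro mult_left_mono) (auto simp: pos_sq_nonneg)
  also have "\<dots> = - (exp (p * V x) * pos_sq (V x - ln (m + w x)) * ((\<mu> - \<mu>') / norm x powr p))"
    by (simp add: diff_divide_distrib algebra_simps)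
  finally show ?thesis .
qed

section \<open>Removing the mollification\<close>

text \<open>For x in the annulus the reflected mollifier \<rho> (x - y) is supported in the ball of
  radius d, hence a test function for the weak gradient; the bound on s ensures this. Outside the
  annulus the two gradients may differ, since w can jump at the boundary of the ball, but there the
  integrand vanishes.\<close>

lemma C1_grad_mollified:
  assumes \<rho>: "mollifier s \<rho>" "s \<le> (d - r0) / 2"
  shows "\<exists>U. C1_grad (\<lambda>x. m + convol \<rho> w x) U \<and> (\<forall>x\<in>annulus. U x = convol \<rho> g x)"
    "\<And>x. m \<le> m + convol \<rho> w x"
proof -
  have \<rho>C: "\<rho> \<in> C0_infinity UNIV" using \<rho> by (simp add: mollifier_def)
  have G: "C1_grad \<rho> (grad \<rho>)" by (rule C0_infinity_C1_grad[OF \<rho>C])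
  define U where "U x = (LBINT y. w y *\<^sub>R grad \<rho> (x - y))" for x
  have C: "C1_grad (convol \<rho> w) U"
    unfolding U_def[abs_def]
    by (rule convol_C1_grad[OF w(1) G compact_cball mollifier_kernel(5)[OF \<rho>(1)]])
  have cg: "continuous_on UNIV (grad \<rho>)" using G by (simp add: C1_grad_def)
  have zg: "grad \<rho> x = 0" if "x \<notin> cball 0 s" for x
    using C1_grad_eq_0_off_closed[OF G closed_cball mollifier_kernel(5)[OF \<rho>(1)] that] .
  have "((\<lambda>x. m + convol \<rho> w x) has_derivative (\<lambda>h. U x \<bullet> h)) (at x)" for x
    using C by (auto simp: C1_grad_def intro!: derivative_eq_intros)
  then have C': "C1_grad (\<lambda>x. m + convol \<rho> w x) U" using C by (simp add: C1_grad_def)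
  have eq: "U x = convol \<rho> g x" if x: "x \<in> annulus" for x
  proof (rule euclidean_eqI)
    fix i :: 'a assume i: "i \<in> Basis"
    define \<phi> where "\<phi> y = \<rho> (x - y)" for y
    have Ck: "C_k n \<phi>" for n
      unfolding \<phi>_def using \<rho>C by (intro C_k_reflect) (simp add: C0_infinity_def)
    have sub: "cball x s \<subseteq> ball 0 d"
    proof
      fix y assume "y \<in> cball x s"
      then have "norm (x - y) \<le> s" by (simp add: dist_norm)
      moreover have "norm x \<le> r0" using x by (simp add: annulus_def)
      ultimately have "norm y \<le> r0 + s" using norm_triangle_sub[of y x] by (simp add: norm_minus_commute)
      then show "y \<in> ball 0 d" using \<rho>(2) r by (simp add: field_simps)
    qed
    have z: "\<phi> y = 0" if "y \<notin> cball x s" for y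
      using that \<rho>(1) by (auto simp: \<phi>_def mollifier_def dist_norm)
    have \<phi>: "\<phi> \<in> C0_infinity (ball 0 d)" by (rule C0_infinityI[OF Ck compact_cball sub z])
    have pd: "partial_deriv i \<phi> y = - (grad \<rho> (x - y) \<bullet> i)" for y
    proof -
      have "(\<phi> has_derivative (\<lambda>h. grad \<rho> (x - y) \<bullet> (- h))) (at y)"
      proof -
        have "((\<lambda>y. x - y) has_derivative (\<lambda>h. - h)) (at y)" by (auto intro!: derivative_eq_intros)
        moreover have "(\<rho> has_derivative (\<lambda>h. grad \<rho> (x - y) \<bullet> h)) (at (x - y))" using G by (simp add: C1_grad_def)
        ultimately show ?thesis unfolding \<phi>_def[abs_def] by (rule has_derivative_compose)
      qed
      from partial_deriv_eq[OF this] show ?thesis by simp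
    qed
    have "U x \<bullet> i = (LBINT y. (w y *\<^sub>R grad \<rho> (x - y)) \<bullet> i)"
      unfolding U_def
      using integral_inner_left[of i lborel "\<lambda>y. w y *\<^sub>R grad \<rho> (x - y)"]
        kernel_integrable[OF w(1) cg compact_cball[of 0 s] zg] by simp
    also have "\<dots> = - (LBINT y. w y * partial_deriv i \<phi> y)" by (simp add: pd)
    also have "\<dots> = (LBINT y. (g y \<bullet> i) * \<phi> y)" using weak_gradient[OF \<phi> i] by simp
    also have "\<dots> = (LBINT y. (\<rho> (x - y) *\<^sub>R g y) \<bullet> i)" by (simp add: \<phi>_def mult.commute)
    also have "\<dots> = convol \<rho> g x \<bullet> i"
      unfolding convol_def
      using integral_inner_left[of i lborel "\<lambda>y. \<rho> (x - y) *\<^sub>R g y"] mollifier_integrable[OF \<rho>(1) g(1), of x]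
      by simp
    finally show "U x \<bullet> i = convol \<rho> g x \<bullet> i" .
  qed
  show "\<exists>U. C1_grad (\<lambda>x. m + convol \<rho> w x) U \<and> (\<forall>x\<in>annulus. U x = convol \<rho> g x)"
    using C' eq by blast
  show "m \<le> m + convol \<rho> w x" for x
    unfolding convol_def using mollifier_kernel(4)[OF \<rho>(1)] w(2) by simp
qed

lemma integrand_tendsto:
  assumes "(u \<longlongrightarrow> t) F" "(c \<longlongrightarrow> c0) F" "0 < t"
  shows "((\<lambda>n. integrand x (u n) (c n)) \<longlongrightarrow> integrand x t c0) F"
  unfolding integrand_def pos_sq_def using assms by (intro tendsto_intros) auto

text \<open>The integrals are nonnegative for all mollifications, whereas the limit integrand is at
  most a negative multiple of P(V - ln u). Hence it vanishes almost everywhere, and P(V - ln u) with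
  it.\<close>

theorem comparison: "AE x in lborel. x \<in> annulus \<longrightarrow> V x \<le> ln (m + w x)"
proof -
  have \<delta>: "0 < (d - r0) / 2" using r by simp
  obtain \<rho> S where \<rho>': "\<forall>n::nat. \<exists>s>0. s \<le> (d - r0) / 2 \<and> mollifier s (\<rho> n)"
    and cw: "AE x in lborel. (\<lambda>n. convol (\<rho> n) w x) \<longlonglongrightarrow> w x"
    and cg: "AE x in lborel. (\<lambda>n. convol (\<rho> n) g x) \<longlonglongrightarrow> g x"
    and S: "integrable lborel S" "AE x in lborel. \<forall>n. convol (\<rho> n) (\<lambda>x. norm (g x) powr p) x \<le> S x"
    by (rule mollifier_sequence[OF w(1) g(1,2) \<delta>])
  note \<rho> = \<rho>'[rule_format]
  define u where "u n x = m + convol (\<rho> n) w x" for n x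
  have um: "m \<le> u n x" for n x
    using \<rho>[of n] C1_grad_mollified(2) unfolding u_def by blast
  have "\<forall>n. \<exists>U. C1_grad (u n) U \<and> (\<forall>x\<in>annulus. U x = convol (\<rho> n) g x)"
    using \<rho> C1_grad_mollified(1) unfolding u_def by blast
  then obtain U where U: "\<And>n. C1_grad (u n) (U n)" "\<And>n x. x \<in> annulus \<Longrightarrow> U n x = convol (\<rho> n) g x"
    by metis
  define J where "J n x = integrand x (u n x) (U n x)" for n x
  \<comment> \<open>Defining L as a pointwise limit makes its measurability a consequence of that of
    the \<open>J n\<close>; almost everywhere it is the integrand at u itself.\<close>
  define L where "L x = lim (\<lambda>n. J n x)" for x
  have Ji: "integrable lborel (J n)" and J0: "0 \<le> (LBINT x. J n x)" for n
    using approximate_integral_nonneg[OF U(1) um] unfolding J_def by auto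
  have Jm: "J n \<in> borel_measurable borel" for n using Ji[of n] by auto
  have Lm: "L \<in> borel_measurable lborel"
    unfolding L_def using Jm by (auto intro!: borel_measurable_lim_metric)
  have w': "m \<le> m + w x" "0 < m + w x" for x using w(2)[of x] m by auto
  have conv: "AE x in lborel. (\<lambda>n. J n x) \<longlonglongrightarrow> integrand x (m + w x) (g x)"
    using cw cg
  proof eventually_elim
    case (elim x)
    show ?case
    proof (cases "x \<in> annulus")
      case True
      have "(\<lambda>n. u n x) \<longlonglongrightarrow> m + w x" unfolding u_def by (intro tendsto_intros elim(1))
      moreover have "(\<lambda>n. U n x) \<longlonglongrightarrow> g x" using elim(2) U(2)[OF True] by simp
      ultimately show ?thesis unfolding J_def by (rule integrand_tendsto) (rule w')
    next
      case False
      then show ?thesis unfolding J_def using um w'(1) by (simp add: integrand_off_annulus)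
    qed
  qed
  have L: "AE x in lborel. (\<lambda>n. J n x) \<longlonglongrightarrow> L x" "AE x in lborel. L x = integrand x (m + w x) (g x)"
    using conv by (eventually_elim, auto simp: L_def limI)+
  obtain C where C: "C \<ge> 0" "\<And>x t c. m \<le> t \<Longrightarrow> \<bar>integrand x t c\<bar> \<le> C * (indicator annulus x * weight x c)"
    using integrand_bounded by auto
  \<comment> \<open>This is \<open>weight\<close> with the power of the mollified gradient replaced
    by its majorant S, and with the constant 1 restricted to the annulus to make it
    integrable.\<close>
  define D where "D x = C * (indicator annulus x + norm (g x) powr p + \<bar>S x\<bar> +
    indicator (ball 0 d) x * (m + w x) powr (p - 1))" for x
  have "integrable lborel (indicator annulus :: 'a \<Rightarrow> real)"
    using emeasure_compact_finite[OF annulus(1)] annulus(1) by (simp add: borel_compact)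
  then have Di: "integrable lborel D"
    unfolding D_def[abs_def] using g(2) S(1) power_integrable by auto
  have bound: "AE x in lborel. norm (J n x) \<le> D x" for n
    using S(2)
  proof eventually_elim
    case (elim x)
    obtain s where s: "mollifier s (\<rho> n)" using \<rho> by blast
    have nn: "0 \<le> indicator (ball 0 d) x * (m + w x) powr (p - 1)" by simp
    show ?case
    proof (cases "x \<in> annulus")
      case True
      have "norm (U n x) powr p \<le> convol (\<rho> n) (\<lambda>x. norm (g x) powr p) x"
        unfolding U(2)[OF True] by (rule norm_convol_powr_le[OF p s g(1,2)])
      also have "\<dots> \<le> \<bar>S x\<bar>" using elim by (meson abs_ge_self order_trans)
      finally have "C * (indicator annulus x * weight x (U n x)) \<le> D x"
        unfolding D_def weight_def using True C(1) by (intro mult_left_mono) auto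
      then show ?thesis using C(2)[where x = x and t = "u n x" and c = "U n x", OF um] unfolding J_def by simp
    next
      case False
      then show ?thesis
        unfolding J_def D_def using C(1) um by (simp add: integrand_off_annulus)
    qed
  qed
  have Jm': "J n \<in> borel_measurable lborel" for n using Jm by simp
  have lim: "(\<lambda>n. \<integral>x. J n x \<partial>lborel) \<longlonglongrightarrow> (LBINT x. L x)"
    by (rule integral_dominated_convergence[OF Lm Jm' Di L(1) bound])
  have Li: "integrable lborel L"
    by (rule integrable_dominated_convergence[OF Lm Jm' Di L(1) bound])
  have L0: "0 \<le> (LBINT x. L x)" using lim J0 by (intro LIMSEQ_le_const[OF lim]) auto
  have Lle: "AE x in lborel. L x \<le> 0"
    using L(2)
  proof eventually_elim
    case (elim x)
    show ?case
    proof (cases "x \<in> annulus")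
      case True
      have "0 \<le> exp (p * V x) * pos_sq (V x - ln (m + w x)) * ((\<mu> - \<mu>') / norm x powr p)"
        using \<mu> by (intro mult_nonneg_nonneg) (auto simp: pos_sq_nonneg)
      then show ?thesis using integrand_le[OF True] elim by simp
    qed (simp add: elim integrand_off_annulus[OF _ w'(1)])
  qed
  have "AE x in lborel. - L x = 0"
  proof (rule integral_nonneg_eq_0_iff_AE[THEN iffD1])
    show "AE x in lborel. 0 \<le> - L x" using Lle by auto
    have "(LBINT x. L x) \<le> 0" using Lle integral_mono_AE[OF Li, of "\<lambda>_. 0"] by simp
    then show "(LBINT x. - L x) = 0" using L0 by simp
  qed (use Li in auto)
  then show ?thesis
    using L(2)
  proof eventually_elim
    case (elim x)
    show ?case
    proof
      assume x: "x \<in> annulus"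
      then have "x \<noteq> 0" using annulus(2) by auto
      then have pos: "0 < exp (p * V x) * ((\<mu> - \<mu>') / norm x powr p)" using \<mu> by simp
      have "exp (p * V x) * ((\<mu> - \<mu>') / norm x powr p) * pos_sq (V x - ln (m + w x)) \<le> 0"
        using integrand_le[OF x] elim by (simp add: mult_ac)
      then have "pos_sq (V x - ln (m + w x)) \<le> 0" 
        using mult_pos_pos[OF pos, of "pos_sq (V x - ln (m + w x))"] by linarith
      then have "pos_sq (V x - ln (m + w x)) = 0" using pos_sq_nonneg by (simp add: antisym)
      then show "V x \<le> ln (m + w x)" by (simp add: pos_sq_eq_0_iff)
    qed
  qed
qed

end

subsection \<open>The explicit subsolutions\<close>

lemma DERIV_max_powr:
  assumes q: "1 < (q::real)"
  shows "((\<lambda>s. max 0 s powr q) has_real_derivative q * max 0 s powr (q - 1)) (at s)"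
proof -
  consider "s < 0" | "s = 0" | "0 < s" by linarith
  then show ?thesis
  proof cases
    case 1
    have "((\<lambda>_. 0) has_real_derivative q * max 0 s powr (q - 1)) (at s)" using 1 by simp
    then show ?thesis
      by (rule has_field_derivative_transform_within_open[where S = "{..<0}"]) (use 1 in auto)
  next
    case 2
    have "((\<lambda>h. (max 0 (0 + h) powr q - max 0 0 powr q) / h) \<longlongrightarrow> 0) (at 0)"
    proof (rule Lim_null_comparison)
      show "\<forall>\<^sub>F h in at 0. norm ((max 0 (0 + h) powr q - max 0 0 powr q) / h) \<le> \<bar>h\<bar> powr (q - 1)"
      proof (rule eventually_at_filter[THEN iffD2], rule always_eventually, intro allI impI)
        fix h :: real assume "h \<noteq> 0"
        then show "norm ((max 0 (0 + h) powr q - max 0 0 powr q) / h) \<le> \<bar>h\<bar> powr (q - 1)"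
        proof (cases "0 < h")
          case True
          then show ?thesis by (simp add: powr_diff)
        next
          case False
          then show ?thesis by (simp add: max_absorb1)
        qed
      qed
      have "((\<lambda>h. \<bar>h\<bar> powr (q - 1)) \<longlongrightarrow> \<bar>0\<bar> powr (q - 1)) (at (0::real))"
        using q by (intro tendsto_powr' tendsto_intros) auto
      then show "((\<lambda>h. \<bar>h\<bar> powr (q - 1)) \<longlongrightarrow> 0) (at (0::real))" using q by simp
    qed
    then show ?thesis using 2 by (simp add: DERIV_def)
  next
    case 3
    have "((\<lambda>s. s powr q) has_real_derivative q * max 0 s powr (q - 1)) (at s)"
      using 3 by (auto intro!: derivative_eq_intros)
    then show ?thesis
      by (rule has_field_derivative_transform_within_open[where S = "{0<..}"]) (use 3 in auto)
  qed
qed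

text \<open>The odd power |s|^(r - 1) s. For r = 1 / (p - 1) it inverts the scalar flux |s|^(p - 2)
  s. Written with positive parts, it comes out directly as the derivative of |s|^(r + 1) / (r +
  1).\<close>

definition signed_powr :: "real \<Rightarrow> real \<Rightarrow> real"
  where "signed_powr r s = max 0 s powr r - max 0 (- s) powr r"

lemma abs_signed_powr: "\<bar>signed_powr r s\<bar> = \<bar>s\<bar> powr r"
  by (cases "0 \<le> s") (auto simp: signed_powr_def max_def)

lemma signed_powr_mult: "0 < s \<Longrightarrow> signed_powr r s = s powr r" "s < 0 \<Longrightarrow> signed_powr r s = - ((- s) powr r)"
  "signed_powr r 0 = 0"
  by (auto simp: signed_powr_def max_def)

lemma DERIV_abs_powr:
  assumes q: "1 < (q::real)"
  shows "((\<lambda>s. \<bar>s\<bar> powr q) has_real_derivative q * signed_powr (q - 1) s) (at s)"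
proof -
  have eq: "(\<lambda>s::real. \<bar>s\<bar> powr q) = (\<lambda>s. max 0 s powr q + max 0 (- s) powr q)"
  proof
    fix s :: real
    show "\<bar>s\<bar> powr q = max 0 s powr q + max 0 (- s) powr q" by (cases "0 \<le> s") (auto simp: max_def)
  qed
  have "((\<lambda>s. max 0 (- s) powr q) has_real_derivative - (q * max 0 (- s) powr (q - 1))) (at s)"
    using DERIV_chain'[OF DERIV_minus[OF DERIV_ident] DERIV_max_powr[OF q, of "- s"]] by simp
  from DERIV_add[OF DERIV_max_powr[OF q, of s] this] show ?thesis
    unfolding eq by (simp add: signed_powr_def right_diff_distrib)
qed

lemma continuous_on_signed_powr:
  assumes "0 < r" "continuous_on S f"
  shows "continuous_on S (\<lambda>x. signed_powr r (f x))"
  unfolding signed_powr_def using assms by (intro continuous_intros continuous_on_powr') auto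

lemma has_derivative_ln_norm:
  assumes "x \<noteq> (0 :: 'a::euclidean_space)" "0 < d"
  shows "((\<lambda>x. ln (norm x / d)) has_derivative (\<lambda>h. (x /\<^sub>R (norm x)\<^sup>2) \<bullet> h)) (at x)"
proof -
  have n: "(norm has_derivative (\<lambda>h. sgn x \<bullet> h)) (at x)"
    using has_derivative_norm[OF assms(1)] by (simp add: inner_commute)
  have "((\<lambda>x. ln (norm x / d)) has_derivative (\<lambda>h. (sgn x \<bullet> h) / d * inverse (norm x / d))) (at x)"
    unfolding divide_inverse
    by (rule has_derivative_ln[OF _ has_derivative_mult_left[OF n]]) (use assms in auto)
  then show ?thesis
    by (rule has_derivative_eq_rhs)
      (use assms in \<open>simp add: fun_eq_iff sgn_div_norm power2_eq_square divide_inverse\<close>)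
qed

context positive_supersolution
begin

text \<open>In t = ln (|x| / d) the prescribed flux means that V has derivative -
  \<open>signed_powr (q - 1) G\<close>, and |G|^q / (q \<delta>) is the primitive of that signed
  power. The factor l < 1 pushes V below ln m already before |x| reaches d, so the comparison takes
  place strictly inside the ball.\<close>

lemma radial_lower_bound_strict:
  fixes \<gamma> l \<delta> :: real
  defines "N \<equiv> real DIM('a)"
  assumes d: "0 < d" and \<gamma>: "0 < \<gamma>" "p * \<gamma> \<le> N - p" and l: "0 < l" "l < 1" and \<delta>: "0 < \<delta>"
    and strict: "\<gamma> powr (p - 1) * (N - p - (p - 1) * \<gamma>) + \<delta> < \<mu>"
  shows "AE x in lborel. l * m * exp (- (\<bar>\<gamma> powr (p - 1) + \<delta> * ln (norm x / d)\<bar> powr (p / (p - 1)) - \<gamma> powr p)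
    / (p / (p - 1) * \<delta>)) \<le> m + w x"
proof -
  define K where "K = \<gamma> powr (p - 1)"
  define q where "q = p / (p - 1)"
  define G where "G x = K + \<delta> * ln (norm x / d)" for x :: 'a
  define V where "V x = ln (l * m) - (\<bar>G x\<bar> powr q - K powr q) / (q * \<delta>)" for x :: 'a
  define b where "b x = - (signed_powr (q - 1) (G x) / (norm x)\<^sup>2) *\<^sub>R x" for x :: 'a
  define k where "k x = G x * norm x powr (- p)" for x :: 'a
  define \<kappa> where "\<kappa> x = (norm x powr (- p) / (norm x)\<^sup>2 * (\<delta> - p * G x)) *\<^sub>R x" for x :: 'a
  \<comment> \<open>The first term is the Hardy constant for which |x|^(-\<gamma>) is a solution;
    the second is the derivative of G in t.\<close>
  define \<mu>' where "\<mu>' = K * (N - p - (p - 1) * \<gamma>) + \<delta>"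
  \<comment> \<open>r0 = d l^(1/\<gamma>). The tangent line bound gives V \<le> ln (l m) - \<gamma>
    t, which is at most ln m once \<gamma> t \<ge> ln l.\<close>
  define r0 where "r0 = d * exp (ln l / \<gamma>)"
  \<comment> \<open>At this radius G = - K, so |G| is back at its value for |x| = d; further inwards
    it only grows.\<close>
  define r1 where "r1 = d * exp (- (2 * K / \<delta>))"
  have K: "0 < K" using \<gamma> by (simp add: K_def)
  have q: "1 < q" "q - 1 = 1 / (p - 1)" "(p - 1) * q = p" using p by (auto simp: q_def field_simps)
  have q0: "q \<noteq> 0" using p by (simp add: q_def)
  have Kq: "K powr q = \<gamma> powr p" "K powr (q - 1) = \<gamma>" "K powr q = K * \<gamma>"
  proof -
    show "K powr q = \<gamma> powr p" using \<gamma> q(3) by (simp add: K_def powr_powr)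
    show "K powr (q - 1) = \<gamma>" unfolding q(2) using \<gamma> p by (simp add: K_def powr_powr)
    then show "K powr q = K * \<gamma>" using K by (simp add: powr_diff field_simps)
  qed
  \<comment> \<open>The tangent line of the convex function |s|^q at s = K, where the slope is q
    K^(q - 1) = q \<gamma>.\<close>
  have tangent: "K powr q + q * \<gamma> * (s - K) \<le> \<bar>s\<bar> powr q" for s
  proof -
    have "q * K powr (q - 1) * \<bar>s\<bar> \<le> (q - 1) * K powr q + \<bar>s\<bar> powr q"
      using K by (intro Young_powr q) auto
    moreover have "q * \<gamma> * s \<le> q * \<gamma> * \<bar>s\<bar>" using q \<gamma> by (intro mult_left_mono) auto
    ultimately show ?thesis unfolding Kq(2,3) by (simp add: algebra_simps)
  qed
  have DG: "(G has_derivative (\<lambda>h. \<delta> * ((x /\<^sub>R (norm x)\<^sup>2) \<bullet> h))) (at x)" if "x \<noteq> 0" for x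
    unfolding G_def[abs_def]
    using has_derivative_add[OF has_derivative_const has_derivative_mult_right[OF has_derivative_ln_norm[OF that d]]]
    by simp
  have cG: "continuous_on (- {0}) G"
    using DG by (auto intro!: continuous_at_imp_continuous_on has_derivative_continuous)
  have DV: "(V has_derivative (\<lambda>h. b x \<bullet> h)) (at x)" if x: "x \<noteq> 0" for x
  proof -
    have "((\<lambda>x. \<bar>G x\<bar> powr q) has_derivative
        (\<lambda>h. q * signed_powr (q - 1) (G x) * (\<delta> * ((x /\<^sub>R (norm x)\<^sup>2) \<bullet> h)))) (at x)"
      using has_derivative_compose[OF DG[OF x] DERIV_abs_powr[OF q(1), of "G x", unfolded has_field_derivative_def]]
      by simp
    from has_derivative_diff[OF has_derivative_const[of "ln (l * m)"]
        has_derivative_mult_left[OF has_derivative_diff[OF this has_derivative_const[of "K powr q"]], of "inverse (q * \<delta>)"]]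
    have "(V has_derivative (\<lambda>h. 0 - (q * signed_powr (q - 1) (G x) * (\<delta> * ((x /\<^sub>R (norm x)\<^sup>2) \<bullet> h)) - 0) * inverse (q * \<delta>))) (at x)"
      unfolding V_def[abs_def] divide_inverse .
    then show ?thesis
      by (rule has_derivative_eq_rhs) (use q0 \<delta> in \<open>simp add: fun_eq_iff b_def field_simps\<close>)
  qed
  have cb: "continuous_on (- {0}) b"
    unfolding b_def using q(2) p cG by (intro continuous_intros continuous_on_signed_powr) auto
  have Dnp: "((\<lambda>x. norm x powr (- p)) has_derivative (\<lambda>h. - p * norm x powr (- p) / (norm x)\<^sup>2 * (x \<bullet> h))) (at x)"
    if x: "x \<noteq> 0" for x :: 'a
  proof -
    have n: "(norm has_derivative (\<lambda>h. sgn x \<bullet> h)) (at x)"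
      using has_derivative_norm[OF x] by (simp add: inner_commute)
    have "((\<lambda>s. s powr (- p)) has_real_derivative (- p) * norm x powr (- p - 1)) (at (norm x))"
      using x has_real_derivative_powr[of "norm x" "- p"] by simp
    from has_derivative_compose[OF n this[unfolded has_field_derivative_def]] show ?thesis
      by (rule has_derivative_eq_rhs)
        (use x in \<open>simp add: fun_eq_iff sgn_div_norm powr_diff power2_eq_square divide_inverse\<close>)
  qed
  have Dk: "(k has_derivative (\<lambda>h. \<kappa> x \<bullet> h)) (at x)" if x: "x \<noteq> 0" for x
    unfolding k_def[abs_def]
    by (rule has_derivative_eq_rhs[OF has_derivative_mult[OF DG[OF x] Dnp[OF x]]])
      (simp add: fun_eq_iff \<kappa>_def divide_inverse algebra_simps)
  have ck: "continuous_on (- {0}) \<kappa>"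
    unfolding \<kappa>_def using cG by (intro continuous_intros) auto
  have nb: "norm (b x) = \<bar>G x\<bar> powr (q - 1) / norm x" if "x \<noteq> 0" for x
    unfolding b_def using that by (simp add: abs_signed_powr power2_eq_square)
  have flux: "norm (b x) powr (p - 2) *\<^sub>R b x = - k x *\<^sub>R x" if x: "x \<noteq> 0" for x
  proof -
    have "norm (b x) powr (p - 2) * (signed_powr (q - 1) (G x) / (norm x)\<^sup>2) = G x * norm x powr (- p)"
    proof (cases "G x = 0")
      case False
      have "norm (b x) powr (p - 2) = \<bar>G x\<bar> powr ((q - 1) * (p - 2)) / norm x powr (p - 2)"
        unfolding nb[OF x] by (simp add: powr_divide powr_powr)
      moreover have "\<bar>G x\<bar> powr ((q - 1) * (p - 2)) * signed_powr (q - 1) (G x) = G x"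
      proof -
        \<comment> \<open>Equivalently (q - 1) (p - 1) = 1: the flux map undoes the signed power q -
          1.\<close>
        have e: "(q - 1) * (p - 2) + (q - 1) = 1" using p unfolding q(2) by (simp add: field_simps)
        have "\<bar>G x\<bar> powr ((q - 1) * (p - 2)) * \<bar>G x\<bar> powr (q - 1) = \<bar>G x\<bar>"
          using False by (simp add: e flip: powr_add)
        then show ?thesis using False by (cases "0 < G x") (auto simp: signed_powr_mult)
      qed
      moreover have "norm x powr (p - 2) * (norm x)\<^sup>2 = norm x powr p"
        using x by (simp add: powr_diff powr_numeral)
      ultimately show ?thesis by (simp add: times_divide_times_eq powr_minus_divide)
    qed (simp add: signed_powr_mult)
    then show ?thesis unfolding b_def k_def by (simp add: mult.assoc)
  qed
  have sub: "x \<bullet> \<kappa> x + real DIM('a) * k x - (p - 1) * norm (b x) powr p \<le> \<mu>' / norm x powr p"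
    if x: "r1 \<le> norm x" "norm x \<le> r0" for x
  proof -
    have r1: "0 < r1" using d by (simp add: r1_def)
    then have x0: "x \<noteq> 0" using x by auto
    have "ln l / \<gamma> \<le> 0" using l \<gamma> by (simp add: divide_le_0_iff)
    then have "r0 \<le> d" using d by (simp add: r0_def)
    then have "norm x \<le> d" using x by simp
    then have "ln (norm x / d) \<le> 0" using x0 d by simp
    then have GK: "G x \<le> K" using \<delta> by (simp add: G_def mult_le_0_iff)
    have "x \<bullet> \<kappa> x = norm x powr (- p) * (\<delta> - p * G x)"
      using x0 by (simp add: \<kappa>_def dot_square_norm)
    moreover have "norm (b x) powr p = norm x powr (- p) * \<bar>G x\<bar> powr q"
    proof -
      have e: "(q - 1) * p = q" using p unfolding q(2) by (simp add: q_def)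
      show ?thesis unfolding nb[OF x0] by (simp add: powr_divide powr_powr e powr_minus_divide)
    qed
    ultimately have "x \<bullet> \<kappa> x + real DIM('a) * k x - (p - 1) * norm (b x) powr p
      = norm x powr (- p) * (\<delta> + (N - p) * G x - (p - 1) * \<bar>G x\<bar> powr q)"
      by (simp add: k_def N_def algebra_simps)
    \<comment> \<open>The concave function (N - p) G - (p - 1) |G|^q has slope N - p - p \<gamma>
      \<ge> 0 at K, so among G \<le> K it is largest at K. This is where \<gamma> \<le> (N - p) / p
      enters.\<close>
    also have "\<dots> \<le> norm x powr (- p) * \<mu>'"
    proof (rule mult_left_mono)
      have "(p - 1) * (K powr q + q * \<gamma> * (G x - K)) \<le> (p - 1) * \<bar>G x\<bar> powr q"
        using p by (intro mult_left_mono tangent) auto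
      moreover have "(p - 1) * (q * \<gamma> * (G x - K)) = p * \<gamma> * (G x - K)"
        using q(3) by (metis mult.assoc)
      moreover have "(N - p - p * \<gamma>) * (G x - K) \<le> 0"
        using GK \<gamma> by (intro mult_nonneg_nonpos) auto
      ultimately show "\<delta> + (N - p) * G x - (p - 1) * \<bar>G x\<bar> powr q \<le> \<mu>'"
        unfolding \<mu>'_def Kq(3) by (simp add: algebra_simps)
    qed simp
    finally show ?thesis by (simp add: powr_minus divide_inverse mult.commute)
  qed
  have Vle: "V x \<le> ln m" if x: "norm x < r1 \<or> r0 < norm x" for x
  proof -
    have lm: "ln (l * m) = ln l + ln m" using l m by (simp add: ln_mult)
    have ll: "ln l < 0" using l by simp
    have qd: "0 < q * \<delta>" using q \<delta> by simp
    consider "x = 0" | "x \<noteq> 0" "norm x < r1" | "x \<noteq> 0" "r0 < norm x" using x by blast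
    then show ?thesis
    proof cases
      \<comment> \<open>The convention ln 0 = 0 yields G 0 = K, hence V 0 = ln (l m).\<close>
      case 1
      then show ?thesis using ll K lm by (simp add: V_def G_def)
    next
      case 2
      have "norm x / d < exp (- (2 * K / \<delta>))" using 2 d by (simp add: r1_def field_simps)
      then have "ln (norm x / d) < ln (exp (- (2 * K / \<delta>)))" using 2 d by (subst ln_less_cancel_iff) auto
      then have "ln (norm x / d) < - (2 * K / \<delta>)" by simp
      then have "\<delta> * ln (norm x / d) < - (2 * K)" using \<delta> by (simp add: field_simps)
      then have "K \<le> \<bar>G x\<bar>" by (simp add: G_def)
      then have "K powr q \<le> \<bar>G x\<bar> powr q" using K q by (intro powr_mono2) auto
      then have "0 \<le> (\<bar>G x\<bar> powr q - K powr q) / (q * \<delta>)" using qd by simp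
      then show ?thesis using ll lm by (simp add: V_def)
    next
      case 3
      have "exp (ln l / \<gamma>) < norm x / d" using 3 d by (simp add: r0_def field_simps)
      then have "ln (exp (ln l / \<gamma>)) < ln (norm x / d)" using 3 d by (subst ln_less_cancel_iff) auto
      then have "ln l / \<gamma> < ln (norm x / d)" by simp
      then have *: "ln l < \<gamma> * ln (norm x / d)" using \<gamma> by (simp add: field_simps)
      have "q * \<gamma> * (\<delta> * ln (norm x / d)) \<le> \<bar>G x\<bar> powr q - K powr q"
        using tangent[of "G x"] by (simp add: G_def)
      then have "\<gamma> * ln (norm x / d) \<le> (\<bar>G x\<bar> powr q - K powr q) / (q * \<delta>)"
        using qd by (simp add: pos_le_divide_eq mult_ac)
      then show ?thesis using * lm by (simp add: V_def)
    qed
  qed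
  have "supersolution_comparison p \<mu> d m w g \<mu>' r1 r0 V k b \<kappa>"
  proof unfold_locales
    show "\<mu>' < \<mu>" using strict by (simp add: \<mu>'_def K_def)
    show "0 < r1" using d by (simp add: r1_def)
    show "r0 < d" using d l \<gamma> by (simp add: r0_def divide_neg_pos)
  qed (use DV cb Dk ck flux sub Vle in auto)
  then interpret C: supersolution_comparison p \<mu> d m w g \<mu>' r1 r0 V k b \<kappa> .
  show ?thesis
    using C.comparison
  proof eventually_elim
    case (elim x)
    have w': "0 < m + w x" "m \<le> m + w x" using m w(2)[of x] by auto
    have "V x \<le> ln (m + w x)"
      using elim C.V_le_off_annulus[of x] ln_mono[OF w'(2) m] by fastforce
    then have "exp (V x) \<le> m + w x" using w'(1) by (simp add: ln_ge_iff)
    moreover have "exp (V x) = l * m * exp (- (\<bar>G x\<bar> powr q - K powr q) / (q * \<delta>))"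
    proof -
      have "V x = ln (l * m) + - (\<bar>G x\<bar> powr q - K powr q) / (q * \<delta>)"
        unfolding V_def minus_divide_left[symmetric] by simp
      then show ?thesis using l m by (simp only: exp_add) simp
    qed
    ultimately show ?case by (simp add: G_def K_def q_def flip: Kq(1))
  qed
qed

text \<open>As \<delta> tends to 0, the exponent becomes a multiple of the difference quotient of s
  \<mapsto> |K + s t|^q at 0, whose limit is q \<gamma> t; this produces exp (- \<gamma> t). Working
  with a sequence keeps the union of the exceptional sets null.\<close>

lemma radial_lower_bound:
  fixes \<gamma> l :: real
  defines "N \<equiv> real DIM('a)"
  assumes d: "0 < d" and \<gamma>: "0 < \<gamma>" "p * \<gamma> \<le> N - p" and l: "0 < l" "l < 1"
    and strict: "\<gamma> powr (p - 1) * (N - p - (p - 1) * \<gamma>) < \<mu>"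
  shows "AE x in lborel. x \<noteq> 0 \<longrightarrow> l * m * (norm x / d) powr (- \<gamma>) \<le> m + w x"
proof -
  define K where "K = \<gamma> powr (p - 1)"
  define q where "q = p / (p - 1)"
  define e where "e = \<mu> - \<gamma> powr (p - 1) * (N - p - (p - 1) * \<gamma>)"
  have e: "0 < e" using strict by (simp add: e_def)
  \<comment> \<open>The denominator n + 2 makes \<open>\<delta> n\<close> strictly smaller than e,
    also for n = 0.\<close>
  define \<delta> where "\<delta> n = e / real (n + 2)" for n
  have \<delta>: "0 < \<delta> n" "\<delta> n < e" for n using e by (auto simp: \<delta>_def field_simps intro: add_pos_nonneg)
  have q: "1 < q" using p by (simp add: q_def)
  have K: "0 < K" "K powr q = \<gamma> powr p" "signed_powr (q - 1) K = \<gamma>"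
  proof -
    show K0: "0 < K" using \<gamma> by (simp add: K_def)
    have "(p - 1) * q = p" "(p - 1) * (q - 1) = 1" using p by (auto simp: q_def field_simps)
    then show "K powr q = \<gamma> powr p" "signed_powr (q - 1) K = \<gamma>"
      using \<gamma> K0 by (simp_all add: signed_powr_mult) (simp_all add: K_def powr_powr)
  qed
  have \<delta>lim: "filterlim \<delta> (at 0) sequentially"
    unfolding filterlim_at
  proof (intro conjI always_eventually allI)
    have "(\<lambda>n. e * inverse (real (n + 2))) \<longlonglongrightarrow> e * 0"
      by (intro tendsto_intros LIMSEQ_ignore_initial_segment[OF lim_inverse_n])
    then show "\<delta> \<longlonglongrightarrow> 0" by (simp add: \<delta>_def[abs_def] divide_inverse)
    show "\<delta> n \<in> UNIV" "\<delta> n \<noteq> 0" for n using \<delta>(1)[of n] by auto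
  qed
  have "AE x in lborel. \<forall>n. l * m * exp (- (\<bar>\<gamma> powr (p - 1) + \<delta> n * ln (norm x / d)\<bar> powr (p / (p - 1)) - \<gamma> powr p)
    / (p / (p - 1) * \<delta> n)) \<le> m + w x"
    unfolding AE_all_countable
  proof
    fix n
    have "\<gamma> powr (p - 1) * (N - p - (p - 1) * \<gamma>) + \<delta> n < \<mu>" using \<delta>(2)[of n] by (simp add: e_def)
    from radial_lower_bound_strict[OF d \<gamma>(1) \<gamma>(2)[unfolded N_def] l \<delta>(1) this[unfolded N_def]]
    show "AE x in lborel. l * m * exp (- (\<bar>\<gamma> powr (p - 1) + \<delta> n * ln (norm x / d)\<bar> powr (p / (p - 1)) - \<gamma> powr p)
      / (p / (p - 1) * \<delta> n)) \<le> m + w x" .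
  qed
  then show ?thesis
  proof eventually_elim
    case (elim x)
    show ?case
    proof
      assume x: "x \<noteq> 0"
      define t where "t = ln (norm x / d)"
      have lin: "((\<lambda>s. K + s * t) has_real_derivative t) (at 0)"
        by (auto intro!: derivative_eq_intros)
      have "((\<lambda>s. \<bar>K + s * t\<bar> powr q) has_real_derivative q * signed_powr (q - 1) (K + 0 * t) * t) (at 0)"
        by (rule DERIV_chain2[OF DERIV_abs_powr[OF q] lin])
      then have "((\<lambda>s. (\<bar>K + s * t\<bar> powr q - K powr q) / s) \<longlongrightarrow> q * \<gamma> * t) (at 0)"
        using K by (simp add: DERIV_def)
      from filterlim_compose[OF this \<delta>lim]
      have "(\<lambda>n. (\<bar>K + \<delta> n * t\<bar> powr q - K powr q) / \<delta> n) \<longlonglongrightarrow> q * \<gamma> * t" .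
      then have "(\<lambda>n. l * m * exp (- (((\<bar>K + \<delta> n * t\<bar> powr q - K powr q) / \<delta> n) / q))) \<longlonglongrightarrow>
        l * m * exp (- (q * \<gamma> * t / q))"
        by (intro tendsto_intros) (use q in auto)
      then have "l * m * exp (- (q * \<gamma> * t / q)) \<le> m + w x"
      proof (rule LIMSEQ_le_const2, intro exI[of _ 0] allI impI)
        fix n
        have "- (((\<bar>K + \<delta> n * t\<bar> powr q - K powr q) / \<delta> n) / q) = - (\<bar>K + \<delta> n * t\<bar> powr q - K powr q) / (q * \<delta> n)"
          by (simp only: divide_divide_eq_left minus_divide_left mult.commute[of q])
        then show "l * m * exp (- (((\<bar>K + \<delta> n * t\<bar> powr q - K powr q) / \<delta> n) / q)) \<le> m + w x"
          using elim[rule_format, of n] unfolding K(2) by (simp add: K_def q_def t_def)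
      qed
      moreover have "exp (- (q * \<gamma> * t / q)) = (norm x / d) powr (- \<gamma>)"
        using q x d by (simp add: powr_def t_def)
      ultimately show "l * m * (norm x / d) powr (- \<gamma>) \<le> m + w x" by simp
    qed
  qed
qed

text \<open>At the root itself the strict inequality of \<open>radial_lower_bound\<close> fails, so
  the exponent is approached from below. The same \<open>l n\<close> multiplies both m and \<gamma>,
  so that one sequence settles both limits.\<close>

theorem radial_lower_bound_limit:
  fixes \<gamma> :: real
  defines "N \<equiv> real DIM('a)"
  assumes d: "0 < d" and \<gamma>: "0 < \<gamma>" "p * \<gamma> \<le> N - p"
    and strict: "\<And>\<eta>. 0 < \<eta> \<Longrightarrow> \<eta> < \<gamma> \<Longrightarrow> \<eta> powr (p - 1) * (N - p - (p - 1) * \<eta>) < \<mu>"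
  shows "AE x in lborel. x \<noteq> 0 \<longrightarrow> m * (norm x / d) powr (- \<gamma>) \<le> m + w x"
proof -
  define l where "l n = 1 - inverse (real (n + 2))" for n
  have l: "0 < l n" "l n < 1" for n by (auto simp: l_def field_simps)
  have llim: "l \<longlonglongrightarrow> 1 - 0"
    unfolding l_def[abs_def] by (intro tendsto_intros LIMSEQ_ignore_initial_segment[OF lim_inverse_n])
  have "AE x in lborel. \<forall>n. x \<noteq> 0 \<longrightarrow> l n * m * (norm x / d) powr (- (l n * \<gamma>)) \<le> m + w x"
    unfolding AE_all_countable
  proof
    fix n
    have lg: "0 < l n * \<gamma>" "l n * \<gamma> < \<gamma>" using l[of n] \<gamma>(1) by auto
    have "p * (l n * \<gamma>) \<le> p * \<gamma>" using lg(2) p by (intro mult_left_mono) auto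
    then have "p * (l n * \<gamma>) \<le> real DIM('a) - p" using \<gamma>(2) by (simp add: N_def)
    from radial_lower_bound[OF d lg(1) this l strict[OF lg, unfolded N_def]]
    show "AE x in lborel. x \<noteq> 0 \<longrightarrow> l n * m * (norm x / d) powr (- (l n * \<gamma>)) \<le> m + w x" .
  qed
  then show ?thesis
  proof eventually_elim
    case (elim x)
    show ?case
    proof
      assume x: "x \<noteq> 0"
      have "(\<lambda>n. l n * m * (norm x / d) powr (- (l n * \<gamma>))) \<longlonglongrightarrow> (1 - 0) * m * (norm x / d) powr (- ((1 - 0) * \<gamma>))"
        using x d by (intro tendsto_intros llim) auto
      then have "(1 - 0) * m * (norm x / d) powr (- ((1 - 0) * \<gamma>)) \<le> m + w x"
        by (rule LIMSEQ_le_const2) (use elim x in auto)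
      then show "m * (norm x / d) powr (- \<gamma>) \<le> m + w x" by simp
    qed
  qed
qed

end

section \<open>The smaller root of the exponent equation\<close>

text \<open>With a = (N - p) / p and c = (N - p) / (p - 1) one has F 0 = \<mu>, F a = \<mu> - a^p <
  0 and F c = \<mu>, so there is a root on either side of a and the left one must be
  \<open>\<gamma>\<^sub>1\<close>. If F were not positive at some \<eta> in between 0 and
  \<open>\<gamma>\<^sub>1\<close>, a third root would arise.\<close>

lemma smaller_root:
  fixes p N \<mu> \<gamma>\<^sub>1 \<gamma>\<^sub>2 :: real
  assumes p: "1 < p" "p < N" and \<mu>: "0 \<le> \<mu>" "\<mu> < ((N - p) / p) powr p" and lt: "\<gamma>\<^sub>1 < \<gamma>\<^sub>2"
    and roots: "{\<gamma>. 0 \<le> \<gamma> \<and> (p - 1) * \<gamma> powr p - (N - p) * \<gamma> powr (p - 1) + \<mu> = 0} = {\<gamma>\<^sub>1, \<gamma>\<^sub>2}"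
  shows "0 \<le> \<gamma>\<^sub>1" "p * \<gamma>\<^sub>1 \<le> N - p"
    "\<And>\<eta>. 0 < \<eta> \<Longrightarrow> \<eta> < \<gamma>\<^sub>1 \<Longrightarrow> \<eta> powr (p - 1) * (N - p - (p - 1) * \<eta>) < \<mu>"
proof -
  define F where "F \<gamma> = (p - 1) * \<gamma> powr p - (N - p) * \<gamma> powr (p - 1) + \<mu>" for \<gamma>
  have root: "0 \<le> z \<and> F z = 0 \<longleftrightarrow> z = \<gamma>\<^sub>1 \<or> z = \<gamma>\<^sub>2" for z
    using roots unfolding F_def by blast
  show g0: "0 \<le> \<gamma>\<^sub>1" using root by blast
  have cont: "continuous_on {0..} F"
    unfolding F_def using p by (intro continuous_intros continuous_on_powr') auto
  have F0: "F 0 = \<mu>" by (simp add: F_def)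
  define a where "a = (N - p) / p"
  have a: "0 < a" using p by (simp add: a_def)
  have Fq: "F s = \<mu> - s powr (p - 1) * (N - p - (p - 1) * s)" if "0 \<le> s" for s
    unfolding F_def using powr_minus_one_mult[OF that, of p] by (simp add: algebra_simps flip: mult.assoc)
  have "a powr (p - 1) * (N - p - (p - 1) * a) = a powr (p - 1) * a"
    using p by (simp add: a_def field_simps)
  then have Fa: "F a < 0"
    using Fq[of a] a \<mu>(2) powr_minus_one_mult[of a p] by (simp add: a_def)
  define c where "c = (N - p) / (p - 1)"
  have ac: "a < c" using p by (simp add: a_def c_def divide_strict_left_mono)
  have Fc: "0 \<le> F c" using Fq[of c] ac a \<mu>(1) p by (simp add: c_def)
  have "\<exists>z\<ge>0. z \<le> a \<and> F z = 0"
    using F0 Fa \<mu>(1) a by (intro IVT2') (auto intro: continuous_on_subset[OF cont])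
  then obtain z1 where z1: "0 \<le> z1" "z1 \<le> a" "F z1 = 0" by blast
  have "\<exists>z\<ge>a. z \<le> c \<and> F z = 0"
    using Fc Fa a ac by (intro IVT') (auto intro: continuous_on_subset[OF cont])
  then obtain z2 where z2: "a \<le> z2" "z2 \<le> c" "F z2 = 0" by blast
  have "z1 \<noteq> a" "z2 \<noteq> a" using z1 z2 Fa by auto
  then have "z1 < z2" using z1 z2 by simp
  then have "z1 = \<gamma>\<^sub>1" using root[of z1] root[of z2] z1 z2 a lt by auto
  then show "p * \<gamma>\<^sub>1 \<le> N - p" using z1(2) p by (simp add: a_def field_simps)
  fix \<eta> :: real assume \<eta>: "0 < \<eta>" "\<eta> < \<gamma>\<^sub>1"
  have "0 < F \<eta>"
  proof (rule ccontr)
    assume "\<not> 0 < F \<eta>"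
    then have "\<exists>z\<ge>0. z \<le> \<eta> \<and> F z = 0"
      using F0 \<mu>(1) \<eta> by (intro IVT2') (auto intro: continuous_on_subset[OF cont])
    then obtain z where "0 \<le> z" "z \<le> \<eta>" "F z = 0" by blast
    then show False using root[of z] \<eta> lt by auto
  qed
  then show "\<eta> powr (p - 1) * (N - p - (p - 1) * \<eta>) < \<mu>" using Fq[of \<eta>] \<eta>(1) by simp
qed

subsection \<open>Passing to Borel functions\<close>

lemma lebesgue_measurable_borel_representative:
  fixes f :: "'a::euclidean_space \<Rightarrow> 'b::euclidean_space"
  assumes f: "f \<in> borel_measurable lebesgue"
  shows "\<exists>g\<in>borel_measurable borel. AE x in lborel. f x = g x"
proof -
  have "\<forall>i. \<exists>g. g \<in> borel_measurable lborel \<and> (AE x in lborel. f x \<bullet> i = g x)"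
  proof
    fix i
    have "(\<lambda>x. f x \<bullet> i) \<in> borel_measurable lebesgue" by (rule borel_measurable_inner[OF f]) simp
    from completion_ex_borel_measurable_real[OF this]
    obtain h where "h \<in> borel_measurable lborel" "AE x in lborel. f x \<bullet> i = h x" by (rule bexE)
    then show "\<exists>g. g \<in> borel_measurable lborel \<and> (AE x in lborel. f x \<bullet> i = g x)"
      by (intro exI conjI)
  qed
  from choice[OF this] obtain g where
    "\<forall>i. g i \<in> borel_measurable lborel \<and> (AE x in lborel. f x \<bullet> i = g i x)" by (rule exE)
  note g = conjunct1[OF this[rule_format]] conjunct2[OF this[rule_format]]
  have "AE x in lborel. \<forall>i\<in>Basis. f x \<bullet> i = g i x"
    by (intro AE_finite_allI finite_Basis g(2))
  then have "AE x in lborel. f x = (\<Sum>i\<in>Basis. g i x *\<^sub>R i)"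
  proof eventually_elim
    case (elim x)
    have "f x = (\<Sum>i\<in>Basis. (f x \<bullet> i) *\<^sub>R i)" by (simp add: euclidean_representation)
    also have "\<dots> = (\<Sum>i\<in>Basis. g i x *\<^sub>R i)" using elim by (intro sum.cong) auto
    finally show ?case .
  qed
  moreover have "(\<lambda>x. \<Sum>i\<in>Basis. g i x *\<^sub>R i) \<in> borel_measurable borel"
    using g(1) by (intro borel_measurable_sum borel_measurable_scaleR borel_measurable_const) simp
  ultimately show ?thesis by (rule rev_bexI[rotated])
qed

text \<open>Transfers integrals over \<Omega> to Borel functions on the whole space, where the
  results on convolution apply. The indicator removes the arbitrary values outside \<Omega>.\<close>

lemma lebesgue_on_eq_lborel:
  fixes H H' :: "'a::euclidean_space \<Rightarrow> 'b::euclidean_space"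
  assumes \<Omega>: "\<Omega> \<in> sets lebesgue" and H: "H \<in> borel_measurable (lebesgue_on \<Omega>)"
    and H': "H' \<in> borel_measurable borel"
    and eq: "AE x in lborel. indicator \<Omega> x *\<^sub>R H x = H' x"
  shows "integral\<^sup>L (lebesgue_on \<Omega>) H = integral\<^sup>L lborel H'"
    "integrable (lebesgue_on \<Omega>) H \<longleftrightarrow> integrable lborel H'"
proof -
  have \<Omega>': "\<Omega> \<inter> space lebesgue \<in> sets lebesgue" using \<Omega> by simp
  have m: "(\<lambda>x. indicator \<Omega> x *\<^sub>R H x) \<in> borel_measurable lebesgue"
    using H borel_measurable_restrict_space_iff[OF \<Omega>', of H] by simp
  have m': "H' \<in> borel_measurable lebesgue" using H' by (simp add: measurable_completion)
  have ae: "AE x in lebesgue. indicator \<Omega> x *\<^sub>R H x = H' x" using eq by (rule AE_completion)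
  have "integral\<^sup>L (lebesgue_on \<Omega>) H = (\<integral>x. indicator \<Omega> x *\<^sub>R H x \<partial>lebesgue)"
    by (rule integral_restrict_space[OF \<Omega>'])
  also have "\<dots> = integral\<^sup>L lebesgue H'" by (rule integral_cong_AE[OF m m' ae])
  also have "\<dots> = integral\<^sup>L lborel H'" using H' by (intro integral_completion) simp
  finally show "integral\<^sup>L (lebesgue_on \<Omega>) H = integral\<^sup>L lborel H'" .
  have "integrable (lebesgue_on \<Omega>) H \<longleftrightarrow> integrable lebesgue (\<lambda>x. indicator \<Omega> x *\<^sub>R H x)"
    by (rule integrable_restrict_space[OF \<Omega>'])
  also have "\<dots> \<longleftrightarrow> integrable lebesgue H'" by (rule integrable_cong_AE[OF m m' ae])
  also have "\<dots> \<longleftrightarrow> integrable lborel H'" using H' by (intro integrable_completion) simp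
  finally show "integrable (lebesgue_on \<Omega>) H \<longleftrightarrow> integrable lborel H'" .
qed

lemma AE_lebesgue_on_iff:
  assumes "\<Omega> \<in> sets lebesgue"
  shows "(AE x in lebesgue_on \<Omega>. P x) \<longleftrightarrow> (AE x in lborel. x \<in> \<Omega> \<longrightarrow> P x)"
  using assms by (simp add: AE_restrict_space_iff AE_completion_iff)

lemma in_Lp_borel_representative:
  fixes f :: "'a::euclidean_space \<Rightarrow> 'b::euclidean_space"
  assumes \<Omega>: "\<Omega> \<in> sets lebesgue" and f: "in_Lp q \<Omega> f"
  obtains g where "g \<in> borel_measurable borel" "AE x in lborel. x \<in> \<Omega> \<longrightarrow> f x = g x"
    "integrable lborel (\<lambda>x. norm (g x) powr q)"
proof -
  have fm: "f \<in> borel_measurable (lebesgue_on \<Omega>)" and fi: "integrable (lebesgue_on \<Omega>) (\<lambda>x. norm (f x) powr q)"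
    using f by (auto simp: in_Lp_def)
  have \<Omega>': "\<Omega> \<inter> space lebesgue \<in> sets lebesgue" using \<Omega> by simp
  have "(\<lambda>x. indicator \<Omega> x *\<^sub>R f x) \<in> borel_measurable lebesgue"
    using fm borel_measurable_restrict_space_iff[OF \<Omega>', of f] by simp
  from lebesgue_measurable_borel_representative[OF this]
  obtain g where g: "g \<in> borel_measurable borel" "AE x in lborel. indicator \<Omega> x *\<^sub>R f x = g x" by blast
  have "AE x in lborel. indicator \<Omega> x *\<^sub>R (norm (f x) powr q) = norm (g x) powr q"
    using g(2)
  proof eventually_elim
    case (elim x)
    show ?case unfolding elim[symmetric] by (cases "x \<in> \<Omega>") auto
  qed
  then have "integrable lborel (\<lambda>x. norm (g x) powr q)"
    using lebesgue_on_eq_lborel(2)[OF \<Omega> borel_measurable_integrable[OF fi], of "\<lambda>x. norm (g x) powr q"] fi g(1)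
    by simp
  moreover have "AE x in lborel. x \<in> \<Omega> \<longrightarrow> f x = g x"
    using g(2) by eventually_elim auto
  ultimately show thesis by (intro that[OF g(1)])
qed

lemma C0_infinity_mono: "\<Omega> \<subseteq> \<Omega>' \<Longrightarrow> \<phi> \<in> C0_infinity \<Omega> \<Longrightarrow> \<phi> \<in> C0_infinity \<Omega>'"
  by (auto simp: C0_infinity_def)

text \<open>A supersolution is encoded through - u, so the chosen weak gradient is that of - u and g
  is its negative. Truncating a Borel version of u at m makes w nonnegative everywhere and alters it
  on the ball only in a null set.\<close>

lemma weak_supersolution_positive_supersolution:
  fixes p \<mu> m d :: real and \<Omega> :: "'a::euclidean_space set" and f u :: "'a \<Rightarrow> real"
  assumes p: "1 < p" "p < real DIM('a)" and \<Omega>: "open \<Omega>" "ball 0 d \<subseteq> \<Omega>"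
    and f: "AE x in lebesgue_on \<Omega>. 0 \<le> f x"
    and u: "u \<in> D1p p \<Omega>" and super: "weak_supersolution p \<mu> f \<Omega> u"
    and m: "0 < m" "AE x in lebesgue_on \<Omega>. m \<le> u x"
  obtains w g where "positive_supersolution p \<mu> d m w g"
    "AE x in lborel. x \<in> ball 0 d \<longrightarrow> u x = m + w x"
proof -
  define B where "B = (ball 0 d :: 'a set)"
  have B: "B \<subseteq> \<Omega>" "B \<in> sets borel" "emeasure lborel B < \<infinity>"
    using \<Omega> emeasure_bounded_finite[OF bounded_ball, of "0::'a" d] by (auto simp: B_def)
  have iB: "integrable lborel (indicator B :: 'a \<Rightarrow> real)" using B by simp
  have \<Omega>L: "\<Omega> \<in> sets lebesgue" using \<Omega>(1) by (simp add: borel_open)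
  \<comment> \<open>The critical Sobolev exponent. It is at least p, so on the ball both u and u^(p
    - 1) are bounded by 1 + u^s and are integrable.\<close>
  define s where "s = real DIM('a) * p / (real DIM('a) - p)"
  have s: "p \<le> s" using p by (simp add: s_def field_simps)
  define G where "G = weak_grad \<Omega> (\<lambda>x. - u x)"
  have D: "(\<lambda>x. - u x) \<in> D1p p \<Omega>" using super by (simp add: weak_supersolution_def weak_subsolution_def)
  then have "\<exists>G. has_weak_gradient \<Omega> (\<lambda>x. - u x) G" by (simp add: D1p_def weakly_differentiable_def)
  then have G: "has_weak_gradient \<Omega> (\<lambda>x. - u x) G" unfolding G_def weak_grad_def by (rule someI_ex)
  have GL: "in_Lp p \<Omega> G" using D by (simp add: D1p_def G_def)
  have uL: "in_Lp s \<Omega> u" using u by (simp add: D1p_def s_def)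
  have um: "u \<in> borel_measurable (lebesgue_on \<Omega>)" and Gm: "G \<in> borel_measurable (lebesgue_on \<Omega>)"
    using uL GL by (auto simp: in_Lp_def)
  obtain u0 where u0: "u0 \<in> borel_measurable borel" "AE x in lborel. x \<in> \<Omega> \<longrightarrow> u x = u0 x"
    "integrable lborel (\<lambda>x. norm (u0 x) powr s)"
    by (rule in_Lp_borel_representative[OF \<Omega>L uL])
  obtain G0 where G0: "G0 \<in> borel_measurable borel" "AE x in lborel. x \<in> \<Omega> \<longrightarrow> G x = G0 x"
    "integrable lborel (\<lambda>x. norm (G0 x) powr p)"
    by (rule in_Lp_borel_representative[OF \<Omega>L GL])
  have mu: "AE x in lborel. x \<in> \<Omega> \<longrightarrow> m \<le> u x" using m(2) by (simp only: AE_lebesgue_on_iff[OF \<Omega>L])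
  define w where "w x = indicator B x * max 0 (u0 x - m)" for x
  define g where "g x = - (indicator B x *\<^sub>R G0 x)" for x
  note [measurable] = u0(1) G0(1) B(2)
  have wm[measurable]: "w \<in> borel_measurable borel" and gm[measurable]: "g \<in> borel_measurable borel"
    unfolding w_def[abs_def] g_def[abs_def] by measurable
  have uw: "AE x in lborel. x \<in> B \<longrightarrow> u x = m + w x"
    using u0(2) mu by eventually_elim (use B(1) in \<open>auto simp: w_def\<close>)
  have Gg: "AE x in lborel. x \<in> B \<longrightarrow> G x = - g x"
    using G0(2) by eventually_elim (use B(1) in \<open>auto simp: g_def\<close>)
  have wi: "integrable lborel w"
  proof (rule Bochner_Integration.integrable_bound)
    show "integrable lborel (\<lambda>x. indicator B x + norm (u0 x) powr s)" using iB u0(3) by simp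
    show "AE x in lborel. norm (w x) \<le> norm (indicator B x + norm (u0 x) powr s)"
    proof (intro AE_I2)
      fix x
      have "\<bar>u0 x\<bar> \<le> 1 + \<bar>u0 x\<bar> powr s" using powr_le_one_plus_powr[of 1 s "\<bar>u0 x\<bar>"] s p by simp
      then show "norm (w x) \<le> norm (indicator B x + norm (u0 x) powr s)"
        using m(1) by (cases "x \<in> B") (auto simp: w_def)
    qed
  qed simp
  have gp: "integrable lborel (\<lambda>x. norm (g x) powr p)"
  proof (rule Bochner_Integration.integrable_bound[OF G0(3)])
    show "AE x in lborel. norm (norm (g x) powr p) \<le> norm (norm (G0 x) powr p)"
    proof (intro AE_I2)
      fix x show "norm (norm (g x) powr p) \<le> norm (norm (G0 x) powr p)"
        by (cases "x \<in> B") (auto simp: g_def)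
    qed
  qed simp
  have gi: "integrable lborel g"
  proof (rule Bochner_Integration.integrable_bound)
    show "integrable lborel (\<lambda>x. indicator B x + norm (g x) powr p)" using iB gp by simp
    show "AE x in lborel. norm (g x) \<le> norm (indicator B x + norm (g x) powr p)"
    proof (intro AE_I2)
      fix x
      show "norm (g x) \<le> norm (indicator B x + norm (g x) powr p)"
        using powr_le_one_plus_powr[of 1 p "norm (g x)"] p by (cases "x \<in> B") (auto simp: g_def)
    qed
  qed simp
  have power: "integrable lborel (\<lambda>x. indicator B x * (m + w x) powr (p - 1))"
  proof (rule Bochner_Integration.integrable_bound)
    show "integrable lborel (\<lambda>x. indicator B x + norm (u0 x) powr s)" using iB u0(3) by simp
    show "AE x in lborel. norm (indicator B x * (m + w x) powr (p - 1)) \<le> norm (indicator B x + norm (u0 x) powr s)"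
      using uw u0(2) mu
    proof eventually_elim
      case (elim x)
      show ?case
      proof (cases "x \<in> B")
        case True
        then have "m + w x = \<bar>u0 x\<bar>" using elim B(1) m(1) by auto
        then show ?thesis
          using True powr_le_one_plus_powr[of "p - 1" s "\<bar>u0 x\<bar>"] s p by simp
      qed simp
    qed
  qed simp
  have zero: "\<phi> x = 0" "partial_deriv i \<phi> x = 0" "grad \<phi> x = 0"
    if "\<phi> \<in> C0_infinity B" "x \<notin> B" for \<phi> x i
  proof -
    obtain K where K: "compact K" "K \<subseteq> B" "\<And>x. x \<notin> K \<Longrightarrow> \<phi> x = 0"
      using C0_infinity_support[OF \<open>\<phi> \<in> C0_infinity B\<close>] by blast
    have C: "C1_grad \<phi> (grad \<phi>)" by (rule C0_infinity_C1_grad) fact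
    have x: "x \<notin> K" using K(2) \<open>x \<notin> B\<close> by blast
    show "\<phi> x = 0" using K(3)[OF x] .
    show "grad \<phi> x = 0" by (rule C1_grad_eq_0_off_closed[OF C compact_imp_closed[OF K(1)] K(3) x])
    then show "partial_deriv i \<phi> x = 0" using C1_grad_partial_deriv[OF C, of i x] by simp
  qed
  have cont: "\<phi> \<in> borel_measurable borel" "grad \<phi> \<in> borel_measurable borel" "partial_deriv i \<phi> \<in> borel_measurable borel"
    if "\<phi> \<in> C0_infinity B" "i \<in> Basis" for \<phi> i
  proof -
    have C: "C1_grad \<phi> (grad \<phi>)" by (rule C0_infinity_C1_grad) fact
    show "\<phi> \<in> borel_measurable borel" "grad \<phi> \<in> borel_measurable borel"
      using C C1_grad_continuous[OF C] by (auto simp: C1_grad_def intro: borel_measurable_continuous_onI)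
    show "partial_deriv i \<phi> \<in> borel_measurable borel"
      using C0_infinity_continuous[OF partial_deriv_C0_infinity[OF that]] by (rule borel_measurable_continuous_onI)
  qed
  have lift: "h \<in> borel_measurable (lebesgue_on \<Omega>)" if "h \<in> borel_measurable borel"
    for h :: "'a \<Rightarrow> 'b::topological_space"
    using that by (intro measurable_restrict_space1 measurable_completion) simp
  have "positive_supersolution p \<mu> d m w g"
  proof
    show "1 < p" "0 < m" using p m by auto
    show "integrable lborel w" "integrable lborel g" "integrable lborel (\<lambda>x. norm (g x) powr p)"
      by (fact wi gi gp)+
    show "0 \<le> w x" for x by (simp add: w_def)
    show "g x = 0" if "x \<notin> ball 0 d" for x using that by (simp add: g_def B_def)
    show "integrable lborel (\<lambda>x. indicator (ball 0 d) x * (m + w x) powr (p - 1))"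
      using power by (simp add: B_def)
  next
    fix \<phi> :: "'a \<Rightarrow> real" and i :: 'a
    assume "\<phi> \<in> C0_infinity (ball 0 d)" and i: "i \<in> Basis"
    then have \<phi>: "\<phi> \<in> C0_infinity B" by (simp add: B_def)
    have \<phi>\<Omega>: "\<phi> \<in> C0_infinity \<Omega>" by (rule C0_infinity_mono[OF B(1) \<phi>])
    note [measurable] = cont[OF \<phi> i]
    have pd: "partial_deriv i \<phi> \<in> C0_infinity B" by (rule partial_deriv_C0_infinity[OF \<phi> i])
    have e1: "(\<integral>x. - u x * partial_deriv i \<phi> x \<partial>lebesgue_on \<Omega>) = (LBINT x. - ((m + w x) * partial_deriv i \<phi> x))"
    proof (rule lebesgue_on_eq_lborel(1)[OF \<Omega>L])
      show "(\<lambda>x. - u x * partial_deriv i \<phi> x) \<in> borel_measurable (lebesgue_on \<Omega>)"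
        using um lift[OF cont(3)[OF \<phi> i]] by measurable
      show "AE x in lborel. indicator \<Omega> x *\<^sub>R (- u x * partial_deriv i \<phi> x) = - ((m + w x) * partial_deriv i \<phi> x)"
        using uw
      proof eventually_elim
        case (elim x)
        then show ?case using zero(2)[OF \<phi>, of x i] B(1) by (cases "x \<in> B") (auto simp: indicator_def algebra_simps)
      qed
    qed measurable
    have e2: "(\<integral>x. (G x \<bullet> i) * \<phi> x \<partial>lebesgue_on \<Omega>) = (LBINT x. - ((g x \<bullet> i) * \<phi> x))"
    proof (rule lebesgue_on_eq_lborel(1)[OF \<Omega>L])
      show "(\<lambda>x. (G x \<bullet> i) * \<phi> x) \<in> borel_measurable (lebesgue_on \<Omega>)"
        using Gm lift[OF cont(1)[OF \<phi> i]] by measurable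
      show "AE x in lborel. indicator \<Omega> x *\<^sub>R ((G x \<bullet> i) * \<phi> x) = - ((g x \<bullet> i) * \<phi> x)"
        using Gg
      proof eventually_elim
        case (elim x)
        then show ?case using zero(1)[OF \<phi>, of x] B(1) by (cases "x \<in> B") (auto simp: indicator_def)
      qed
    qed measurable
    have "(\<integral>x. - u x * partial_deriv i \<phi> x \<partial>lebesgue_on \<Omega>) = - (\<integral>x. (G x \<bullet> i) * \<phi> x \<partial>lebesgue_on \<Omega>)"
      using G \<phi>\<Omega> i unfolding has_weak_gradient_def by blast
    then have E: "(LBINT x. (m + w x) * partial_deriv i \<phi> x) = - (LBINT x. (g x \<bullet> i) * \<phi> x)"
      unfolding e1 e2 Bochner_Integration.integral_minus by simp
    have pdi: "integrable lborel (partial_deriv i \<phi>)" by (rule C0_infinity_integrable[OF pd])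
    obtain K where K: "compact K" "K \<subseteq> B" "\<And>x. x \<notin> K \<Longrightarrow> partial_deriv i \<phi> x = 0"
      using C0_infinity_support[OF pd] by blast
    have "integrable lborel (\<lambda>x. w x \<bullet> partial_deriv i \<phi> x)"
      by (rule integrable_inner_compact_support[OF wi C0_infinity_continuous[OF pd] K(1,3)])
    then have wpd: "integrable lborel (\<lambda>x. w x * partial_deriv i \<phi> x)" by simp
    have C: "C1_grad \<phi> (grad \<phi>)" by (rule C0_infinity_C1_grad[OF \<phi>])
    obtain L where L: "compact L" "L \<subseteq> B" "\<And>x. x \<notin> L \<Longrightarrow> \<phi> x = 0"
      using C0_infinity_support[OF \<phi>] by blast
    have gr: "integrable lborel (grad \<phi>)"
      by (rule continuous_compact_support_integrable[OF _ L(1)])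
        (use C C1_grad_eq_0_off_closed[OF C compact_imp_closed[OF L(1)] L(3)] in \<open>auto simp: C1_grad_def\<close>)
    \<comment> \<open>The constant m drops out of the weak gradient identity because the derivative
      of a test function has integral 0.\<close>
    have "(LBINT x. partial_deriv i \<phi> x) = (LBINT x. grad \<phi> x \<bullet> i)"
      by (simp add: C1_grad_partial_deriv[OF C])
    also have "\<dots> = (LBINT x. grad \<phi> x) \<bullet> i" using gr by (intro integral_inner_left) auto
    also have "\<dots> = 0" using integral_gradient_eq_0[OF C L(1,3)] by simp
    finally have "(LBINT x. partial_deriv i \<phi> x) = 0" .
    then have "(LBINT x. (m + w x) * partial_deriv i \<phi> x) = (LBINT x. w x * partial_deriv i \<phi> x)"
      using pdi wpd unfolding distrib_right by simp
    with E show "(LBINT x. w x * partial_deriv i \<phi> x) = - (LBINT x. (g x \<bullet> i) * \<phi> x)" by simp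
  next
    fix \<phi> :: "'a \<Rightarrow> real"
    assume \<phi>0: "\<phi> \<in> C0_infinity (ball 0 d - {0})" and pos: "\<And>x. 0 \<le> \<phi> x"
    have \<phi>: "\<phi> \<in> C0_infinity B" by (rule C0_infinity_mono[OF _ \<phi>0]) (auto simp: B_def)
    have \<phi>\<Omega>: "\<phi> \<in> C0_infinity \<Omega>" by (rule C0_infinity_mono[OF B(1) \<phi>])
    obtain i :: 'a where i: "i \<in> Basis" by (meson nonempty_Basis ex_in_conv)
    note [measurable] = cont(1,2)[OF \<phi> i]
    let ?H = "\<lambda>x. (norm (g x) powr (p - 2) *\<^sub>R g x) \<bullet> grad \<phi> x - \<mu> / norm x powr p * (m + w x) powr (p - 1) * \<phi> x"
    have "(\<integral>x. (norm (G x) powr (p - 2) *\<^sub>R G x) \<bullet> grad \<phi> x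
        - \<mu> / norm x powr p * \<bar>- u x\<bar> powr (p - 2) * - u x * \<phi> x \<partial>lebesgue_on \<Omega>)
      \<le> (\<integral>x. f x * \<bar>- u x\<bar> powr (p - 2) * - u x * \<phi> x \<partial>lebesgue_on \<Omega>)"
      using super \<phi>\<Omega> pos unfolding weak_supersolution_def weak_subsolution_def G_def by blast
    \<comment> \<open>Here f \<ge> 0 and u > 0 settle the sign of the right-hand side, and f leaves
      the problem.\<close>
    also have "\<dots> \<le> 0"
    proof -
      have "AE x in lebesgue_on \<Omega>. 0 \<le> f x * \<bar>- u x\<bar> powr (p - 2) * u x * \<phi> x"
        using f m(2)
      proof eventually_elim
        case (elim x)
        then show ?case using m(1) pos[of x] by simp
      qed
      then have "0 \<le> (\<integral>x. f x * \<bar>- u x\<bar> powr (p - 2) * u x * \<phi> x \<partial>lebesgue_on \<Omega>)"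
        by (rule integral_nonneg_AE)
      then show ?thesis by simp
    qed
    also have "(\<integral>x. (norm (G x) powr (p - 2) *\<^sub>R G x) \<bullet> grad \<phi> x
        - \<mu> / norm x powr p * \<bar>- u x\<bar> powr (p - 2) * - u x * \<phi> x \<partial>lebesgue_on \<Omega>) = (LBINT x. - ?H x)"
    proof (rule lebesgue_on_eq_lborel(1)[OF \<Omega>L])
      have [measurable]: "(\<lambda>x. norm x) \<in> borel_measurable (lebesgue_on \<Omega>)"
        by (rule lift) measurable
      show "(\<lambda>x. (norm (G x) powr (p - 2) *\<^sub>R G x) \<bullet> grad \<phi> x
        - \<mu> / norm x powr p * \<bar>- u x\<bar> powr (p - 2) * - u x * \<phi> x) \<in> borel_measurable (lebesgue_on \<Omega>)"
        using Gm um lift[OF cont(1)[OF \<phi> i]] lift[OF cont(2)[OF \<phi> i]] by measurable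
      show "AE x in lborel. indicator \<Omega> x *\<^sub>R ((norm (G x) powr (p - 2) *\<^sub>R G x) \<bullet> grad \<phi> x
        - \<mu> / norm x powr p * \<bar>- u x\<bar> powr (p - 2) * - u x * \<phi> x) = - ?H x"
        using uw Gg mu
      proof eventually_elim
        case (elim x)
        show ?case
        proof (cases "x \<in> B")
          case True
          then have x: "x \<in> \<Omega>" using B(1) by blast
          then have u: "u x = m + w x" "G x = - g x" "0 < u x" using elim True m(1) by auto
          have "\<bar>- u x\<bar> powr (p - 2) * u x = u x powr (p - 1)"
            using u(3) by (simp add: powr_diff power2_eq_square)
          then have "\<mu> / norm x powr p * \<bar>- u x\<bar> powr (p - 2) * - u x * \<phi> x = - (\<mu> / norm x powr p * u x powr (p - 1) * \<phi> x)"
            by (metis (no_types, lifting) mult.assoc mult_minus_left mult_minus_right)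
          then show ?thesis using x u(1,2) by simp
        next
          case False
          then show ?thesis using zero(1,3)[OF \<phi> False] by simp
        qed
      qed
    qed measurable
    finally show "0 \<le> (LBINT x. ?H x)" by (simp only: Bochner_Integration.integral_minus neg_le_0_iff_le)
  qed
  then show thesis using uw unfolding B_def by (rule that)
qed

section \<open>The bound on the whole domain\<close>

theorem theorem1p4:
  fixes p \<mu> \<gamma>\<^sub>1 \<gamma>\<^sub>2 m C :: real
    and \<Omega> :: "'a::euclidean_space set"
    and f u :: "'a \<Rightarrow> real"
  assumes "1 < p" and "p < real DIM('a)"
    and "0 \<le> \<mu>" and "\<mu> < ((real DIM('a) - p) / p) powr p"
    and "\<gamma>\<^sub>1 < \<gamma>\<^sub>2"
    and "{\<gamma>. 0 \<le> \<gamma> \<and>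
           (p - 1) * \<gamma> powr p - (real DIM('a) - p) * \<gamma> powr (p - 1) + \<mu> = 0} = {\<gamma>\<^sub>1, \<gamma>\<^sub>2}"
    and "open \<Omega>" and "connected \<Omega>" and "bounded \<Omega>" and "0 \<in> \<Omega>"
    and "in_Lp (real DIM('a) / p) \<Omega> f" and "AE x in lebesgue_on \<Omega>. 0 \<le> f x"
    and "u \<in> D1p p \<Omega>" and "AE x in lebesgue_on \<Omega>. 0 \<le> u x"
    and "weak_supersolution p \<mu> f \<Omega> u"
    and "m = real_of_ereal (ess_inf \<Omega> u)"
    and "C = (INF x\<in>frontier \<Omega>. norm x powr \<gamma>\<^sub>1)"
  shows "AE x in lebesgue_on \<Omega>. u x \<ge> C * m * norm x powr (- \<gamma>\<^sub>1)"
proof -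
  have \<Omega>L: "\<Omega> \<in> sets lebesgue" using \<open>open \<Omega>\<close> by (simp add: borel_open)
  note root = smaller_root[OF assms(1-6)]
  define d where "d = infdist 0 (frontier \<Omega>)"
  have ne: "frontier \<Omega> \<noteq> {}"
    using \<open>0 \<in> \<Omega>\<close> \<open>bounded \<Omega>\<close> not_bounded_UNIV by (auto simp: frontier_eq_empty)
  obtain y where y: "y \<in> frontier \<Omega>" "d = norm y"
    using infdist_attains_inf[OF frontier_closed ne, of 0] by (auto simp: d_def)
  have y0: "y \<noteq> 0" using y(1) \<open>0 \<in> \<Omega>\<close> \<open>open \<Omega>\<close> by (auto simp: frontier_def interior_open)
  then have d: "0 < d" using y by simp
  \<comment> \<open>A ball that meets \<Omega> without lying in it would, being connected, meet the
    boundary at a distance below d.\<close>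
  have ball: "ball 0 d \<subseteq> \<Omega>"
  proof (rule ccontr)
    assume "\<not> ball 0 d \<subseteq> \<Omega>"
    moreover have "ball 0 d \<inter> \<Omega> \<noteq> {}" using \<open>0 \<in> \<Omega>\<close> d centre_in_ball[of 0 d] by blast
    ultimately have "ball 0 d \<inter> frontier \<Omega> \<noteq> {}"
      by (intro connected_Int_frontier connected_ball) auto
    then obtain z where "z \<in> frontier \<Omega>" "norm z < d" by auto
    then show False using infdist_le[of z "frontier \<Omega>" 0] by (simp add: d_def)
  qed
  have C0: "0 \<le> C" unfolding \<open>C = _\<close> by (rule cINF_greatest[OF ne]) simp
  \<comment> \<open>The infimum is bounded by its value at the boundary point y nearest to the
    origin.\<close>
  have Cd: "C \<le> d powr \<gamma>\<^sub>1"
    unfolding \<open>C = _\<close> y(2) by (rule cINF_lower[OF _ y(1)]) (auto intro!: bdd_belowI2[where m = 0])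
  have nonzero: "AE x in lborel. x \<noteq> (0::'a)" by (rule AE_lborel_singleton)
  show ?thesis
  proof (cases "0 < m")
    \<comment> \<open>This case includes an infinite essential infimum, which
      \<open>real_of_ereal\<close> sends to 0. The claimed bound is then at most 0.\<close>
    case False
    then have le0: "C * m * norm x powr (- \<gamma>\<^sub>1) \<le> 0" for x :: 'a
      using C0 by (intro mult_nonpos_nonneg mult_nonneg_nonpos) auto
    show ?thesis
      using assms(14) by eventually_elim (rule order_trans[OF le0])
  next
    case True
    have "AE x in lebesgue_on \<Omega>. m \<le> u x"
    proof -
      define e where "e = esssup (lebesgue_on \<Omega>) (\<lambda>x. - ereal (u x))"
      have "m = real_of_ereal (- e)" using assms(16) by (simp add: ess_inf_def e_def)
      \<comment> \<open>An infinite e would make m equal to 0, so e is finite.\<close>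
      then have "e = ereal (- m)" using True by (cases e) auto
      then have "AE x in lebesgue_on \<Omega>. - ereal (u x) \<le> ereal (- m)"
        using esssup_AE[of "\<lambda>x. - ereal (u x)" "lebesgue_on \<Omega>"] by (simp add: e_def)
      then show ?thesis by eventually_elim simp
    qed
    note mu = this
    obtain w g where P: "positive_supersolution p \<mu> d m w g" and uw: "AE x in lborel. x \<in> ball 0 d \<longrightarrow> u x = m + w x"
      by (rule weak_supersolution_positive_supersolution[OF assms(1,2) \<open>open \<Omega>\<close> ball assms(12,13,15) True mu])
    interpret positive_supersolution p \<mu> d m w g by (rule P)
    have low: "AE x in lborel. x \<in> ball 0 d \<longrightarrow> 0 < \<gamma>\<^sub>1 \<longrightarrow> x \<noteq> 0 \<longrightarrow> m * (norm x / d) powr (- \<gamma>\<^sub>1) \<le> u x"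
    proof (cases "0 < \<gamma>\<^sub>1")
      case True
      have "AE x in lborel. x \<noteq> 0 \<longrightarrow> m * (norm x / d) powr (- \<gamma>\<^sub>1) \<le> m + w x"
        by (rule radial_lower_bound_limit[OF d True root(2)]) (rule root(3))
      then show ?thesis using uw by eventually_elim auto
    qed simp
    have "AE x in lborel. x \<in> \<Omega> \<longrightarrow> m \<le> u x" using mu by (simp only: AE_lebesgue_on_iff[OF \<Omega>L])
    then have "AE x in lborel. x \<in> \<Omega> \<longrightarrow> C * m * norm x powr (- \<gamma>\<^sub>1) \<le> u x"
      using low nonzero
    proof eventually_elim
      case (elim x)
      show ?case
      proof
        assume x: "x \<in> \<Omega>"
        have "C * m * norm x powr (- \<gamma>\<^sub>1) \<le> d powr \<gamma>\<^sub>1 * m * norm x powr (- \<gamma>\<^sub>1)"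
          using Cd True by (intro mult_right_mono) auto
        also have "\<dots> = m * (norm x / d) powr (- \<gamma>\<^sub>1)"
          using d elim(3) by (simp add: powr_divide powr_minus_divide)
        \<comment> \<open>The radial bound is available for a positive exponent and |x| < d.
          Otherwise \<open>(norm x / d) powr (- \<gamma>\<^sub>1)\<close> is at most 1 and u \<ge> m
          suffices; the exponent 0 occurs when \<mu> = 0.\<close>
        also have "\<dots> \<le> u x"
        proof (cases "0 < \<gamma>\<^sub>1 \<and> norm x < d")
          case True
          then show ?thesis using elim by simp
        next
          case False
          have "(norm x / d) powr (- \<gamma>\<^sub>1) \<le> 1"
          proof (cases "\<gamma>\<^sub>1 = 0")
            case False
            with \<open>\<not> (0 < \<gamma>\<^sub>1 \<and> norm x < d)\<close> root(1) have "d \<le> norm x" by auto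
            then have "1 \<le> (norm x / d) powr \<gamma>\<^sub>1" using d root(1) by (intro ge_one_powr_ge_zero) auto
            then show ?thesis by (simp add: powr_minus inverse_le_1_iff)
          qed (use d elim(3) in simp)
          then have "m * (norm x / d) powr (- \<gamma>\<^sub>1) \<le> m" using True by simp
          then show ?thesis using elim(1) x by simp
        qed
        finally show "C * m * norm x powr (- \<gamma>\<^sub>1) \<le> u x" .
      qed
    qed
    then show ?thesis unfolding AE_lebesgue_on_iff[OF \<Omega>L] .
  qed
qed

end
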